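(* Let $r\ge 2$ be an integer and let $H$ be a fixed graph with at least one edge. Then there exists a constant $\beta_{r,H}>0$, effectively computable from a finite collection of rational linear programs whose sizes depend only on $r$ and $H$, such that $$Rt_r(H;K_n)=(\beta_{r,H}+o(1))\,n\qquad\text{as }n\to\infty.$$ Consequently, $$R_r(kH)=\left(\frac{1}{\beta_{r,H}}+o(1)\right)k\qquad\text{as }k\to\infty.$$
   Context: For an edge-colouring $\chi:E(K_n)\to[r]$, let $\nu_H(\chi)$ be the maximum over colours $\ell\in[r]$ of the maximum number of vertex-disjoint copies of $H$ all of whose edges have colour $\ell$. Then $Rt_r(H;K_n):=\min_{\chi:E(K_n)\to[r]}\nu_H(\chi)$. $kH$ denotes the disjoint union of $k$ copies of $H$, and $R_r(kH)$ is the least $n$ such that every $r$-edge-colouring of $K_n$ contains a monochromatic copy of $kH$. The paper's constant $\beta_{r,H}$ is the following. For $q\ge 1$, an $r$-colour $q$-strip template is a map $\lambda:\{(i,j):1\le i\le j\le q\}\to[r]$, regarded as symmetric (that is, $\lambda(j,i):=\lambda(i,j)$). For $\ell\in[r]$ let $\Phi_\ell(\lambda)$ be the set of maps $f:V(H)\to[q]$ with $\lambda(f(u),f(v))=\ell$ for every $uv\in E(H)$, and put $a_i(f):=|f^{-1}(i)|$. For $x\in\mathbb R_{\ge 0}^q$ let $\tau_\ell(\lambda,x)$ be the maximum of $\sum_{f\in\Phi_\ell(\lambda)}w_f$ over $w_f\ge 0$ subject to $\sum_{f\in\Phi_\ell(\lambda)}a_i(f)w_f\le x_i$ for all $i\in[q]$.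 With $\Delta_q=\{x\in\mathbb R_{\ge0}^q:\sum_i x_i=1\}$, $$\beta_{r,H}:=\min_{1\le q\le r}\ \min_{\lambda}\ \min_{x\in\Delta_q}\ \max_{\ell\in[r]}\tau_\ell(\lambda,x).$$ "Effectively computable" means that there is an algorithm which, given $r$ and $H$, computes $\beta_{r,H}$ by solving finitely many linear programs with rational coefficients whose sizes depend only on $r$ and $H$. *)

theory Defs
  imports
    Complex_Main
    "HOL-Library.FuncSet"
    "HOL-Library.Nat_Bijection"
    "HOL-Library.Landau_Symbols"
begin

section \<open>Graphs and monochromatic copies\<close>

type_synonym 'a graph = "'a set \<times> 'a set set"

abbreviation verts :: "'a graph \<Rightarrow> 'a set" where "verts H \<equiv> fst H"
abbreviation edges :: "'a graph \<Rightarrow> 'a set set" where "edges H \<equiv> snd H"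

definition finite_graph :: "'a graph \<Rightarrow> bool" where
  "finite_graph H \<longleftrightarrow> finite (verts H) \<and> (\<forall>e\<in>edges H. e \<subseteq> verts H \<and> card e = 2)"

definition complete_edges :: "nat \<Rightarrow> nat set set" where
  "complete_edges n = {e. e \<subseteq> {..<n} \<and> card e = 2}"

definition colourings :: "nat \<Rightarrow> nat \<Rightarrow> (nat set \<Rightarrow> nat) set" where
  "colourings r n = complete_edges n \<rightarrow>\<^sub>E {1..r}"

definition image_graph :: "('a \<Rightarrow> 'b) \<Rightarrow> 'a graph \<Rightarrow> 'b graph" where
  "image_graph f H = (f ` verts H, (\<lambda>e. f ` e) ` edges H)"

text \<open>The subgraphs of \<open>K\<^sub>n\<close>, with vertex set \<open>{..<n}\<close>, that are isomorphic to \<open>H\<close> and have all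
  edges of colour \<open>l\<close>. Isolated vertices of \<open>H\<close> are part of a copy.\<close>

definition mono_copies :: "nat \<Rightarrow> (nat set \<Rightarrow> nat) \<Rightarrow> nat \<Rightarrow> 'a graph \<Rightarrow> nat graph set" where
  "mono_copies n \<chi> l H =
     {image_graph f H | f. inj_on f (verts H) \<and> f ` verts H \<subseteq> {..<n} \<and>
                           (\<forall>e\<in>edges H. \<chi> (f ` e) = l)}"

definition mono_tiling_number :: "nat \<Rightarrow> (nat set \<Rightarrow> nat) \<Rightarrow> nat \<Rightarrow> 'a graph \<Rightarrow> nat" where
  "mono_tiling_number n \<chi> l H =
     Max {card C | C. C \<subseteq> mono_copies n \<chi> l H \<and>
                      pairwise (\<lambda>K K'. disjnt (verts K) (verts K')) C}"

definition tiling_number :: "nat \<Rightarrow> nat \<Rightarrow> 'a graph \<Rightarrow> (nat set \<Rightarrow> nat) \<Rightarrow> nat" where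
  "tiling_number r n H \<chi> = Max ((\<lambda>l. mono_tiling_number n \<chi> l H) ` {1..r})"

definition Rt :: "nat \<Rightarrow> 'a graph \<Rightarrow> nat \<Rightarrow> nat" where
  "Rt r H n = Min (tiling_number r n H ` colourings r n)"

definition disjoint_copies :: "nat \<Rightarrow> 'a graph \<Rightarrow> ('a \<times> nat) graph" where
  "disjoint_copies k H =
     (verts H \<times> {..<k}, {(\<lambda>v. (v, j)) ` e | e j. e \<in> edges H \<and> j < k})"

definition ramsey_number :: "nat \<Rightarrow> 'a graph \<Rightarrow> nat" where
  "ramsey_number r G =
     (LEAST n. \<forall>\<chi>\<in>colourings r n. \<exists>l\<in>{1..r}. mono_copies n \<chi> l G \<noteq> {})"


section \<open>Strip templates and the constant \<open>\<beta>\<close>\<close>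

text \<open>A template is given by its symmetric extension; its values matter on \<open>{1..q} \<times> {1..q}\<close> only.\<close>

definition strip_template :: "nat \<Rightarrow> nat \<Rightarrow> (nat \<Rightarrow> nat \<Rightarrow> nat) \<Rightarrow> bool" where
  "strip_template r q lam \<longleftrightarrow>
     (\<forall>i\<in>{1..q}. \<forall>j\<in>{1..q}. lam i j \<in> {1..r} \<and> lam j i = lam i j)"

definition template_maps ::
  "'a graph \<Rightarrow> nat \<Rightarrow> (nat \<Rightarrow> nat \<Rightarrow> nat) \<Rightarrow> nat \<Rightarrow> ('a \<Rightarrow> nat) set" where
  "template_maps H q lam l =
     {f \<in> verts H \<rightarrow>\<^sub>E {1..q}. \<forall>u v. {u, v} \<in> edges H \<longrightarrow> lam (f u) (f v) = l}"

definition fibre_size :: "'a graph \<Rightarrow> ('a \<Rightarrow> nat) \<Rightarrow> nat \<Rightarrow> nat" where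
  "fibre_size H f i = card {v \<in> verts H. f v = i}"

text \<open>The linear program defining \<open>\<tau>\<close> has a compact nonempty feasible region, and the minimum
  defining \<open>\<beta>\<close> ranges over finitely many compact simplices, so supremum and infimum below are the
  maximum and the minimum.\<close>

definition tau ::
  "'a graph \<Rightarrow> nat \<Rightarrow> (nat \<Rightarrow> nat \<Rightarrow> nat) \<Rightarrow> nat \<Rightarrow> (nat \<Rightarrow> real) \<Rightarrow> real" where
  "tau H q lam l x =
     Sup {(\<Sum>f\<in>template_maps H q lam l. w f) | w.
            (\<forall>f\<in>template_maps H q lam l. 0 \<le> w f) \<and>
            (\<forall>i\<in>{1..q}. (\<Sum>f\<in>template_maps H q lam l. real (fibre_size H f i) * w f) \<le> x i)}"

definition weight_simplex :: "nat \<Rightarrow> (nat \<Rightarrow> real) set" where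
  "weight_simplex q = {x. (\<forall>i\<in>{1..q}. 0 \<le> x i) \<and> (\<Sum>i\<in>{1..q}. x i) = 1}"

definition beta :: "nat \<Rightarrow> 'a graph \<Rightarrow> real" where
  "beta r H =
     Inf {Max ((\<lambda>l. tau H q lam l x) ` {1..r}) | q lam x.
            1 \<le> q \<and> q \<le> r \<and> strip_template r q lam \<and> x \<in> weight_simplex q}"


section \<open>Algorithms\<close>

text \<open>The total recursive functions: unary, with several arguments packed by the pairing bijection
  \<open>prod_encode\<close>, closed under primitive recursion and minimization of regular functions.\<close>

inductive recursive :: "(nat \<Rightarrow> nat) \<Rightarrow> bool" where
  zero: "recursive (\<lambda>_. 0)"
| suc: "recursive Suc"
| first: "recursive (\<lambda>a. fst (prod_decode a))"
| second: "recursive (\<lambda>a. snd (prod_decode a))"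
| pair: "recursive f \<Longrightarrow> recursive g \<Longrightarrow> recursive (\<lambda>a. prod_encode (f a, g a))"
| comp: "recursive f \<Longrightarrow> recursive g \<Longrightarrow> recursive (\<lambda>a. f (g a))"
| prim_rec: "recursive f \<Longrightarrow> recursive g \<Longrightarrow>
    recursive (\<lambda>a. rec_nat (f (fst (prod_decode a)))
      (\<lambda>m y. g (prod_encode (fst (prod_decode a), prod_encode (m, y)))) (snd (prod_decode a)))"
| minimize: "recursive f \<Longrightarrow> (\<And>a. \<exists>m. f (prod_encode (a, m)) = 0) \<Longrightarrow>
    recursive (\<lambda>a. LEAST m. f (prod_encode (a, m)) = 0)"

text \<open>As input for an algorithm, a graph is given, up to isomorphism, by its number \<open>n\<close> of vertices
  and a list of edges on the vertex set \<open>{..<n}\<close>.\<close>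

definition presents :: "nat \<Rightarrow> (nat \<times> nat) list \<Rightarrow> 'a graph \<Rightarrow> bool" where
  "presents n es H \<longleftrightarrow>
     (\<forall>(u, v)\<in>set es. u < n \<and> v < n) \<and>
     (\<exists>g. bij_betw g {..<n} (verts H) \<and> edges H = {{g u, g v} | u v. (u, v) \<in> set es})"

definition encode_input :: "nat \<Rightarrow> nat \<Rightarrow> (nat \<times> nat) list \<Rightarrow> nat" where
  "encode_input r n es =
     prod_encode (r, prod_encode (n, list_encode (map prod_encode es)))"

text \<open>The pair \<open>(c, rows)\<close> is the linear program of minimizing \<open>c \<bullet> x\<close> over all real vectors \<open>x\<close> with
  \<open>a \<bullet> x \<le> b\<close> for all \<open>(a, b)\<close> in \<open>rows\<close>; the number of variables is the length of \<open>c\<close>.\<close>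

type_synonym rat_lp = "rat list \<times> (rat list \<times> rat) list"

definition lp_wf :: "rat_lp \<Rightarrow> bool" where
  "lp_wf P \<longleftrightarrow> (\<forall>(a, b)\<in>set (snd P). length a = length (fst P))"

definition lp_dot :: "rat list \<Rightarrow> real list \<Rightarrow> real" where
  "lp_dot a x = (\<Sum>i<length a. of_rat (a ! i) * x ! i)"

definition lp_feasible :: "rat_lp \<Rightarrow> real list \<Rightarrow> bool" where
  "lp_feasible P x \<longleftrightarrow>
     length x = length (fst P) \<and> (\<forall>(a, b)\<in>set (snd P). lp_dot a x \<le> of_rat b)"

definition lp_optimum :: "rat_lp \<Rightarrow> real \<Rightarrow> bool" where
  "lp_optimum P v \<longleftrightarrow>
     (\<exists>x. lp_feasible P x \<and> lp_dot (fst P) x = v) \<and>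
     (\<forall>x. lp_feasible P x \<longrightarrow> v \<le> lp_dot (fst P) x)"

definition decode_rat :: "nat \<Rightarrow> rat" where
  "decode_rat m = (case prod_decode m of (p, d) \<Rightarrow> of_int (int_decode p) / of_nat d)"

definition decode_row :: "nat \<Rightarrow> rat list \<times> rat" where
  "decode_row m = (case prod_decode m of
     (a, b) \<Rightarrow> (map decode_rat (list_decode a), decode_rat b))"

definition decode_lp :: "nat \<Rightarrow> rat_lp" where
  "decode_lp m = (case prod_decode m of
     (c, rows) \<Rightarrow> (map decode_rat (list_decode c), map decode_row (list_decode rows)))"

definition decode_lps :: "nat \<Rightarrow> rat_lp list" where
  "decode_lps m = map decode_lp (list_decode m)"

text \<open>The number \<open>\<beta>\<close> is computed from the programs \<open>Ps\<close>: all of them are solvable, and \<open>\<beta>\<close> is the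
  least of their optimal values.\<close>

definition computed_by_lps :: "rat_lp list \<Rightarrow> real \<Rightarrow> bool" where
  "computed_by_lps Ps \<beta> \<longleftrightarrow>
     Ps \<noteq> [] \<and> (\<forall>P\<in>set Ps. lp_wf P) \<and>
     (\<exists>vs. list_all2 lp_optimum Ps vs \<and> \<beta> = Min (set vs))"

end

theory Submission
  imports
    Defs
    "HOL-Analysis.Henstock_Kurzweil_Integration"
    "HOL-Library.Ramsey"
begin

text \<open>
  A \<^emph>\<open>cover\<close> of a template assigns to each colour \<open>l\<close> nonnegative weights of the strips such that
  every template map of colour \<open>l\<close> has total weight at least 1. Covers are the dual solutions of the
  programs for \<open>tau\<close>, so the averages of a cover, taken with the sizes of the strips, bound \<open>beta\<close> from
  above (\<open>beta_le_cover_bound\<close>). Two comparisons determine the growth of \<open>Rt\<close>.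

  A colouring by strips is at most as good as its template: the copies of a tiling, counted by the
  strips of their vertices, form a packing (\<open>Rt_le_template_value\<close>). Hence \<open>Rt\<close> is at most
  \<open>(beta + o(1)) n\<close>.

  Conversely, every colouring produces a template with a cover whose averages are at most
  the normalized tiling number plus \<open>o(1)\<close> (\<open>colouring_gives_cover\<close>). For a colour \<open>l\<close>, the largest
  number of disjoint copies inside a vertex set \<open>S\<close> is a game that grows by 0 or 1 when a vertex joins,
  and the weight of a vertex is its Shapley value, the expected increase when it joins a random set of
  random density, up to a cut-off. The sum of these weights is at most the tiling number. The vertex set \<open>X\<close> of a
  copy always adds at least 1 to the game; if the increases due to the vertices of \<open>X\<close> did not depend
  on each other, their expectations would add up to at least 1, as a cover requires. They are almost
  independent for most copies: indicators of disjoint patterns in a random set are uncorrelated, so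
  that only boundedly many disjoint patterns can influence the increase due to \<open>v\<close> noticeably
  (\<open>disjoint_patterns_influence\<close>), and a bounded set \<open>Z v\<close> of vertices meets all those that do
  (\<open>bad_patterns_transversal\<close>). Vertices with almost equal weights in all colours are put into one
  class. Ramsey's theorem finds in the large classes sets between which the colouring is constant;
  if one records in the colour of a pair also whether one end lies in the set \<open>Z\<close> of the other, these
  sets avoid such pairs, since there are too few of them (\<open>homogeneous_good_classes\<close>). This yields
  a template and a cover. As only the \<open>r\<close> averages of the cover matter, an optimal distribution of
  weights is supported by \<open>r\<close> strips (\<open>averages_with_small_support\<close>).

  Both comparisons together show that \<open>Rt\<close> is \<open>(beta + o(1)) n\<close> and also that \<open>beta\<close> is the infimum
  of the averages of covers (\<open>cover_bound_near_beta\<close>). A colouring contains \<open>k H\<close> in one colour iff its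
  tiling number is at least \<open>k\<close>, so the Ramsey number is the generalized inverse of \<open>Rt\<close>.

  For the computability of \<open>beta\<close>, covers and then sizes of strips may be replaced by vertices of their
  polyhedra, whose coordinates have bounded numerators and denominators (\<open>bounded_vertex\<close>). This leaves
  finitely many candidates, which a recursive function can search. Its output is the linear program
  in one variable whose optimal value is the fraction that was found.
\<close>


section \<open>Random subsets\<close>

text \<open>The expectation of \<open>G\<close> at the random subset of \<open>V\<close> that contains each element
  independently with probability \<open>t\<close>.\<close>

definition subset_expectation :: "real \<Rightarrow> 'v set \<Rightarrow> ('v set \<Rightarrow> real) \<Rightarrow> real" where
  "subset_expectation t V G = (\<Sum>S\<in>Pow V. t ^ card S * (1 - t) ^ card (V - S) * G S)"

lemma subset_expectation_empty: "subset_expectation t {} G = G {}"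
  by (simp add: subset_expectation_def)

lemma subset_expectation_cong:
  "(\<And>S. S \<subseteq> V \<Longrightarrow> G S = G' S) \<Longrightarrow> subset_expectation t V G = subset_expectation t V G'"
  unfolding subset_expectation_def by (rule sum.cong) auto

lemma subset_expectation_insert:
  assumes "finite V" "v \<notin> V"
  shows "subset_expectation t (insert v V) G =
    t * subset_expectation t V (\<lambda>S. G (insert v S)) + (1 - t) * subset_expectation t V G"
proof -
  have inj: "inj_on (insert v) (Pow V)"
    using assms(2) by (auto simp: inj_on_def)
  have "subset_expectation t (insert v V) G =
     (\<Sum>S\<in>Pow V. t ^ card S * (1 - t) ^ card (insert v V - S) * G S) +
     (\<Sum>S\<in>insert v ` Pow V. t ^ card S * (1 - t) ^ card (insert v V - S) * G S)"
    unfolding subset_expectation_def Pow_insert using assms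
    by (subst sum.union_disjoint) auto
  also have "(\<Sum>S\<in>Pow V. t ^ card S * (1 - t) ^ card (insert v V - S) * G S) =
      (\<Sum>S\<in>Pow V. (1 - t) * (t ^ card S * (1 - t) ^ card (V - S) * G S))"
  proof (rule sum.cong)
    fix S assume "S \<in> Pow V"
    then have "insert v V - S = insert v (V - S)" "v \<notin> V - S" using assms by auto
    then have "card (insert v V - S) = Suc (card (V - S))" using assms(1) by simp
    then show "t ^ card S * (1 - t) ^ card (insert v V - S) * G S =
       (1 - t) * (t ^ card S * (1 - t) ^ card (V - S) * G S)" by simp
  qed simp
  also have "(\<Sum>S\<in>insert v ` Pow V. t ^ card S * (1 - t) ^ card (insert v V - S) * G S) =
      (\<Sum>S\<in>Pow V. t * (t ^ card S * (1 - t) ^ card (V - S) * G (insert v S)))"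
    unfolding sum.reindex[OF inj] o_def
  proof (rule sum.cong)
    fix S assume S: "S \<in> Pow V"
    then have "insert v V - insert v S = V - S" using assms by auto
    moreover have "card (insert v S) = Suc (card S)"
      using S assms by (metis PowD card_insert_disjoint finite_subset subsetD)
    ultimately show "t ^ card (insert v S) * (1 - t) ^ card (insert v V - insert v S) * G (insert v S) =
       t * (t ^ card S * (1 - t) ^ card (V - S) * G (insert v S))" by simp
  qed simp
  finally show ?thesis
    by (simp add: subset_expectation_def sum_distrib_left)
qed

lemma subset_expectation_const: "finite V \<Longrightarrow> subset_expectation t V (\<lambda>_. c) = c"
  by (induction V rule: finite_induct)
     (auto simp: subset_expectation_empty subset_expectation_insert algebra_simps)

lemma subset_expectation_add:
  "subset_expectation t V (\<lambda>S. G S + G' S) = subset_expectation t V G + subset_expectation t V G'"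
  by (simp add: subset_expectation_def algebra_simps sum.distrib)

lemma subset_expectation_diff:
  "subset_expectation t V (\<lambda>S. G S - G' S) = subset_expectation t V G - subset_expectation t V G'"
  by (simp add: subset_expectation_def algebra_simps sum_subtractf)

lemma subset_expectation_cmult:
  "subset_expectation t V (\<lambda>S. c * G S) = c * subset_expectation t V G"
  by (simp add: subset_expectation_def sum_distrib_left algebra_simps)

lemma subset_expectation_sum:
  "subset_expectation t V (\<lambda>S. \<Sum>i\<in>J. G i S) = (\<Sum>i\<in>J. subset_expectation t V (G i))"
  unfolding subset_expectation_def sum_distrib_left by (rule sum.swap)

lemma subset_expectation_mono:
  assumes "0 \<le> t" "t \<le> 1" "\<And>S. S \<subseteq> V \<Longrightarrow> G S \<le> G' S"
  shows "subset_expectation t V G \<le> subset_expectation t V G'"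
  unfolding subset_expectation_def using assms by (intro sum_mono mult_left_mono) auto

lemma subset_expectation_continuous:
  "continuous_on A (\<lambda>t. subset_expectation t V G)"
  unfolding subset_expectation_def by (intro continuous_intros)

text \<open>Conditioning on \<open>v \<in> S\<close> amounts to adding \<open>v\<close> to the random set.\<close>

lemma subset_expectation_if_in:
  assumes "finite V" "v \<in> V"
  shows "subset_expectation t V (\<lambda>S. if v \<in> S then G S else 0) =
    t * subset_expectation t V (\<lambda>S. G (insert v S))"
proof -
  obtain W where W: "V = insert v W" "v \<notin> W" "finite W"
    using assms by (metis Set.set_insert finite_insert)
  have "subset_expectation t W (\<lambda>S. if v \<in> S then G S else 0) = subset_expectation t W (\<lambda>_. 0)"
    using W by (intro subset_expectation_cong) auto
  then have "subset_expectation t W (\<lambda>S. if v \<in> S then G S else 0) = 0"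
    using W by (simp add: subset_expectation_const)
  then show ?thesis
    unfolding W(1) using W by (simp add: subset_expectation_insert algebra_simps)
qed

lemma subset_expectation_if_out:
  assumes "finite V" "v \<in> V"
  shows "subset_expectation t V (\<lambda>S. if v \<notin> S then G S else 0) =
    (1 - t) * subset_expectation t V (\<lambda>S. G (S - {v}))"
proof -
  obtain W where W: "V = insert v W" "v \<notin> W" "finite W"
    using assms by (metis Set.set_insert finite_insert)
  have "subset_expectation t W (\<lambda>S. if v \<notin> S then G S else 0) = subset_expectation t W G"
    "subset_expectation t W (\<lambda>S. G (S - {v})) = subset_expectation t W G"
    using W by (intro subset_expectation_cong; force)+
  moreover have "subset_expectation t W (\<lambda>S. G (insert v S - {v})) = subset_expectation t W G"
    using W by (intro subset_expectation_cong arg_cong[where f = G]) auto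
  ultimately show ?thesis
    unfolding W(1) using W by (simp add: subset_expectation_insert subset_expectation_const algebra_simps)
qed

definition has_pattern :: "'v set \<Rightarrow> 'v set \<Rightarrow> 'v set \<Rightarrow> bool" where
  "has_pattern I O' S \<longleftrightarrow> I \<subseteq> S \<and> O' \<inter> S = {}"

lemma subset_expectation_pattern_in:
  assumes "finite V" "finite I" "I \<subseteq> V"
  shows "subset_expectation t V (\<lambda>S. if I \<subseteq> S then G S else 0) =
    t ^ card I * subset_expectation t V (\<lambda>S. G (S \<union> I))"
  using assms(2,3)
proof (induction I arbitrary: G rule: finite_induct)
  case empty
  then show ?case by simp
next
  case (insert v I)
  have "subset_expectation t V (\<lambda>S. if insert v I \<subseteq> S then G S else 0) =
      subset_expectation t V (\<lambda>S. if v \<in> S then (if I \<subseteq> S then G S else 0) else 0)"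
    by (intro subset_expectation_cong) auto
  also have "\<dots> = t * subset_expectation t V (\<lambda>S. if I \<subseteq> insert v S then G (insert v S) else 0)"
    using insert assms(1) by (subst subset_expectation_if_in) auto
  also have "subset_expectation t V (\<lambda>S. if I \<subseteq> insert v S then G (insert v S) else 0) =
      subset_expectation t V (\<lambda>S. if I \<subseteq> S then G (insert v S) else 0)"
    using insert by (intro subset_expectation_cong) auto
  also have "\<dots> = t ^ card I * subset_expectation t V (\<lambda>S. G (insert v (S \<union> I)))"
    using insert by (subst insert.IH) auto
  finally show ?case using insert by (simp add: mult_ac)
qed

lemma subset_expectation_pattern_out:
  assumes "finite V" "finite O'" "O' \<subseteq> V"
  shows "subset_expectation t V (\<lambda>S. if O' \<inter> S = {} then G S else 0) =
    (1 - t) ^ card O' * subset_expectation t V (\<lambda>S. G (S - O'))"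
  using assms(2,3)
proof (induction O' arbitrary: G rule: finite_induct)
  case empty
  then show ?case by simp
next
  case (insert v O')
  have "subset_expectation t V (\<lambda>S. if insert v O' \<inter> S = {} then G S else 0) =
      subset_expectation t V (\<lambda>S. if v \<notin> S then (if O' \<inter> S = {} then G S else 0) else 0)"
    by (intro subset_expectation_cong) auto
  also have "\<dots> = (1 - t) * subset_expectation t V (\<lambda>S. if O' \<inter> (S - {v}) = {} then G (S - {v}) else 0)"
    using insert assms(1) by (subst subset_expectation_if_out) auto
  also have "subset_expectation t V (\<lambda>S. if O' \<inter> (S - {v}) = {} then G (S - {v}) else 0) =
      subset_expectation t V (\<lambda>S. if O' \<inter> S = {} then G (S - {v}) else 0)"
    using insert by (intro subset_expectation_cong) (simp add: Diff_Int_distrib Int_Diff)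
  also have "\<dots> = (1 - t) ^ card O' * subset_expectation t V (\<lambda>S. G (S - O' - {v}))"
    using insert by (subst insert.IH) auto
  also have "(\<lambda>S. G (S - O' - {v})) = (\<lambda>S. G (S - insert v O'))"
    by (intro ext arg_cong[where f = G]) auto
  finally show ?case using insert by (simp add: mult_ac)
qed

lemma subset_expectation_pattern:
  assumes "finite V" "I \<subseteq> V" "O' \<subseteq> V" "I \<inter> O' = {}"
  shows "subset_expectation t V (\<lambda>S. if has_pattern I O' S then G S else 0) =
    t ^ card I * (1 - t) ^ card O' * subset_expectation t V (\<lambda>S. G (S \<union> I - O'))"
proof -
  have fin: "finite I" "finite O'" using assms by (auto intro: finite_subset)
  have "subset_expectation t V (\<lambda>S. if has_pattern I O' S then G S else 0) =
     subset_expectation t V (\<lambda>S. if I \<subseteq> S then (if O' \<inter> S = {} then G S else 0) else 0)"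
    by (intro subset_expectation_cong) (auto simp: has_pattern_def)
  also have "\<dots> = t ^ card I * subset_expectation t V (\<lambda>S. if O' \<inter> (S \<union> I) = {} then G (S \<union> I) else 0)"
    using assms fin by (subst subset_expectation_pattern_in) auto
  also have "subset_expectation t V (\<lambda>S. if O' \<inter> (S \<union> I) = {} then G (S \<union> I) else 0) =
     subset_expectation t V (\<lambda>S. if O' \<inter> S = {} then G (S \<union> I) else 0)"
    using assms by (intro subset_expectation_cong) (auto simp: Int_commute Int_Un_distrib)
  also have "\<dots> = (1 - t) ^ card O' * subset_expectation t V (\<lambda>S. G (S - O' \<union> I))"
    using assms fin by (subst subset_expectation_pattern_out) auto
  also have "(\<lambda>S. G (S - O' \<union> I)) = (\<lambda>S. G (S \<union> I - O'))"
    using assms by (intro ext arg_cong[where f = G]) auto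
  finally show ?thesis by simp
qed

text \<open>Russo's formula. Splitting off an element writes the expectation as an affine combination, with
  weights \<open>t\<close> and \<open>1 - t\<close>, of two expectations over the remaining elements.\<close>

lemma subset_expectation_deriv:
  assumes "finite V"
  shows "((\<lambda>t. subset_expectation t V G) has_real_derivative
     (\<Sum>v\<in>V. subset_expectation t V (\<lambda>S. G (insert v S) - G (S - {v})))) (at t within A)"
  using assms
proof (induction V arbitrary: G rule: finite_induct)
  case empty
  then show ?case by (simp add: subset_expectation_empty)
next
  case (insert w V)
  let ?E = "subset_expectation t V"
  have Gw: "?E (\<lambda>S. G (S - {w})) = ?E G"
    using insert by (intro subset_expectation_cong arg_cong[where f = G]) auto
  have Gw2: "?E (\<lambda>S. G (insert w S - {w})) = ?E G"
    using insert by (intro subset_expectation_cong arg_cong[where f = G]) auto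
  have new: "subset_expectation t (insert w V) (\<lambda>S. G (insert w S) - G (S - {w})) =
      ?E (\<lambda>S. G (insert w S)) - ?E G"
    using insert Gw Gw2 by (simp add: subset_expectation_insert subset_expectation_diff algebra_simps)
  have old: "subset_expectation t (insert w V) (\<lambda>S. G (insert v S) - G (S - {v})) =
      t * ?E (\<lambda>S. G (insert w (insert v S)) - G (insert w (S - {v}))) +
      (1 - t) * ?E (\<lambda>S. G (insert v S) - G (S - {v}))" if "v \<in> V" for v
  proof -
    have "insert w S - {v} = insert w (S - {v})" for S using that insert by auto
    then show ?thesis using insert by (simp add: subset_expectation_insert insert_commute)
  qed
  have "((\<lambda>t. t * subset_expectation t V (\<lambda>S. G (insert w S)) + (1 - t) * subset_expectation t V G)
     has_real_derivative
       (?E (\<lambda>S. G (insert w S)) - ?E G) +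
       (t * (\<Sum>v\<in>V. ?E (\<lambda>S. G (insert w (insert v S)) - G (insert w (S - {v})))) +
       (1 - t) * (\<Sum>v\<in>V. ?E (\<lambda>S. G (insert v S) - G (S - {v}))))) (at t within A)"
    by (rule derivative_eq_intros insert.IH refl)+ (simp add: algebra_simps)
  moreover have "(\<Sum>v\<in>insert w V. subset_expectation t (insert w V) (\<lambda>S. G (insert v S) - G (S - {v}))) =
      (?E (\<lambda>S. G (insert w S)) - ?E G) +
       (t * (\<Sum>v\<in>V. ?E (\<lambda>S. G (insert w (insert v S)) - G (insert w (S - {v})))) +
       (1 - t) * (\<Sum>v\<in>V. ?E (\<lambda>S. G (insert v S) - G (S - {v}))))"
    using insert.hyps new old by (simp add: sum.distrib sum_distrib_left)
  ultimately show ?case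
    unfolding subset_expectation_insert[OF insert.hyps] by simp
qed

text \<open>Cauchy--Schwarz against a function that is bounded by 1.\<close>

lemma subset_expectation_square_bound:
  assumes "finite V" "0 \<le> t" "t \<le> 1" "\<And>S. S \<subseteq> V \<Longrightarrow> \<bar>G S\<bar> \<le> 1"
  shows "(subset_expectation t V (\<lambda>S. G S * X S))\<^sup>2 \<le> subset_expectation t V (\<lambda>S. (X S)\<^sup>2)"
proof -
  define m where "m = subset_expectation t V (\<lambda>S. G S * X S)"
  have "0 \<le> subset_expectation t V (\<lambda>S. (G S * X S - m)\<^sup>2)"
    using subset_expectation_mono[of t V "\<lambda>_. 0" "\<lambda>S. (G S * X S - m)\<^sup>2"] assms
    by (simp add: subset_expectation_const)
  also have "(\<lambda>S. (G S * X S - m)\<^sup>2) = (\<lambda>S. (G S * X S)\<^sup>2 - (2 * m) * (G S * X S) + m\<^sup>2)"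
    by (auto simp: power2_eq_square algebra_simps)
  also have "subset_expectation t V \<dots> = subset_expectation t V (\<lambda>S. (G S * X S)\<^sup>2) - m\<^sup>2"
    unfolding subset_expectation_add subset_expectation_diff subset_expectation_cmult
      m_def[symmetric] using assms(1) by (simp add: subset_expectation_const power2_eq_square)
  finally have "m\<^sup>2 \<le> subset_expectation t V (\<lambda>S. (G S * X S)\<^sup>2)" by simp
  also have "\<dots> \<le> subset_expectation t V (\<lambda>S. (X S)\<^sup>2)"
  proof (rule subset_expectation_mono)
    fix S assume "S \<subseteq> V"
    then have "(G S)\<^sup>2 \<le> 1" using assms(4) by (simp add: abs_square_le_1)
    then show "(G S * X S)\<^sup>2 \<le> (X S)\<^sup>2"
      unfolding power_mult_distrib by (simp add: mult_left_le_one_le)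
  qed (use assms in auto)
  finally show ?thesis by (simp add: m_def)
qed

text \<open>Each difference is the correlation of \<open>G\<close> with the indicator of a pattern, divided by its probability
  and centred at 0. For disjoint patterns these variables are uncorrelated, so that the variance of their
  sum is the sum of their variances.\<close>

lemma disjoint_patterns_influence:
  assumes V: "finite V" and t: "0 < t" "t < 1" and G: "\<And>S. S \<subseteq> V \<Longrightarrow> \<bar>G S\<bar> \<le> 1"
    and J: "finite J"
    and IO: "\<And>i. i \<in> J \<Longrightarrow> I i \<subseteq> V" "\<And>i. i \<in> J \<Longrightarrow> O' i \<subseteq> V" "\<And>i. i \<in> J \<Longrightarrow> I i \<inter> O' i = {}"
    and dis: "\<And>i j. i \<in> J \<Longrightarrow> j \<in> J \<Longrightarrow> i \<noteq> j \<Longrightarrow> (I i \<union> O' i) \<inter> (I j \<union> O' j) = {}"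
  shows "(\<Sum>i\<in>J. subset_expectation t V (\<lambda>S. G (S \<union> I i - O' i)) - subset_expectation t V G)\<^sup>2
    \<le> (\<Sum>i\<in>J. 1 / (t ^ card (I i) * (1 - t) ^ card (O' i)))"
proof -
  let ?E = "subset_expectation t V"
  define P where "P i = t ^ card (I i) * (1 - t) ^ card (O' i)" for i
  have Ppos: "P i > 0" for i using t by (simp add: P_def)
  define g where "g i S = (if has_pattern (I i) (O' i) S then 1 / P i else 0) - 1" for i S
  have pat: "?E (\<lambda>S. if has_pattern (I i) (O' i) S then F S else 0) = P i * ?E (\<lambda>S. F (S \<union> I i - O' i))"
    if "i \<in> J" for i F
    using subset_expectation_pattern[OF V IO(1)[OF that] IO(2)[OF that] IO(3)[OF that]] by (simp add: P_def)
  have Eind: "?E (\<lambda>S. if has_pattern (I i) (O' i) S then c else 0) = P i * c" if "i \<in> J" for i c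
    using pat[OF that, of "\<lambda>_. c"] V by (simp add: subset_expectation_const)
  have Gg: "?E (\<lambda>S. G S * g i S) = ?E (\<lambda>S. G (S \<union> I i - O' i)) - ?E G" if "i \<in> J" for i
  proof -
    have "(\<lambda>S. G S * g i S) = (\<lambda>S. (1 / P i) * (if has_pattern (I i) (O' i) S then G S else 0) - G S)"
      by (auto simp: g_def algebra_simps)
    then show ?thesis
      using pat[OF that] Ppos[of i] by (simp only: subset_expectation_diff subset_expectation_cmult) simp
  qed
  have gg: "?E (\<lambda>S. g i S * g j S) \<le> (if i = j then 1 / P i else 0)" if "i \<in> J" "j \<in> J" for i j
  proof (cases "i = j")
    case True
    have "(\<lambda>S. g i S * g i S) =
       (\<lambda>S. (if has_pattern (I i) (O' i) S then (1 / P i)\<^sup>2 - 2 / P i else 0) + 1)"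
      by (auto simp: g_def power2_eq_square algebra_simps)
    then have "?E (\<lambda>S. g i S * g i S) = P i * ((1 / P i)\<^sup>2 - 2 / P i) + 1"
      using Eind[OF that(1)] V by (simp only: subset_expectation_add) (simp add: subset_expectation_const)
    also have "\<dots> = 1 / P i - 1" using Ppos[of i] by (simp add: field_simps power2_eq_square)
    finally show ?thesis using True by simp
  next
    case False
    have dj: "(I i \<union> O' i) \<inter> (I j \<union> O' j) = {}" using dis that False by auto
    have both: "?E (\<lambda>S. if has_pattern (I i \<union> I j) (O' i \<union> O' j) S then c else 0) = P i * P j * c" for c
    proof -
      have fin: "finite (I i)" "finite (I j)" "finite (O' i)" "finite (O' j)"
        using IO that V finite_subset by metis+
      have "card (I i \<union> I j) = card (I i) + card (I j)" "card (O' i \<union> O' j) = card (O' i) + card (O' j)"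
        using dj fin by (auto intro!: card_Un_disjoint)
      moreover have "(I i \<union> I j) \<inter> (O' i \<union> O' j) = {}" using dj IO(3) that by blast
      ultimately show ?thesis
        using subset_expectation_pattern[OF V, of "I i \<union> I j" "O' i \<union> O' j" t "\<lambda>_. c"] IO that V
        by (simp add: P_def subset_expectation_const power_add mult_ac)
    qed
    have "(\<lambda>S. g i S * g j S) =
       (\<lambda>S. (if has_pattern (I i \<union> I j) (O' i \<union> O' j) S then 1 / P i * (1 / P j) else 0)
          - (if has_pattern (I i) (O' i) S then 1 / P i else 0)
          - (if has_pattern (I j) (O' j) S then 1 / P j else 0) + 1)"
      by (rule ext) (auto simp: g_def has_pattern_def Int_Un_distrib2 algebra_simps)
    then have "?E (\<lambda>S. g i S * g j S) = P i * P j * (1 / P i * (1 / P j)) - P i * (1 / P i) - P j * (1 / P j) + 1"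
      using Eind that both V
      by (simp only: subset_expectation_add subset_expectation_diff subset_expectation_const)
    also have "\<dots> = 0" using Ppos[of i] Ppos[of j] by simp
    finally show ?thesis using False by simp
  qed
  have "(\<Sum>i\<in>J. ?E (\<lambda>S. G (S \<union> I i - O' i)) - ?E G) = (\<Sum>i\<in>J. ?E (\<lambda>S. G S * g i S))"
    using Gg by simp
  also have "\<dots> = ?E (\<lambda>S. G S * (\<Sum>i\<in>J. g i S))"
    by (simp add: subset_expectation_sum[symmetric] sum_distrib_left)
  finally have "(\<Sum>i\<in>J. ?E (\<lambda>S. G (S \<union> I i - O' i)) - ?E G)\<^sup>2 \<le> ?E (\<lambda>S. (\<Sum>i\<in>J. g i S)\<^sup>2)"
    using subset_expectation_square_bound[OF V _ _ G, of t] t by simp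
  also have "\<dots> = (\<Sum>i\<in>J. \<Sum>j\<in>J. ?E (\<lambda>S. g i S * g j S))"
    by (simp add: power2_eq_square sum_product subset_expectation_sum)
  also have "\<dots> \<le> (\<Sum>i\<in>J. \<Sum>j\<in>J. if i = j then 1 / P i else 0)"
    using gg by (intro sum_mono) auto
  also have "\<dots> = (\<Sum>i\<in>J. 1 / P i)" using J by simp
  finally show ?thesis by (simp add: P_def)
qed


section \<open>Shapley values of games with unit increments\<close>

definition unit_game :: "'v set \<Rightarrow> ('v set \<Rightarrow> real) \<Rightarrow> bool" where
  "unit_game V m \<longleftrightarrow> m {} = 0 \<and>
     (\<forall>S v. S \<subseteq> V \<and> v \<in> V \<longrightarrow> m S \<le> m (insert v S) \<and> m (insert v S) \<le> m S + 1)"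

lemma unit_game_mono:
  assumes "finite V" "unit_game V m" "S \<subseteq> T" "T \<subseteq> V"
  shows "m S \<le> m T"
proof -
  have "m S \<le> m (S \<union> D)" if "finite D" "S \<union> D \<subseteq> V" for D
    using that
  proof (induction D rule: finite_induct)
    case (insert v D)
    then have "m (S \<union> D) \<le> m (insert v (S \<union> D))" using assms(2) by (simp add: unit_game_def)
    then show ?case using insert by simp
  qed simp
  from this[of T] show ?thesis
    using assms by (metis finite_subset sup.absorb2)
qed

definition marginal :: "('v set \<Rightarrow> real) \<Rightarrow> 'v \<Rightarrow> 'v set \<Rightarrow> real" where
  "marginal m v S = m (insert v S) - m (S - {v})"

text \<open>With \<open>d = 0\<close> this is the Shapley value of \<open>v\<close>: an element that arrives at a uniform time
  \<open>t\<close> finds a random set of density \<open>t\<close>. The two ends are cut off so that the probabilities of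
  patterns stay away from 0; this only lowers the total.\<close>

definition shapley :: "real \<Rightarrow> 'v set \<Rightarrow> ('v set \<Rightarrow> real) \<Rightarrow> 'v \<Rightarrow> real" where
  "shapley d V m v = integral {d..1-d} (\<lambda>t. subset_expectation t V (marginal m v))"

text \<open>The value of \<open>v\<close> conditioned on \<open>I\<close> having arrived before \<open>v\<close> and \<open>O'\<close> arriving after it.\<close>

definition pattern_shapley ::
  "real \<Rightarrow> 'v set \<Rightarrow> ('v set \<Rightarrow> real) \<Rightarrow> 'v \<Rightarrow> 'v set \<Rightarrow> 'v set \<Rightarrow> real" where
  "pattern_shapley d V m v I O' =
     integral {d..1-d} (\<lambda>t. subset_expectation t V (\<lambda>S. marginal m v (S \<union> I - O')))"

lemma subset_expectation_integrable:
  "(\<lambda>t. subset_expectation t V G) integrable_on {a..b}"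
  by (intro integrable_continuous_real subset_expectation_continuous)

lemma marginal_bounds:
  assumes "unit_game V m" "S \<subseteq> V" "v \<in> V"
  shows "0 \<le> marginal m v S" "marginal m v S \<le> 1"
proof -
  have "S - {v} \<subseteq> V" using assms by auto
  then have "m (S - {v}) \<le> m (insert v (S - {v}))" "m (insert v (S - {v})) \<le> m (S - {v}) + 1"
    using assms unfolding unit_game_def by blast+
  then show "0 \<le> marginal m v S" "marginal m v S \<le> 1" by (auto simp: marginal_def)
qed

lemma shapley_bounds:
  assumes "finite V" "unit_game V m" "v \<in> V" "0 < d" "d < 1/2"
  shows "0 \<le> shapley d V m v" "shapley d V m v \<le> 1"
proof -
  have b: "0 \<le> subset_expectation t V (marginal m v)" "subset_expectation t V (marginal m v) \<le> 1"
    if "t \<in> {d..1-d}" for t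
    using subset_expectation_mono[of t V "\<lambda>_. 0" "marginal m v"]
      subset_expectation_mono[of t V "marginal m v" "\<lambda>_. 1"] that assms marginal_bounds[OF assms(2)]
    by (auto simp: subset_expectation_const)
  then show "0 \<le> shapley d V m v"
    unfolding shapley_def by (intro integral_nonneg subset_expectation_integrable)
  have "shapley d V m v \<le> integral {d..1-d} (\<lambda>_. 1 :: real)"
    unfolding shapley_def using b by (intro integral_le subset_expectation_integrable) auto
  then show "shapley d V m v \<le> 1" using assms by simp
qed

lemma shapley_sum_le:
  assumes "finite V" "unit_game V m" "0 < d" "d < 1/2"
  shows "(\<Sum>v\<in>V. shapley d V m v) \<le> m V"
proof -
  have "((\<lambda>t. \<Sum>v\<in>V. subset_expectation t V (marginal m v)) has_integral
     (subset_expectation (1-d) V m - subset_expectation d V m)) {d..1-d}"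
    using subset_expectation_deriv[OF assms(1), of m] assms
    by (intro fundamental_theorem_of_calculus)
       (auto simp: marginal_def[abs_def] has_real_derivative_iff_has_vector_derivative)
  then have "(\<Sum>v\<in>V. shapley d V m v) = subset_expectation (1-d) V m - subset_expectation d V m"
    unfolding shapley_def
    by (subst integral_sum[symmetric]) (auto intro: assms subset_expectation_integrable integral_unique)
  moreover have "0 \<le> subset_expectation d V m"
  proof -
    have "0 \<le> m S" if "S \<subseteq> V" for S
      using unit_game_mono[OF assms(1,2), of "{}" S] that assms(2) by (simp add: unit_game_def)
    then have "subset_expectation d V (\<lambda>_. 0) \<le> subset_expectation d V m"
      using assms by (intro subset_expectation_mono) auto
    then show ?thesis using assms by (simp add: subset_expectation_const)
  qed
  moreover have "subset_expectation (1-d) V m \<le> m V"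
  proof -
    have "subset_expectation (1-d) V m \<le> subset_expectation (1-d) V (\<lambda>_. m V)"
      using assms unit_game_mono[OF assms(1,2)] by (intro subset_expectation_mono) auto
    then show ?thesis using assms by (simp add: subset_expectation_const)
  qed
  ultimately show ?thesis by simp
qed

text \<open>If \<open>N\<close> disjoint patterns all raise the value of \<open>v\<close> by \<open>e\<close>, their influences sum to at least
  \<open>N * e\<close>, whereas uncorrelated indicators only allow a sum of the order of \<open>sqrt N\<close>.\<close>

lemma disjoint_bad_patterns_bound:
  assumes V: "finite V" and m: "unit_game V m" and v: "v \<in> V" and d: "0 < d" "d < 1/2" and e: "0 < e"
    and J: "finite J"
    and IO: "\<And>I O'. (I, O') \<in> J \<Longrightarrow> I \<subseteq> V \<and> O' \<subseteq> V \<and> I \<inter> O' = {} \<and> card (I \<union> O') \<le> h"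
    and dis: "\<And>p q. p \<in> J \<Longrightarrow> q \<in> J \<Longrightarrow> p \<noteq> q \<Longrightarrow> (fst p \<union> snd p) \<inter> (fst q \<union> snd q) = {}"
    and bad: "\<And>I O'. (I, O') \<in> J \<Longrightarrow> shapley d V m v + e \<le> pattern_shapley d V m v I O'"
  shows "real (card J) \<le> 1 / (d ^ h * e\<^sup>2)"
proof -
  define N where "N = real (card J)"
  define D where "D t p = subset_expectation t V (\<lambda>S. marginal m v (S \<union> fst p - snd p))
     - subset_expectation t V (marginal m v)" for t p
  have Dint: "(\<lambda>t. D t p) integrable_on {d..1-d}" for p
    unfolding D_def by (intro integrable_diff subset_expectation_integrable)
  have le: "(\<Sum>p\<in>J. D t p) \<le> sqrt (N / d ^ h)" if t: "t \<in> {d..1-d}" for t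
  proof -
    have "(\<Sum>p\<in>J. D t p)\<^sup>2 \<le> (\<Sum>p\<in>J. 1 / (t ^ card (fst p) * (1 - t) ^ card (snd p)))"
      unfolding D_def
    proof (rule disjoint_patterns_influence)
      show "\<bar>marginal m v S\<bar> \<le> 1" if "S \<subseteq> V" for S
        using marginal_bounds[OF m that v] by simp
      show "fst p \<subseteq> V" "snd p \<subseteq> V" "fst p \<inter> snd p = {}" if "p \<in> J" for p
        using IO[of "fst p" "snd p"] that by auto
    qed (use V J dis t d in auto)
    also have "\<dots> \<le> (\<Sum>p\<in>J. 1 / d ^ h)"
    proof (rule sum_mono)
      fix p assume "p \<in> J"
      then have p: "fst p \<subseteq> V" "snd p \<subseteq> V" "fst p \<inter> snd p = {}" "card (fst p \<union> snd p) \<le> h"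
        using IO[of "fst p" "snd p"] by auto
      have "finite (fst p)" "finite (snd p)" using p V by (auto intro: finite_subset)
      then have c: "card (fst p) + card (snd p) \<le> h" using p card_Un_disjoint by metis
      have "d ^ h \<le> d ^ (card (fst p) + card (snd p))"
        using c d by (intro power_decreasing) auto
      also have "\<dots> \<le> t ^ card (fst p) * (1 - t) ^ card (snd p)"
        unfolding power_add using t d by (intro mult_mono power_mono) auto
      finally show "1 / (t ^ card (fst p) * (1 - t) ^ card (snd p)) \<le> 1 / d ^ h"
        using d t by (intro divide_left_mono) (auto intro!: mult_pos_pos zero_less_power)
    qed
    also have "\<dots> = N / d ^ h" by (simp add: N_def)
    finally show ?thesis by (rule real_le_rsqrt)
  qed
  have "N * e = (\<Sum>p\<in>J. e)" by (simp add: N_def)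
  also have "\<dots> \<le> (\<Sum>p\<in>J. integral {d..1-d} (\<lambda>t. D t p))"
  proof (rule sum_mono)
    fix p assume "p \<in> J"
    then have "shapley d V m v + e \<le> pattern_shapley d V m v (fst p) (snd p)" using bad[of "fst p" "snd p"] by simp
    then show "e \<le> integral {d..1-d} (\<lambda>t. D t p)"
      unfolding D_def shapley_def pattern_shapley_def
      by (subst integral_diff) (auto intro: subset_expectation_integrable)
  qed
  also have "\<dots> = integral {d..1-d} (\<lambda>t. \<Sum>p\<in>J. D t p)"
    using J Dint by (simp add: integral_sum)
  also have "\<dots> \<le> integral {d..1-d} (\<lambda>_. sqrt (N / d ^ h))"
    using le J Dint by (intro integral_le integrable_sum) auto
  also have "\<dots> \<le> sqrt (N / d ^ h)"
    using d by (simp add: mult_left_le_one_le N_def)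
  finally have "N * e \<le> sqrt (N / d ^ h)" .
  then have "(N * e)\<^sup>2 \<le> (sqrt (N / d ^ h))\<^sup>2"
    using e by (intro power_mono) (auto simp: N_def)
  also have "\<dots> = N / d ^ h" using d by (simp add: N_def)
  finally have "(N * e)\<^sup>2 \<le> N / d ^ h" .
  then have "N * (N * (d ^ h * e\<^sup>2)) \<le> N * 1"
    using d by (simp add: field_simps power2_eq_square)
  then have "N = 0 \<or> N * (d ^ h * e\<^sup>2) \<le> 1"
    by (subst (asm) mult_le_cancel_left) (auto simp: N_def)
  then show ?thesis
    using d e by (auto simp: N_def[symmetric] field_simps)
qed

text \<open>Consequently boundedly many elements meet every pattern that raises the value of \<open>v\<close>: take the
  union of a maximal disjoint family of such patterns.\<close>

lemma bad_patterns_transversal: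
  assumes V: "finite V" and m: "unit_game V m" and v: "v \<in> V" and d: "0 < d" "d < 1/2" and e: "0 < e"
  shows "\<exists>Z. finite Z \<and> real (card Z) \<le> real h / (d ^ h * e\<^sup>2) \<and>
    (\<forall>I O'. I \<subseteq> V \<and> O' \<subseteq> V \<and> I \<inter> O' = {} \<and> card (I \<union> O') \<le> h \<and> (I \<union> O') \<inter> Z = {} \<longrightarrow>
       pattern_shapley d V m v I O' \<le> shapley d V m v + e)"
proof -
  define sp :: "'a set \<times> 'a set \<Rightarrow> 'a set" where "sp p = fst p \<union> snd p" for p
  define bad where "bad = {(I, O'). I \<subseteq> V \<and> O' \<subseteq> V \<and> I \<inter> O' = {} \<and> card (I \<union> O') \<le> h \<and>
     shapley d V m v + e < pattern_shapley d V m v I O'}"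
  define fams where "fams = {J. J \<subseteq> bad \<and> (\<forall>p\<in>J. \<forall>q\<in>J. p \<noteq> q \<longrightarrow> sp p \<inter> sp q = {})}"
  have finbad: "finite bad"
    by (rule finite_subset[of _ "Pow V \<times> Pow V"]) (use V in \<open>auto simp: bad_def\<close>)
  have "finite fams" by (rule finite_subset[of _ "Pow bad"]) (use finbad in \<open>auto simp: fams_def\<close>)
  moreover have "{} \<in> fams" by (simp add: fams_def)
  ultimately obtain J where J: "J \<in> fams" and max: "\<And>J'. J' \<in> fams \<Longrightarrow> card J' \<le> card J"
    using Max_in[of "card ` fams"] Max_ge[of "card ` fams"] by fastforce
  have finJ: "finite J" using J finbad finite_subset by (auto simp: fams_def)
  define Z where "Z = (\<Union>p\<in>J. fst p \<union> snd p)"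
  have finp: "finite (fst p \<union> snd p)" "card (fst p \<union> snd p) \<le> h" if "p \<in> J" for p
  proof -
    have "fst p \<subseteq> V" "snd p \<subseteq> V" "card (fst p \<union> snd p) \<le> h"
      using subsetD[OF _ that, of bad] J by (auto simp: fams_def bad_def)
    then show "finite (fst p \<union> snd p)" "card (fst p \<union> snd p) \<le> h"
      using V by (auto intro: finite_subset)
  qed
  have "card Z \<le> (\<Sum>p\<in>J. card (fst p \<union> snd p))"
    unfolding Z_def using finJ by (rule card_UN_le)
  also have "\<dots> \<le> card J * h" using sum_bounded_above[of J _ h] finp by simp
  finally have "real (card Z) \<le> real h * real (card J)" by (metis mult.commute of_nat_le_iff of_nat_mult)
  also have "\<dots> \<le> real h * (1 / (d ^ h * e\<^sup>2))"
  proof (rule mult_left_mono)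
    show "real (card J) \<le> 1 / (d ^ h * e\<^sup>2)"
      by (rule disjoint_bad_patterns_bound[OF V m v d e finJ])
         (use J in \<open>auto simp: fams_def bad_def sp_def\<close>)
  qed simp
  finally have card: "real (card Z) \<le> real h / (d ^ h * e\<^sup>2)" by simp
  have main: "pattern_shapley d V m v I O' \<le> shapley d V m v + e"
    if IO: "I \<subseteq> V" "O' \<subseteq> V" "I \<inter> O' = {}" "card (I \<union> O') \<le> h" "(I \<union> O') \<inter> Z = {}" for I O'
  proof (rule ccontr)
    assume c: "\<not> ?thesis"
    then have "I \<union> O' \<noteq> {}" using e by (auto simp: pattern_shapley_def shapley_def)
    then have "(I, O') \<notin> J" using IO(5) by (fastforce simp: Z_def)
    moreover have "insert (I, O') J \<in> fams"
    proof -
      have "(I, O') \<in> bad" using c IO by (simp add: bad_def)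
      moreover have "\<forall>q\<in>J. sp (I, O') \<inter> sp q = {} \<and> sp q \<inter> sp (I, O') = {}"
      proof
        fix q assume "q \<in> J"
        then have "sp q \<subseteq> Z" by (auto simp: Z_def sp_def)
        moreover have "sp (I, O') \<inter> Z = {}" using IO(5) by (simp add: sp_def)
        ultimately show "sp (I, O') \<inter> sp q = {} \<and> sp q \<inter> sp (I, O') = {}" by blast
      qed
      ultimately show ?thesis using J by (simp add: fams_def)
    qed
    ultimately show False using max[of "insert (I, O') J"] finJ by simp
  qed
  have "finite Z" using finp finJ by (auto simp: Z_def)
  then show ?thesis using card main by (intro exI[of _ Z] conjI allI impI) auto
qed

text \<open>If \<open>X\<close> contains no element of a bad pattern for another of its elements, the marginal
  values of the elements of \<open>X\<close> are almost additive. A set \<open>X\<close> that always adds 1 to the game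
  therefore has total value almost 1.\<close>

lemma shapley_cover:
  assumes V: "finite V" and m: "unit_game V m" and d: "0 < d" "d < 1/2"
    and X: "X \<subseteq> V"
    and gain: "\<And>S. S \<subseteq> V \<Longrightarrow> m (S - X) + 1 \<le> m (S \<union> X)"
    and good: "\<And>v I O'. v \<in> X \<Longrightarrow> I \<union> O' = X - {v} \<Longrightarrow> I \<inter> O' = {} \<Longrightarrow>
       pattern_shapley d V m v I O' \<le> shapley d V m v + e"
  shows "1 - 2 * d \<le> (\<Sum>v\<in>X. shapley d V m v + e)"
proof -
  define Q where "Q A = integral {d..1-d} (\<lambda>t. subset_expectation t V (\<lambda>S. m ((S - X) \<union> A)))" for A
  have "finite X" using X V finite_subset by blast
  then have "Q X - Q {} \<le> (\<Sum>v\<in>X. shapley d V m v + e)"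
    using subset_refl[of X]
  proof (induction rule: finite_subset_induct')
    case empty
    then show ?case by simp
  next
    case (insert v A)
    let ?O = "X - insert v A"
    have "Q (insert v A) - Q A = pattern_shapley d V m v A ?O"
      unfolding Q_def pattern_shapley_def marginal_def
    proof (subst integral_diff[symmetric])
      have "insert v (S \<union> A - ?O) = S - X \<union> insert v A" "S \<union> A - ?O - {v} = S - X \<union> A" for S
        using insert by auto
      then show "integral {d..1-d} (\<lambda>t. subset_expectation t V (\<lambda>S. m (S - X \<union> insert v A)) -
          subset_expectation t V (\<lambda>S. m (S - X \<union> A))) =
        integral {d..1-d} (\<lambda>t. subset_expectation t V
          (\<lambda>S. m (insert v (S \<union> A - ?O)) - m (S \<union> A - ?O - {v})))"
        by (simp add: subset_expectation_diff)
    qed (rule subset_expectation_integrable)+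
    also have "\<dots> \<le> shapley d V m v + e" using insert by (intro good) auto
    finally show ?case using insert by simp
  qed
  moreover have "integral {d..1-d} (\<lambda>_. 1 :: real) \<le> integral {d..1-d}
     (\<lambda>t. subset_expectation t V (\<lambda>S. m (S - X \<union> X)) - subset_expectation t V (\<lambda>S. m (S - X \<union> {})))"
  proof (rule integral_le)
    fix t assume t: "t \<in> {d..1-d}"
    have "m (S - X) + 1 \<le> m (S - X \<union> X)" if "S \<subseteq> V" for S
      using gain[OF that] by simp
    then have "subset_expectation t V (\<lambda>_. 1) \<le>
        subset_expectation t V (\<lambda>S. m (S - X \<union> X) - m (S - X \<union> {}))"
      using t d by (intro subset_expectation_mono) (auto simp: algebra_simps)
    then show "1 \<le> subset_expectation t V (\<lambda>S. m (S - X \<union> X)) - subset_expectation t V (\<lambda>S. m (S - X \<union> {}))"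
      using V by (simp add: subset_expectation_const subset_expectation_diff)
  qed (auto intro: integrable_diff subset_expectation_integrable)
  then have "1 - 2 * d \<le> Q X - Q {}"
    unfolding Q_def using d by (subst (asm) integral_diff) (auto intro: subset_expectation_integrable)
  ultimately show ?thesis by simp
qed


section \<open>Homogeneous subsets of several classes\<close>

lemma ramsey_pairs:
  "\<exists>N. \<forall>(A :: 'v set) \<phi>. finite A \<and> N \<le> card A \<and> (\<forall>a\<in>A. \<forall>b\<in>A. a \<noteq> b \<longrightarrow> \<phi> {a, b} < (c :: nat)) \<longrightarrow>
     (\<exists>B\<subseteq>A. card B = M \<and> (\<exists>k. \<forall>a\<in>B. \<forall>b\<in>B. a \<noteq> b \<longrightarrow> \<phi> {a, b} = k))"
proof -
  obtain N :: nat where N: "partn_lst {..<N} (replicate c M) 2"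
    using ramsey_full[of "replicate c M" 2] by blast
  show ?thesis
  proof (intro exI[of _ N] allI impI, elim conjE)
    fix A :: "'v set" and \<phi> :: "'v set \<Rightarrow> nat"
    assume A: "finite A" "N \<le> card A" and col: "\<forall>a\<in>A. \<forall>b\<in>A. a \<noteq> b \<longrightarrow> \<phi> {a, b} < c"
    obtain e where e: "inj_on e {..<N}" "e ` {..<N} \<subseteq> A"
      using A card_le_inj[of "{..<N}" A] by auto
    have "(\<lambda>s. \<phi> (e ` s)) \<in> nsets {..<N} 2 \<rightarrow> {..<length (replicate c M)}"
      unfolding length_replicate
    proof (intro Pi_I lessThan_iff[THEN iffD2])
      fix s assume "s \<in> nsets {..<N} 2"
      then obtain x y where s: "s = {x, y}" "x < N" "y < N" "x \<noteq> y" by (auto elim!: nsets2_E)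
      then have "e x \<noteq> e y" "e x \<in> A" "e y \<in> A" using e by (auto dest: inj_onD)
      then show "\<phi> (e ` s) < c" using col s by simp
    qed
    then obtain i where i: "i < c" "monochromatic {..<N} (replicate c M ! i) 2 (\<lambda>s. \<phi> (e ` s)) i"
      using N unfolding partn_lst_def length_replicate by blast
    then obtain H where H: "H \<in> nsets {..<N} M"
      and mono: "(\<lambda>s. \<phi> (e ` s)) ` nsets H 2 \<subseteq> {i}"
      unfolding monochromatic_def by auto
    have Hsub: "H \<subseteq> {..<N}" "card H = M" using H by (auto simp: nsets_def)
    have "\<phi> {a, b} = i" if "a \<in> e ` H" "b \<in> e ` H" "a \<noteq> b" for a b
    proof -
      obtain x y where xy: "a = e x" "b = e y" "x \<in> H" "y \<in> H" using \<open>a \<in> e ` H\<close> \<open>b \<in> e ` H\<close> by auto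
      then have "{x, y} \<in> nsets H 2" using that by auto
      then have "\<phi> (e ` {x, y}) = i" using mono by blast
      then show ?thesis using xy by simp
    qed
    moreover have "e ` H \<subseteq> A" "card (e ` H) = M"
      using e Hsub by (auto simp: card_image inj_on_subset)
    ultimately show "\<exists>B\<subseteq>A. card B = M \<and> (\<exists>k. \<forall>a\<in>B. \<forall>b\<in>B. a \<noteq> b \<longrightarrow> \<phi> {a, b} = k)"
      by (intro exI[of _ "e ` H"] exI[of _ i] conjI ballI impI) simp_all
  qed
qed

lemma ramsey_pairs_simultaneous:
  assumes "finite P"
  shows "\<exists>N. \<forall>(A :: 'v set) \<phi>. finite A \<and> N \<le> card A \<and>
       (\<forall>p\<in>P. \<forall>a\<in>A. \<forall>b\<in>A. a \<noteq> b \<longrightarrow> \<phi> p {a, b} < (c :: nat)) \<longrightarrow>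
     (\<exists>B\<subseteq>A. card B = M \<and> (\<forall>p\<in>P. \<exists>k. \<forall>a\<in>B. \<forall>b\<in>B. a \<noteq> b \<longrightarrow> \<phi> p {a, b} = k))"
  using assms
proof (induction P rule: finite_induct)
  case empty
  show ?case
  proof (intro exI[of _ M] allI impI, elim conjE)
    fix A :: "'v set" assume "M \<le> card A"
    then obtain B where "B \<subseteq> A" "card B = M" by (meson obtain_subset_with_card_n)
    then show "\<exists>B\<subseteq>A. card B = M \<and> (\<forall>p\<in>{}. \<exists>k. \<forall>a\<in>B. \<forall>b\<in>B. a \<noteq> b \<longrightarrow> \<phi> p {a, b} = k)" for \<phi> :: "'a \<Rightarrow> 'v set \<Rightarrow> nat"
      by blast
  qed
next
  case (insert p P)
  from insert.IH obtain N where N: "\<forall>(A :: 'v set) \<phi>. finite A \<and> N \<le> card A \<and>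
       (\<forall>p\<in>P. \<forall>a\<in>A. \<forall>b\<in>A. a \<noteq> b \<longrightarrow> \<phi> p {a, b} < c) \<longrightarrow>
     (\<exists>B\<subseteq>A. card B = M \<and> (\<forall>p\<in>P. \<exists>k. \<forall>a\<in>B. \<forall>b\<in>B. a \<noteq> b \<longrightarrow> \<phi> p {a, b} = k))" ..
  from ramsey_pairs obtain N' where N': "\<forall>(A :: 'v set) \<phi>. finite A \<and> N' \<le> card A \<and>
       (\<forall>a\<in>A. \<forall>b\<in>A. a \<noteq> b \<longrightarrow> \<phi> {a, b} < c) \<longrightarrow>
     (\<exists>B\<subseteq>A. card B = N \<and> (\<exists>k. \<forall>a\<in>B. \<forall>b\<in>B. a \<noteq> b \<longrightarrow> \<phi> {a, b} = k))" ..
  show ?case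
  proof (intro exI[of _ N'] allI impI, elim conjE)
    fix A :: "'v set" and \<phi> :: "'a \<Rightarrow> 'v set \<Rightarrow> nat"
    assume A: "finite A" "N' \<le> card A"
      and col: "\<forall>p\<in>insert p P. \<forall>a\<in>A. \<forall>b\<in>A. a \<noteq> b \<longrightarrow> \<phi> p {a, b} < c"
    obtain B k where B: "B \<subseteq> A" "card B = N" "\<forall>a\<in>B. \<forall>b\<in>B. a \<noteq> b \<longrightarrow> \<phi> p {a, b} = k"
      using N'[rule_format, of A "\<phi> p"] A col by auto
    have "\<forall>p\<in>P. \<forall>a\<in>B. \<forall>b\<in>B. a \<noteq> b \<longrightarrow> \<phi> p {a, b} < c" using B col by blast
    then obtain B' where B': "B' \<subseteq> B" "card B' = M"
      "\<forall>p\<in>P. \<exists>k. \<forall>a\<in>B'. \<forall>b\<in>B'. a \<noteq> b \<longrightarrow> \<phi> p {a, b} = k"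
      using N[rule_format, of B \<phi>] B finite_subset[OF B(1) A(1)] by auto
    moreover have "\<forall>a\<in>B'. \<forall>b\<in>B'. a \<noteq> b \<longrightarrow> \<phi> p {a, b} = k" using B B' by blast
    ultimately show "\<exists>B\<subseteq>A. card B = M \<and> (\<forall>p\<in>insert p P. \<exists>k. \<forall>a\<in>B. \<forall>b\<in>B. a \<noteq> b \<longrightarrow> \<phi> p {a, b} = k)"
      using B(1) by (intro exI[of _ B']) auto
  qed
qed

text \<open>Ramsey's theorem is applied to the indices of enumerations of the classes. Distinct classes
  then use disjoint blocks of the homogeneous index set, so that the order of two indices from
  distinct blocks does not depend on the choice of the indices.\<close>

lemma ramsey_classes:
  assumes "0 < (c :: nat)"
  shows "\<exists>N. \<forall>J (V :: nat \<Rightarrow> 'v set) \<psi>. J \<subseteq> {..<K} \<and> (\<forall>i\<in>J. finite (V i) \<and> N \<le> card (V i)) \<and>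
       (\<forall>e. \<psi> e < c) \<longrightarrow>
     (\<exists>U L. (\<forall>i\<in>J. U i \<subseteq> V i \<and> card (U i) = M) \<and>
        (\<forall>i\<in>J. \<forall>j\<in>J. \<forall>u\<in>U i. \<forall>v\<in>U j. u \<noteq> v \<longrightarrow> \<psi> {u, v} = L i j))"
proof -
  let ?P = "{..<K} \<times> {..<K}"
  have "finite ?P" by simp
  from ramsey_pairs_simultaneous[OF this] obtain N where N: "\<forall>(A :: nat set) \<phi>. finite A \<and> N \<le> card A \<and>
       (\<forall>p\<in>?P. \<forall>a\<in>A. \<forall>b\<in>A. a \<noteq> b \<longrightarrow> \<phi> p {a, b} < c) \<longrightarrow>
     (\<exists>B\<subseteq>A. card B = K * M \<and> (\<forall>p\<in>?P. \<exists>k. \<forall>a\<in>B. \<forall>b\<in>B. a \<noteq> b \<longrightarrow> \<phi> p {a, b} = k))" ..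
  show ?thesis
  proof (intro exI[of _ N] allI impI, elim conjE)
    fix J and V :: "nat \<Rightarrow> 'v set" and \<psi> :: "'v set \<Rightarrow> nat"
    assume J: "J \<subseteq> {..<K}" and V: "\<forall>i\<in>J. finite (V i) \<and> N \<le> card (V i)" and col: "\<forall>e. \<psi> e < c"
    have "\<exists>e. inj_on e {..<N} \<and> e ` {..<N} \<subseteq> V i" if "i \<in> J" for i
      using V that card_le_inj[of "{..<N}" "V i"] by auto
    then obtain e where e: "\<And>i. i \<in> J \<Longrightarrow> inj_on (e i) {..<N}" "\<And>i. i \<in> J \<Longrightarrow> e i ` {..<N} \<subseteq> V i"
      by metis
    define \<phi> where "\<phi> p A = \<psi> {e (fst p) (Min A), e (snd p) (Max A)}" for p and A :: "nat set"
    obtain B where B: "B \<subseteq> {..<N}" "card B = K * M"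
      and hom: "\<forall>p\<in>?P. \<exists>k. \<forall>a\<in>B. \<forall>b\<in>B. a \<noteq> b \<longrightarrow> \<phi> p {a, b} = k"
    proof -
      have "\<phi> p A < c" for p A using col by (simp add: \<phi>_def)
      then show ?thesis using N[rule_format, of "{..<N}" \<phi>] that by auto
    qed
    obtain L0 where L0: "\<And>i j a b. i < K \<Longrightarrow> j < K \<Longrightarrow> a \<in> B \<Longrightarrow> b \<in> B \<Longrightarrow> a \<noteq> b \<Longrightarrow> \<phi> (i, j) {a, b} = L0 (i, j)"
    proof -
      have "\<forall>p. \<exists>k. p \<in> ?P \<longrightarrow> (\<forall>a\<in>B. \<forall>b\<in>B. a \<noteq> b \<longrightarrow> \<phi> p {a, b} = k)" using hom by auto
      from choice[OF this] show ?thesis using that by auto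
    qed
    have finB: "finite B" using B finite_subset by blast
    obtain b where b: "bij_betw b {..<K * M} B" "strict_mono_on {..<K * M} b"
      using ex_bij_betw_strict_mono_card[OF finB] B by (metis atLeast0LessThan)
    have blt: "b s < b s'" if "s < s'" "s' < K * M" for s s'
      using b(2) that by (auto simp: strict_mono_on_def)
    have bB: "b s \<in> B" if "s < K * M" for s using b(1) that by (auto simp: bij_betw_def)
    define blk where "blk i = {i * M..<i * M + M}" for i
    have blk_less: "s < K * M" if "s \<in> blk i" "i \<in> J" for s i
    proof -
      have "Suc i * M \<le> K * M" using that J by (intro mult_right_mono) auto
      then show ?thesis using that by (auto simp: blk_def)
    qed
    have ordered: "\<psi> {e i (b s), e j (b s')} = L0 (i, j)"
      if "i \<in> J" "j \<in> J" "s < s'" "s' < K * M" for i j s s'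
    proof -
      have "Min {b s, b s'} = b s" "Max {b s, b s'} = b s'" "b s \<noteq> b s'" using blt that by fastforce+
      then have "\<psi> {e i (b s), e j (b s')} = \<phi> (i, j) {b s, b s'}" by (simp add: \<phi>_def)
      also have "\<dots> = L0 (i, j)" using that J bB \<open>b s \<noteq> b s'\<close> by (intro L0) auto
      finally show ?thesis .
    qed
    define U where "U i = e i ` b ` blk i" for i
    define L where "L i j = (if i \<le> j then L0 (i, j) else L0 (j, i))" for i j
    have "U i \<subseteq> V i \<and> card (U i) = M" if i: "i \<in> J" for i
    proof -
      have sub: "b ` blk i \<subseteq> {..<N}" using bB blk_less[OF _ i] B(1) by (meson image_subsetI subsetD)
      have "inj_on b (blk i)" using b(1) blk_less i by (auto simp: bij_betw_def inj_on_def)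
      moreover have "inj_on (e i) (b ` blk i)" using e(1)[OF i] sub by (rule inj_on_subset)
      ultimately have "card (U i) = card (blk i)" by (simp add: U_def card_image)
      moreover have "U i \<subseteq> V i" using sub e(2)[OF i] by (auto simp: U_def)
      ultimately show ?thesis by (simp add: blk_def)
    qed
    moreover have "\<psi> {u, v} = L i j"
      if ij: "i \<in> J" "j \<in> J" and u: "u \<in> U i" and v: "v \<in> U j" and ne: "u \<noteq> v" for i j u v
    proof -
      obtain s s' where s: "s \<in> blk i" "s' \<in> blk j" "u = e i (b s)" "v = e j (b s')"
        using u v by (auto simp: U_def)
      have sl: "s < K * M" "s' < K * M" using blk_less ij s by auto
      consider "i = j" | "i < j" | "j < i" by linarith
      then show ?thesis
      proof cases
        case 1
        then have "s \<noteq> s'" using s ne by auto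
        then show ?thesis
          using ordered[of i j s s'] ordered[of j i s' s] ij sl s 1
          by (cases "s < s'") (auto simp: L_def insert_commute)
      next
        case 2
        then have "Suc i * M \<le> j * M" by (intro mult_right_mono) auto
        then have "s < s'" using s by (auto simp: blk_def)
        then show ?thesis using ordered[of i j s s'] ij sl s 2 by (auto simp: L_def)
      next
        case 3
        then have "Suc j * M \<le> i * M" by (intro mult_right_mono) auto
        then have "s' < s" using s by (auto simp: blk_def)
        then show ?thesis using ordered[of j i s' s] ij sl s 3 by (auto simp: L_def insert_commute)
      qed
    qed
    ultimately show "\<exists>U L. (\<forall>i\<in>J. U i \<subseteq> V i \<and> card (U i) = M) \<and>
        (\<forall>i\<in>J. \<forall>j\<in>J. \<forall>u\<in>U i. \<forall>v\<in>U j. u \<noteq> v \<longrightarrow> \<psi> {u, v} = L i j)"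
      by (intro exI[of _ U] exI[of _ L] conjI ballI impI) simp_all
  qed
qed

section \<open>Linear systems\<close>

lemma nontrivial_kernel:
  fixes a :: "'r \<Rightarrow> 'i \<Rightarrow> real"
  assumes "finite R" "finite I" "card R < card I"
  shows "\<exists>d. (\<exists>i\<in>I. d i \<noteq> 0) \<and> (\<forall>\<rho>\<in>R. (\<Sum>i\<in>I. a \<rho> i * d i) = 0)"
  using assms
proof (induction R arbitrary: I a rule: finite_induct)
  case empty
  then have "I \<noteq> {}" by auto
  then show ?case by (intro exI[of _ "\<lambda>_. 1"]) auto
next
  case (insert \<rho> R)
  show ?case
  proof (cases "\<forall>i\<in>I. a \<rho> i = 0")
    case True
    then show ?thesis using insert.IH[of I a] insert.prems insert.hyps by auto
  next
    case False
    then obtain j where j: "j \<in> I" "a \<rho> j \<noteq> 0" by auto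
    obtain d where d: "\<exists>i\<in>I - {j}. d i \<noteq> 0"
      "\<forall>\<sigma>\<in>R. (\<Sum>i\<in>I - {j}. (a \<sigma> i - a \<sigma> j / a \<rho> j * a \<rho> i) * d i) = 0"
    proof -
      have "card R < card (I - {j})" using insert.prems insert.hyps j by simp
      with insert.prems(1) show ?thesis
        using insert.IH[of "I - {j}" "\<lambda>\<sigma> i. a \<sigma> i - a \<sigma> j / a \<rho> j * a \<rho> i"] that by blast
    qed
    define t where "t = (\<Sum>i\<in>I - {j}. a \<rho> i * d i)"
    define d' where "d' = d(j := - t / a \<rho> j)"
    have sum: "(\<Sum>i\<in>I. a \<sigma> i * d' i) = (\<Sum>i\<in>I - {j}. a \<sigma> i * d i) - a \<sigma> j * t / a \<rho> j" for \<sigma>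
    proof -
      have "(\<Sum>i\<in>I - {j}. a \<sigma> i * d' i) = (\<Sum>i\<in>I - {j}. a \<sigma> i * d i)"
        by (intro sum.cong) (auto simp: d'_def)
      then show ?thesis using insert.prems j by (simp add: sum.remove[of I j] d'_def)
    qed
    have "(\<Sum>i\<in>I. a \<sigma> i * d' i) = 0" if "\<sigma> \<in> insert \<rho> R" for \<sigma>
    proof (cases "\<sigma> = \<rho>")
      case True
      then show ?thesis using j sum[of \<rho>] by (simp add: t_def)
    next
      case False
      then have "0 = (\<Sum>i\<in>I - {j}. (a \<sigma> i - a \<sigma> j / a \<rho> j * a \<rho> i) * d i)" using d that by auto
      also have "\<dots> = (\<Sum>i\<in>I - {j}. a \<sigma> i * d i) - a \<sigma> j / a \<rho> j * t"
        by (simp only: left_diff_distrib sum_subtractf t_def sum_distrib_left mult.assoc)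
      finally show ?thesis using sum[of \<sigma>] by simp
    qed
    moreover have "\<exists>i\<in>I. d' i \<noteq> 0" using d(1) by (auto simp: d'_def)
    ultimately show ?thesis by blast
  qed
qed

text \<open>Moving from \<open>x\<close> along a direction that leaves the \<open>r\<close> averages unchanged and does not lower the
  total, one reaches a point with a smaller support; rescaling it to total 1 only lowers the averages.\<close>

lemma averages_with_small_support:
  fixes Y :: "nat \<Rightarrow> 'i \<Rightarrow> real"
  assumes J: "finite J" and r: "1 \<le> r" and x: "\<And>i. i \<in> J \<Longrightarrow> 0 \<le> x i" "(\<Sum>i\<in>J. x i) = 1"
    and Y: "\<And>l i. l \<in> {1..r} \<Longrightarrow> i \<in> J \<Longrightarrow> 0 \<le> Y l i"
  shows "\<exists>x'. (\<forall>i\<in>J. 0 \<le> x' i) \<and> (\<Sum>i\<in>J. x' i) = 1 \<and> card {i\<in>J. x' i \<noteq> 0} \<le> r \<and>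
    (\<forall>l\<in>{1..r}. (\<Sum>i\<in>J. x' i * Y l i) \<le> (\<Sum>i\<in>J. x i * Y l i))"
proof -
  define good where "good x' \<longleftrightarrow> (\<forall>i\<in>J. 0 \<le> x' i) \<and> (\<Sum>i\<in>J. x' i) = 1 \<and>
    (\<forall>l\<in>{1..r}. (\<Sum>i\<in>J. x' i * Y l i) \<le> (\<Sum>i\<in>J. x i * Y l i))" for x'
  define sz where "sz x' = card {i\<in>J. x' i \<noteq> 0}" for x' :: "'i \<Rightarrow> real"
  have "good x" using x by (auto simp: good_def)
  then obtain z where z: "good z" and zmin: "\<And>y. good y \<Longrightarrow> sz z \<le> sz y"
    by (metis ex_has_least_nat)
  have "sz z \<le> r"
  proof (rule ccontr)
    assume big: "\<not> sz z \<le> r"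
    define S where "S = {i\<in>J. z i \<noteq> 0}"
    have S: "finite S" "S \<subseteq> J" "r < card S" using J big by (auto simp: S_def sz_def)
    have zpos: "0 < z i" if "i \<in> S" for i using z that by (auto simp: good_def S_def order_less_le)
    obtain d0 where d0: "\<exists>i\<in>S. d0 i \<noteq> 0" "\<forall>l\<in>{1..r}. (\<Sum>i\<in>S. Y l i * d0 i) = 0"
      using nontrivial_kernel[of "{1..r}" S Y] S by auto
    define d where "d i = (if i \<in> S then (if 0 \<le> (\<Sum>i\<in>S. d0 i) then d0 i else - d0 i) else 0)" for i
    have dS: "(\<Sum>i\<in>J. f i * d i) = (\<Sum>i\<in>S. f i * d i)" for f
      using S J by (intro sum.mono_neutral_right) (auto simp: d_def)
    have d1: "\<exists>i\<in>S. d i \<noteq> 0" using d0(1) by (auto simp: d_def)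
    have d2: "(\<Sum>i\<in>J. Y l i * d i) = 0" if "l \<in> {1..r}" for l
    proof -
      have "(\<Sum>i\<in>S. Y l i * d i) = (if 0 \<le> (\<Sum>i\<in>S. d0 i) then 1 else - 1) * (\<Sum>i\<in>S. Y l i * d0 i)"
        unfolding sum_distrib_left by (intro sum.cong) (auto simp: d_def)
      then show ?thesis using d0(2) that unfolding dS by simp
    qed
    have d3: "0 \<le> (\<Sum>i\<in>J. d i)"
    proof -
      have "(\<Sum>i\<in>S. d i) = (if 0 \<le> (\<Sum>i\<in>S. d0 i) then 1 else - 1) * (\<Sum>i\<in>S. d0 i)"
        unfolding sum_distrib_left by (intro sum.cong) (auto simp: d_def)
      then show ?thesis using dS[of "\<lambda>_. 1"] by simp
    qed
    show False
    proof (cases "\<exists>i\<in>S. d i < 0")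
      case True
      define T where "T = {i\<in>S. d i < 0}"
      have T: "finite T" "T \<noteq> {}" using True S by (auto simp: T_def)
      define s where "s = Min ((\<lambda>i. z i / - d i) ` T)"
      have "s \<in> (\<lambda>i. z i / - d i) ` T" unfolding s_def using T by (intro Min_in) auto
      then obtain j where j: "j \<in> T" "s = z j / - d j" by auto
      have s0: "0 < s" using j zpos by (auto simp: T_def divide_pos_neg)
      have sle: "s \<le> z i / - d i" if "i \<in> T" for i unfolding s_def using T that by (intro Min_le) auto
      have nn: "0 \<le> z i + s * d i" if "i \<in> J" for i
      proof (cases "i \<in> T")
        case True
        then show ?thesis using sle[OF True] by (auto simp: T_def field_simps)
      next
        case False
        then have "0 \<le> d i" by (auto simp: T_def d_def)
        then show ?thesis using s0 z that by (auto simp: good_def)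
      qed
      define w where "w = 1 + s * (\<Sum>i\<in>J. d i)"
      have w: "1 \<le> w" using s0 d3 by (simp add: w_def)
      define y where "y i = (z i + s * d i) / w" for i
      have "good y"
        unfolding good_def
      proof (intro conjI ballI)
        show "(\<Sum>i\<in>J. y i) = 1"
          using w z by (simp add: y_def good_def sum_divide_distrib[symmetric] sum.distrib sum_distrib_left[symmetric] w_def)
        fix l assume l: "l \<in> {1..r}"
        have nn': "0 \<le> (\<Sum>i\<in>J. z i * Y l i)"
          using z Y[OF l] by (intro sum_nonneg) (auto simp: good_def)
        have "(\<Sum>i\<in>J. y i * Y l i) = ((\<Sum>i\<in>J. z i * Y l i) + s * (\<Sum>i\<in>J. Y l i * d i)) / w"
          by (simp add: y_def sum_divide_distrib sum.distrib[symmetric] sum_distrib_left algebra_simps add_divide_distrib)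
        also have "\<dots> = (\<Sum>i\<in>J. z i * Y l i) / w" using d2[OF l] by simp
        also have "\<dots> \<le> (\<Sum>i\<in>J. z i * Y l i)" using mult_left_mono[OF w nn'] w by (simp add: pos_divide_le_eq)
        also have "\<dots> \<le> (\<Sum>i\<in>J. x i * Y l i)" using z l by (auto simp: good_def)
        finally show "(\<Sum>i\<in>J. y i * Y l i) \<le> (\<Sum>i\<in>J. x i * Y l i)" .
      qed (use nn w in \<open>auto simp: y_def\<close>)
      moreover have "{i\<in>J. y i \<noteq> 0} \<subseteq> S - {j}"
      proof -
        have "y j = 0" using j by (simp add: y_def T_def)
        moreover have "y i = 0" if "i \<in> J" "i \<notin> S" for i using that by (simp add: y_def d_def S_def)
        ultimately show ?thesis by auto
      qed
      then have "sz y \<le> card (S - {j})" unfolding sz_def using S by (intro card_mono) auto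
      moreover have "card (S - {j}) < card S" using j S by (intro psubset_card_mono) (auto simp: T_def)
      ultimately show False using zmin[of y] by (simp add: sz_def S_def)
    next
      case False
      \<comment> \<open>A nonnegative direction in the kernel exhibits an index at which all averages vanish.\<close>
      then obtain j where j: "j \<in> S" "0 < d j" using d1 by (auto simp: not_less order_less_le)
      have dn: "0 \<le> d i" for i using False by (auto simp: d_def not_less)
      have Yj: "Y l j = 0" if l: "l \<in> {1..r}" for l
      proof -
        have "Y l j * d j \<le> (\<Sum>i\<in>J. Y l i * d i)"
          using j S J dn Y[OF l] by (intro member_le_sum) auto
        then show ?thesis using d2[OF l] j Y[OF l, of j] S
          by (metis mult_le_0_iff order_antisym_conv order_less_le_trans not_less subsetD)
      qed
      define y where "y i = (if i = j then 1 else 0 :: real)" for i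
      have jJ: "j \<in> J" using j S by auto
      have "good y"
        unfolding good_def
      proof (intro conjI ballI)
        show "(\<Sum>i\<in>J. y i) = 1" using J jJ by (simp add: y_def)
        fix l assume l: "l \<in> {1..r}"
        have "(\<Sum>i\<in>J. y i * Y l i) = (\<Sum>i\<in>J. if i = j then Y l j else 0)"
          by (intro sum.cong) (auto simp: y_def)
        also have "\<dots> = 0" using J jJ Yj[OF l] by simp
        also have "0 \<le> (\<Sum>i\<in>J. x i * Y l i)" using x Y[OF l] by (intro sum_nonneg) auto
        finally show "(\<Sum>i\<in>J. y i * Y l i) \<le> (\<Sum>i\<in>J. x i * Y l i)" .
      qed (auto simp: y_def)
      moreover have "{i\<in>J. y i \<noteq> 0} \<subseteq> {j}" by (auto simp: y_def)
      then have "sz y \<le> card {j}" unfolding sz_def by (intro card_mono) auto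
      ultimately show False using zmin[of y] S r by (simp add: sz_def S_def)
    qed
  qed
  then show ?thesis using z by (auto simp: good_def sz_def)
qed


section \<open>Vertices of polyhedra with bounded integer data\<close>

text \<open>Row \<open>(a, b)\<close> stands for the constraint \<open>a \<bullet> z \<ge> b\<close> on \<open>z 0, \<dots>, z (k - 1)\<close>.\<close>

type_synonym int_row = "(nat \<Rightarrow> int) \<times> int"

definition row_value :: "nat \<Rightarrow> (nat \<Rightarrow> int) \<Rightarrow> (nat \<Rightarrow> real) \<Rightarrow> real" where
  "row_value k a z = (\<Sum>i<k. of_int (a i) * z i)"

definition satisfies :: "nat \<Rightarrow> int_row set \<Rightarrow> (nat \<Rightarrow> real) \<Rightarrow> bool" where
  "satisfies k C z \<longleftrightarrow> (\<forall>(a, b)\<in>C. of_int b \<le> row_value k a z)"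

definition unit_row :: "nat \<Rightarrow> int_row" where
  "unit_row i = (\<lambda>j. if j = i then 1 else 0, 0)"

definition tight_rows :: "nat \<Rightarrow> int_row set \<Rightarrow> (nat \<Rightarrow> real) \<Rightarrow> int_row set" where
  "tight_rows k C z = {(a, b)\<in>C. row_value k a z = of_int b}"

definition trivial_kernel :: "nat \<Rightarrow> int_row set \<Rightarrow> bool" where
  "trivial_kernel k E \<longleftrightarrow> (\<forall>d. (\<forall>(a, b)\<in>E. row_value k a d = 0) \<longrightarrow> (\<forall>i<k. d i = 0))"

lemma row_value_add: "row_value k a (\<lambda>i. z i + s * d i) = row_value k a z + s * row_value k a d"
  by (simp add: row_value_def sum_distrib_left algebra_simps sum.distrib)

lemma row_value_unit: "i < k \<Longrightarrow> row_value k (fst (unit_row i)) z = z i"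
  by (simp add: row_value_def unit_row_def if_distrib[of "\<lambda>x. of_int x * _"] cong: if_cong)

text \<open>Among the points that cost at most as much as \<open>z\<close>, one with as many tight constraints as possible is
  a vertex: along a direction in the kernel of the tight rows one could move, without raising the cost,
  until another constraint becomes tight. The unit rows ensure that this happens.\<close>

lemma vertex_of_low_cost:
  assumes C: "finite C" and unit: "\<And>i. i < k \<Longrightarrow> unit_row i \<in> C"
    and z: "satisfies k C z" and c: "\<And>i. i < k \<Longrightarrow> 0 \<le> c i"
  shows "\<exists>z'. satisfies k C z' \<and> (\<Sum>i<k. c i * z' i) \<le> (\<Sum>i<k. c i * z i) \<and>
     trivial_kernel k (tight_rows k C z')"
proof -
  define good where "good z' \<longleftrightarrow> satisfies k C z' \<and> (\<Sum>i<k. c i * z' i) \<le> (\<Sum>i<k. c i * z i)" for z'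
  define nt where "nt z' = card (tight_rows k C z')" for z'
  have fin: "finite (tight_rows k C z')" for z'
    using C by (rule rev_finite_subset) (auto simp: tight_rows_def)
  have bound: "nt z' < Suc (card C)" for z'
    unfolding nt_def less_Suc_eq_le using C by (intro card_mono) (auto simp: tight_rows_def)
  have "good z" using z by (simp add: good_def)
  then obtain y where y: "good y" and ymax: "\<And>y'. good y' \<Longrightarrow> nt y' \<le> nt y"
    using ex_has_greatest_nat[of good z nt "Suc (card C)"] bound less_imp_le by metis
  have ysat: "of_int b \<le> row_value k a y" if "(a, b) \<in> C" for a b
    using y that by (auto simp: good_def satisfies_def)
  have "trivial_kernel k (tight_rows k C y)"
  proof (rule ccontr)
    assume "\<not> trivial_kernel k (tight_rows k C y)"
    then obtain d0 i0 where d0: "\<And>a b. (a, b) \<in> tight_rows k C y \<Longrightarrow> row_value k a d0 = 0"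
      and i0: "i0 < k" "d0 i0 \<noteq> 0"
      unfolding trivial_kernel_def by blast
    have neg: "row_value k a (\<lambda>i. - d0 i) = - row_value k a d0" for a
      by (simp add: row_value_def sum_negf)
    have costneg: "(\<Sum>i<k. c i * - d0 i) = - (\<Sum>i<k. c i * d0 i)" by (simp add: sum_negf)
    have costpos: "0 \<le> (\<Sum>i<k. c i * d i)" if "\<And>i. i < k \<Longrightarrow> 0 \<le> d i" for d
      using c that by (intro sum_nonneg mult_nonneg_nonneg) auto
    \<comment> \<open>One of \<open>d0\<close> and \<open>-d0\<close> does not raise the cost and has a negative entry.\<close>
    have "\<exists>d. (\<forall>(a, b)\<in>tight_rows k C y. row_value k a d = 0) \<and>
       (\<Sum>i<k. c i * d i) \<le> 0 \<and> (\<exists>i<k. d i < 0)"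
    proof -
      consider (lt) "(\<Sum>i<k. c i * d0 i) < 0" | (gt) "(\<Sum>i<k. c i * d0 i) > 0"
        | (zero) "(\<Sum>i<k. c i * d0 i) = 0" by linarith
      then show ?thesis
      proof cases
        case lt
        then have "\<exists>i<k. d0 i < 0" using costpos[of d0] by (meson not_le)
        then show ?thesis using lt d0 by (intro exI[of _ d0]) auto
      next
        case gt
        then have "\<exists>i<k. - d0 i < 0" using costpos[of "\<lambda>i. - d0 i"] costneg by (smt (verit))
        then show ?thesis using gt d0 neg costneg by (intro exI[of _ "\<lambda>i. - d0 i"]) auto
      next
        case zero
        show ?thesis
        proof (cases "d0 i0 < 0")
          case True
          then show ?thesis using zero d0 i0 by (intro exI[of _ d0]) auto
        next
          case False
          then show ?thesis using zero d0 i0 neg costneg by (intro exI[of _ "\<lambda>i. - d0 i"]) auto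
        qed
      qed
    qed
    then obtain d j where d: "\<And>a b. (a, b) \<in> tight_rows k C y \<Longrightarrow> row_value k a d = 0"
      and cost: "(\<Sum>i<k. c i * d i) \<le> 0" and j: "j < k" "d j < 0"
      by blast
    define T where "T = {(a, b)\<in>C. row_value k a d < 0}"
    define q where "q p = (row_value k (fst p) y - of_int (snd p)) / - row_value k (fst p) d" for p :: int_row
    have T: "finite T" using C by (rule rev_finite_subset) (auto simp: T_def)
    have "unit_row j \<in> T"
      using unit[OF j(1)] row_value_unit[OF j(1)] j by (cases "unit_row j") (auto simp: T_def)
    then have Tne: "T \<noteq> {}" by auto
    define s where "s = Min (q ` T)"
    have "s \<in> q ` T" unfolding s_def using T Tne by (intro Min_in) auto
    then obtain a' b' where t: "(a', b') \<in> T" "s = q (a', b')" by auto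
    have sle: "s \<le> q p" if "p \<in> T" for p unfolding s_def using T that by (intro Min_le) auto
    have s0: "0 \<le> s" using t ysat[of a' b'] by (auto simp: q_def T_def divide_nonneg_neg)
    define w where "w i = y i + s * d i" for i
    have wv: "row_value k a w = row_value k a y + s * row_value k a d" for a
      unfolding w_def by (rule row_value_add)
    have "good w"
      unfolding good_def satisfies_def
    proof (intro conjI ballI, clarsimp)
      fix a b assume ab: "(a, b) \<in> C"
      show "of_int b \<le> row_value k a w"
      proof (cases "(a, b) \<in> T")
        case True
        then have "0 < - row_value k a d" by (simp add: T_def)
        moreover have "s \<le> (row_value k a y - of_int b) / - row_value k a d"
          using sle[OF True] by (simp only: q_def fst_conv snd_conv)
        ultimately have "s * - row_value k a d \<le> row_value k a y - of_int b"
          by (simp only: pos_le_divide_eq)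
        then show ?thesis by (simp add: wv)
      next
        case False
        then have "0 \<le> row_value k a d" using ab by (auto simp: T_def)
        then show ?thesis using ysat[OF ab] s0 by (simp add: wv add_increasing2)
      qed
    next
      have "(\<Sum>i<k. c i * w i) = (\<Sum>i<k. c i * y i) + s * (\<Sum>i<k. c i * d i)"
        by (simp add: w_def sum_distrib_left sum.distrib algebra_simps)
      then show "(\<Sum>i<k. c i * w i) \<le> (\<Sum>i<k. c i * z i)"
        using y cost s0 by (simp add: good_def mult_nonneg_nonpos add_decreasing2)
    qed
    moreover have "insert (a', b') (tight_rows k C y) \<subseteq> tight_rows k C w"
    proof -
      have "row_value k a' w = of_int b'" using t by (auto simp: wv q_def T_def)
      moreover have "(a', b') \<in> C" using t by (simp add: T_def)
      ultimately show ?thesis using d by (auto simp: tight_rows_def wv)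
    qed
    then have "card (insert (a', b') (tight_rows k C y)) \<le> nt w"
      unfolding nt_def by (rule card_mono[OF fin])
    moreover have "(a', b') \<notin> tight_rows k C y" using t(1) d by (force simp: T_def)
    then have "card (insert (a', b') (tight_rows k C y)) = Suc (nt y)" using fin by (simp add: nt_def)
    ultimately show False using ymax[of w] by simp
  qed
  then show ?thesis using y by (auto simp: good_def)
qed

text \<open>A bound for numerators and denominators of the solution of a system in \<open>k\<close> unknowns with entries
  of absolute value at most \<open>M\<close>. Eliminating one unknown replaces \<open>M\<close> by \<open>2 * M * M\<close>; the exponent is a
  convenient one for which the recurrence that results is satisfied.\<close>

definition height_bound :: "nat \<Rightarrow> nat \<Rightarrow> nat" where
  "height_bound k M = fact k * (2 * M) ^ (3 ^ k)"

lemma height_bound_Suc: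
  assumes "1 \<le> M"
  shows "Suc k * M * height_bound k (2 * M * M) \<le> height_bound (Suc k) M"
proof -
  have "M * (2 * (2 * M * M)) ^ (3 ^ k) \<le> (2 * M) ^ 1 * ((2 * M) ^ 2) ^ (3 ^ k)"
    by (intro mult_mono power_mono) (auto simp: power2_eq_square)
  also have "\<dots> = (2 * M) ^ (1 + 2 * 3 ^ k)" by (simp only: power_mult power_add)
  also have "\<dots> \<le> (2 * M) ^ (3 ^ Suc k)" using assms by (intro power_increasing) auto
  finally have "fact (Suc k) * (M * (2 * (2 * M * M)) ^ (3 ^ k)) \<le> fact (Suc k) * (2 * M) ^ (3 ^ Suc k)"
    by (rule mult_left_mono) simp
  then have "fact (Suc k) * (M * (2 * (2 * M * M)) ^ (3 ^ k)) \<le> height_bound (Suc k) M"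
    by (simp only: height_bound_def)
  moreover have "Suc k * M * height_bound k (2 * M * M) =
      fact (Suc k) * (M * (2 * (2 * M * M)) ^ (3 ^ k))"
    by (simp only: height_bound_def fact_Suc of_nat_id mult_ac)
  ultimately show ?thesis by (simp only:)
qed

text \<open>By elimination of the last unknown, whose value is recovered from the equation used for it.\<close>

lemma unique_solution_height:
  assumes "\<And>a b. (a, b) \<in> E \<Longrightarrow> row_value k a z = of_int b" "trivial_kernel k E"
    "\<And>a b i. (a, b) \<in> E \<Longrightarrow> i < k \<Longrightarrow> \<bar>a i\<bar> \<le> int M" "\<And>a b. (a, b) \<in> E \<Longrightarrow> \<bar>b\<bar> \<le> int M"
    "1 \<le> M"
  shows "\<exists>D n. 1 \<le> D \<and> D \<le> int (height_bound k M) \<and>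
    (\<forall>i<k. of_int D * z i = of_int (n i) \<and> \<bar>n i\<bar> \<le> int (height_bound k M))"
  using assms
proof (induction k arbitrary: E M)
  case 0
  then have "1 \<le> (2 * M) ^ (3 ^ 0)" by simp
  then show ?case by (intro exI[of _ 1]) (auto simp: height_bound_def)
next
  case (Suc k)
  have "\<exists>(a, b)\<in>E. a k \<noteq> 0"
  proof (rule ccontr)
    assume "\<not> ?thesis"
    then have "\<forall>(a, b)\<in>E. row_value (Suc k) a (\<lambda>i. if i = k then 1 else 0) = 0"
      by (auto simp: row_value_def)
    then show False using Suc.prems(2) unfolding trivial_kernel_def by fastforce
  qed
  then obtain a0 b0 where ab0: "(a0, b0) \<in> E" "a0 k \<noteq> 0" by auto
  define elim where "elim = (\<lambda>(a, b). (\<lambda>i. a0 k * a i - a k * a0 i, a0 k * b - a k * b0))"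
  have elim_value: "row_value k (fst (elim (a, b))) d =
      of_int (a0 k) * row_value k a d - of_int (a k) * row_value k a0 d" for a b d
    by (simp add: elim_def row_value_def sum_distrib_left sum_subtractf algebra_simps)
  have Mk: "\<bar>a i\<bar> \<le> int M" if "(a, b) \<in> E" "i < Suc k" for a b i using Suc.prems(3) that by blast
  have prodM: "\<bar>x * y - u * v\<bar> \<le> int (2 * M * M)"
    if "\<bar>x\<bar> \<le> int M" "\<bar>y\<bar> \<le> int M" "\<bar>u\<bar> \<le> int M" "\<bar>v\<bar> \<le> int M" for x y u v :: int
  proof -
    have "\<bar>x * y\<bar> \<le> int M * int M" "\<bar>u * v\<bar> \<le> int M * int M"
      using that unfolding abs_mult by (auto intro: mult_mono)
    then show ?thesis by simp
  qed
  let ?M = "2 * M * M" and ?B = "height_bound k (2 * M * M)"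
  have "\<exists>D n. 1 \<le> D \<and> D \<le> int ?B \<and> (\<forall>i<k. of_int D * z i = of_int (n i) \<and> \<bar>n i\<bar> \<le> int ?B)"
  proof (rule Suc.IH[of "elim ` E"])
    fix a b assume "(a, b) \<in> elim ` E"
    then obtain a1 b1 where ab1: "(a1, b1) \<in> E" "(a, b) = elim (a1, b1)" by auto
    have a: "a = fst (elim (a1, b1))" "b = a0 k * b1 - a1 k * b0" using ab1(2) by (auto simp: elim_def)
    have "row_value k a1 z = of_int b1 - of_int (a1 k) * z k" "row_value k a0 z = of_int b0 - of_int (a0 k) * z k"
      using Suc.prems(1)[OF ab1(1)] Suc.prems(1)[OF ab0(1)] by (auto simp: row_value_def)
    then have "row_value k a z = of_int (a0 k) * (of_int b1 - of_int (a1 k) * z k)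
        - of_int (a1 k) * (of_int b0 - of_int (a0 k) * z k)"
      unfolding a elim_value by presburger
    then show "row_value k a z = of_int b" unfolding a by (simp add: algebra_simps)
    show "\<bar>b\<bar> \<le> int ?M" unfolding a
      using Mk[OF ab0(1)] Mk[OF ab1(1)] Suc.prems(4)[OF ab0(1)] Suc.prems(4)[OF ab1(1)] by (intro prodM) auto
    fix i assume "i < k"
    then show "\<bar>a i\<bar> \<le> int ?M" unfolding a elim_def
      using Mk[OF ab0(1)] Mk[OF ab1(1)] by (simp only: prod.case fst_conv) (intro prodM; simp)
  next
    show "trivial_kernel k (elim ` E)"
      unfolding trivial_kernel_def
    proof (intro allI impI)
      fix d i assume d: "\<forall>(a, b)\<in>elim ` E. row_value k a d = 0" and i: "i < k"
      define t where "t = - row_value k a0 d / of_int (a0 k)"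
      define d' where "d' = d(k := t)"
      have ext: "row_value (Suc k) a d' = row_value k a d + of_int (a k) * t" for a
        by (simp add: row_value_def d'_def)
      have "row_value (Suc k) a d' = 0" if ab: "(a, b) \<in> E" for a b
      proof -
        have "row_value k (fst (elim (a, b))) d = 0" using d ab by force
        then have "of_int (a0 k) * row_value k a d = of_int (a k) * row_value k a0 d"
          unfolding elim_value by simp
        then show ?thesis unfolding ext t_def using ab0(2) by (simp add: field_simps)
      qed
      then have "d' i = 0" using Suc.prems(2) i unfolding trivial_kernel_def by fastforce
      then show "d i = 0" using i by (simp add: d'_def)
    qed
  qed (use Suc.prems(5) in auto)
  then obtain D n where D: "1 \<le> D" "D \<le> int ?B"
    and n: "\<And>i. i < k \<Longrightarrow> of_int D * z i = of_int (n i)" "\<And>i. i < k \<Longrightarrow> \<bar>n i\<bar> \<le> int ?B" by blast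
  define nk where "nk = sgn (a0 k) * (D * b0 - (\<Sum>i<k. a0 i * n i))"
  define n' where "n' i = (if i = k then nk else \<bar>a0 k\<bar> * n i)" for i
  have a0M: "\<bar>a0 i\<bar> \<le> int M" if "i \<le> k" for i using Mk[OF ab0(1), of i] that by simp
  have B: "int (Suc k) * (int M * int ?B) \<le> int (height_bound (Suc k) M)"
    using height_bound_Suc[OF Suc.prems(5), of k] by (metis of_nat_le_iff of_nat_mult mult.assoc)
  have B1: "int M * int ?B \<le> int (height_bound (Suc k) M)"
  proof -
    have "1 * (int M * int ?B) \<le> int (Suc k) * (int M * int ?B)" by (intro mult_right_mono) auto
    then show ?thesis using B by simp
  qed
  have 1: "1 \<le> \<bar>a0 k\<bar> * D" using ab0(2) D(1) by (metis int_one_le_iff_zero_less mult_pos_pos zero_less_abs_iff)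
  have 2: "\<bar>a0 k\<bar> * D \<le> int (height_bound (Suc k) M)"
    using a0M[of k] D by (intro order_trans[OF _ B1] mult_mono) auto
  have 3: "of_int (\<bar>a0 k\<bar> * D) * z i = of_int (n' i) \<and> \<bar>n' i\<bar> \<le> int (height_bound (Suc k) M)"
    if "i < Suc k" for i
  proof (cases "i = k")
    case False
    then have i: "i < k" using that by simp
    have "\<bar>a0 k\<bar> * \<bar>n i\<bar> \<le> int M * int ?B" using a0M[of k] n(2)[OF i] by (intro mult_mono) auto
    then show ?thesis using False n(1)[OF i] B1 by (simp add: n'_def abs_mult mult.assoc)
  next
    case True
    have "of_int (a0 k) * z k = of_int b0 - (\<Sum>i<k. of_int (a0 i) * z i)"
      using Suc.prems(1)[OF ab0(1)] by (simp add: row_value_def)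
    then have "of_int D * (of_int (a0 k) * z k) = of_int D * of_int b0 - (\<Sum>i<k. of_int (a0 i) * (of_int D * z i))"
      by (simp add: right_diff_distrib sum_distrib_left mult_ac)
    also have "(\<Sum>i<k. of_int (a0 i) * (of_int D * z i)) = (\<Sum>i<k. of_int (a0 i) * of_int (n i))"
      using n(1) by (intro sum.cong) auto
    finally have "of_int D * (of_int (a0 k) * z k) = of_int (D * b0 - (\<Sum>i<k. a0 i * n i))" by simp
    moreover have "\<bar>a0 k\<bar> = sgn (a0 k) * a0 k" by (simp add: abs_sgn mult.commute)
    ultimately have "of_int (\<bar>a0 k\<bar> * D) * z k = of_int nk"
      by (simp add: nk_def mult_ac)
    moreover have "\<bar>nk\<bar> \<le> int (height_bound (Suc k) M)"
    proof -
      have "\<bar>nk\<bar> = \<bar>D * b0 - (\<Sum>i<k. a0 i * n i)\<bar>"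
        using ab0(2) by (simp add: nk_def abs_mult sgn_if)
      also have "\<dots> \<le> \<bar>D * b0\<bar> + \<bar>\<Sum>i<k. a0 i * n i\<bar>" by linarith
      also have "\<dots> \<le> int M * int ?B + (\<Sum>i<k. int M * int ?B)"
      proof (rule add_mono)
        have "\<bar>b0\<bar> * \<bar>D\<bar> \<le> int M * int ?B" using D Suc.prems(4)[OF ab0(1)] by (intro mult_mono) auto
        then show "\<bar>D * b0\<bar> \<le> int M * int ?B" by (simp add: abs_mult mult.commute)
        have "\<bar>a0 i * n i\<bar> \<le> int M * int ?B" if "i < k" for i
          unfolding abs_mult using a0M[of i] n(2)[OF that] that by (intro mult_mono) auto
        then have "(\<Sum>i<k. \<bar>a0 i * n i\<bar>) \<le> (\<Sum>i<k. int M * int ?B)" by (intro sum_mono) auto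
        then show "\<bar>\<Sum>i<k. a0 i * n i\<bar> \<le> (\<Sum>i<k. int M * int ?B)" by (rule order_trans[OF sum_abs])
      qed
      also have "\<dots> = int (Suc k) * (int M * int ?B)" by (simp add: algebra_simps)
      finally show ?thesis using B by linarith
    qed
    ultimately show ?thesis using True by (simp add: n'_def)
  qed
  show ?case using 1 2 3 by (intro exI[of _ "\<bar>a0 k\<bar> * D"] exI[of _ n'] conjI allI impI) simp_all
qed

text \<open>Since all denominators are bounded, the factorial of the bound is a common denominator.\<close>

lemma bounded_vertex:
  assumes C: "finite C" and unit: "\<And>i. i < k \<Longrightarrow> unit_row i \<in> C"
    and z: "satisfies k C z" and c: "\<And>i. i < k \<Longrightarrow> 0 \<le> c i"
    and M: "\<And>a b i. (a, b) \<in> C \<Longrightarrow> i < k \<Longrightarrow> \<bar>a i\<bar> \<le> int M" "\<And>a b. (a, b) \<in> C \<Longrightarrow> \<bar>b\<bar> \<le> int M" "1 \<le> M"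
  shows "\<exists>z' n. satisfies k C z' \<and> (\<Sum>i<k. c i * z' i) \<le> (\<Sum>i<k. c i * z i) \<and>
     (\<forall>i<k. real (fact (height_bound k M)) * z' i = real (n i) \<and>
        n i \<le> fact (height_bound k M) * height_bound k M)"
proof -
  let ?B = "height_bound k M"
  obtain z' where z': "satisfies k C z'" "(\<Sum>i<k. c i * z' i) \<le> (\<Sum>i<k. c i * z i)"
    "trivial_kernel k (tight_rows k C z')"
    using vertex_of_low_cost[where c = c, OF C unit z c] by blast
  have "\<exists>D n. 1 \<le> D \<and> D \<le> int ?B \<and> (\<forall>i<k. of_int D * z' i = of_int (n i) \<and> \<bar>n i\<bar> \<le> int ?B)"
    by (rule unique_solution_height[OF _ z'(3) _ _ M(3)]) (use M in \<open>auto simp: tight_rows_def\<close>)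
  then obtain D n where D: "1 \<le> D" "D \<le> int ?B"
    and n: "\<And>i. i < k \<Longrightarrow> of_int D * z' i = of_int (n i)" "\<And>i. i < k \<Longrightarrow> \<bar>n i\<bar> \<le> int ?B" by blast
  have "nat D dvd fact ?B" using D by (intro dvd_fact) auto
  then obtain e where e: "fact ?B = nat D * e" by blast
  have main: "real (fact ?B) * z' i = real (e * nat (n i)) \<and> e * nat (n i) \<le> fact ?B * ?B" if i: "i < k" for i
  proof -
    have "0 \<le> z' i"
      using z'(1) unit[OF i] row_value_unit[OF i, of z'] by (force simp: satisfies_def unit_row_def)
    then have "0 \<le> (of_int (n i) :: real)" using n(1)[OF i] D by (metis mult_nonneg_nonneg of_int_0_le_iff order_trans zero_le_one)
    then have n0: "0 \<le> n i" by simp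
    have "real (fact ?B) * z' i = real e * (of_int D * z' i)" unfolding e using D by simp
    also have "\<dots> = real (e * nat (n i))" using n(1)[OF i] n0 by simp
    finally have "real (fact ?B) * z' i = real (e * nat (n i))" .
    moreover have "e * nat (n i) \<le> fact ?B * ?B"
    proof (rule mult_mono)
      show "e \<le> fact ?B" unfolding e using D by (cases "nat D") auto
      show "nat (n i) \<le> ?B" using n(2)[OF i] by simp
    qed auto
    ultimately show ?thesis by simp
  qed
  show ?thesis
    by (intro exI[of _ z'] exI[of _ "\<lambda>i. e * nat (n i)"]) (use z' main in auto)
qed


section \<open>Monochromatic tilings as games\<close>

definition tilings :: "nat \<Rightarrow> (nat set \<Rightarrow> nat) \<Rightarrow> nat \<Rightarrow> 'a graph \<Rightarrow> nat set \<Rightarrow> nat graph set set" where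
  "tilings n \<kappa> l H S = {C. C \<subseteq> mono_copies n \<kappa> l H \<and>
     pairwise (\<lambda>K K'. disjnt (verts K) (verts K')) C \<and> (\<forall>K\<in>C. verts K \<subseteq> S)}"

definition tiling_within :: "nat \<Rightarrow> (nat set \<Rightarrow> nat) \<Rightarrow> nat \<Rightarrow> 'a graph \<Rightarrow> nat set \<Rightarrow> nat" where
  "tiling_within n \<kappa> l H S = Max (card ` tilings n \<kappa> l H S)"

lemma finite_mono_copies:
  assumes "finite_graph H"
  shows "finite (mono_copies n \<kappa> l H)"
proof (rule finite_subset)
  show "mono_copies n \<kappa> l H \<subseteq> Pow {..<n} \<times> Pow (Pow {..<n})"
  proof
    fix K assume "K \<in> mono_copies n \<kappa> l H"
    then obtain f where f: "K = image_graph f H" "f ` verts H \<subseteq> {..<n}"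
      by (auto simp: mono_copies_def)
    have "f ` e \<subseteq> {..<n}" if "e \<in> edges H" for e
      using assms that f(2) unfolding finite_graph_def by blast
    then show "K \<in> Pow {..<n} \<times> Pow (Pow {..<n})" using f by (auto simp: image_graph_def)
  qed
qed auto

lemma finite_tilings:
  assumes "finite_graph H"
  shows "finite (tilings n \<kappa> l H S)"
  by (rule finite_subset[of _ "Pow (mono_copies n \<kappa> l H)"])
     (use finite_mono_copies[OF assms] in \<open>auto simp: tilings_def\<close>)

lemma finite_tiling: "finite_graph H \<Longrightarrow> C \<in> tilings n \<kappa> l H S \<Longrightarrow> finite C"
  by (rule finite_subset[OF _ finite_mono_copies]) (auto simp: tilings_def)

lemma empty_tiling: "{} \<in> tilings n \<kappa> l H S"
  by (simp add: tilings_def)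

lemma card_le_tiling_within:
  "finite_graph H \<Longrightarrow> C \<in> tilings n \<kappa> l H S \<Longrightarrow> card C \<le> tiling_within n \<kappa> l H S"
  unfolding tiling_within_def by (intro Max_ge) (auto simp: finite_tilings)

lemma tiling_within_attained:
  assumes "finite_graph H"
  obtains C where "C \<in> tilings n \<kappa> l H S" "card C = tiling_within n \<kappa> l H S"
proof -
  have "tiling_within n \<kappa> l H S \<in> card ` tilings n \<kappa> l H S"
    unfolding tiling_within_def using empty_tiling finite_tilings[OF assms] by (intro Max_in) blast+
  then show ?thesis using that by auto
qed

lemma mono_copy_verts: "K \<in> mono_copies n \<kappa> l H \<Longrightarrow> verts K \<subseteq> {..<n}"
  unfolding mono_copies_def image_graph_def by (elim CollectE exE conjE) simp

lemma mono_copy_nonempty: "K \<in> mono_copies n \<kappa> l H \<Longrightarrow> verts H \<noteq> {} \<Longrightarrow> verts K \<noteq> {}"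
  by (auto simp: mono_copies_def image_graph_def)

lemma mono_tiling_number_eq: "mono_tiling_number n \<kappa> l H = tiling_within n \<kappa> l H {..<n}"
proof -
  have "{card C | C. C \<subseteq> mono_copies n \<kappa> l H \<and> pairwise (\<lambda>K K'. disjnt (verts K) (verts K')) C}
    = card ` tilings n \<kappa> l H {..<n}"
    unfolding tilings_def using mono_copy_verts by blast
  then show ?thesis by (simp add: mono_tiling_number_def tiling_within_def)
qed

lemma tiling_within_empty:
  assumes "finite_graph H" "verts H \<noteq> {}"
  shows "tiling_within n \<kappa> l H {} = 0"
proof -
  obtain C where C: "C \<in> tilings n \<kappa> l H {}" "card C = tiling_within n \<kappa> l H {}"
    by (rule tiling_within_attained[OF assms(1)])
  have "C = {}" using C(1) mono_copy_nonempty[OF _ assms(2)] by (force simp: tilings_def)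
  then show ?thesis using C(2) by simp
qed

lemma tiling_within_mono:
  assumes "finite_graph H" "S \<subseteq> T"
  shows "tiling_within n \<kappa> l H S \<le> tiling_within n \<kappa> l H T"
proof -
  obtain C where C: "C \<in> tilings n \<kappa> l H S" "card C = tiling_within n \<kappa> l H S"
    by (rule tiling_within_attained[OF assms(1)])
  have "C \<in> tilings n \<kappa> l H T" using C(1) assms(2) by (fastforce simp: tilings_def)
  then show ?thesis using card_le_tiling_within[OF assms(1)] C(2) by metis
qed

lemma tiling_within_insert:
  assumes "finite_graph H"
  shows "tiling_within n \<kappa> l H (insert v S) \<le> tiling_within n \<kappa> l H S + 1"
proof -
  obtain C where C: "C \<in> tilings n \<kappa> l H (insert v S)" "card C = tiling_within n \<kappa> l H (insert v S)"
    by (rule tiling_within_attained[OF assms(1)])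
  have finC: "finite C" using finite_tiling assms C(1) by blast
  define D where "D = {K\<in>C. v \<in> verts K}"
  have "card D \<le> 1"
  proof (rule card_le_Suc0_iff_eq[THEN iffD2, unfolded One_nat_def[symmetric]])
    have "verts K \<inter> verts K' = {}" if "K \<in> C" "K' \<in> C" "K \<noteq> K'" for K K'
      using C(1) that by (simp add: tilings_def pairwise_def disjnt_def)
    then show "\<forall>a1\<in>D. \<forall>a2\<in>D. a1 = a2" unfolding D_def by blast
  qed (use finC in \<open>simp add: D_def\<close>)
  moreover have "C - D \<in> tilings n \<kappa> l H S"
    using C(1) by (auto simp: D_def tilings_def pairwise_def)
  then have "card (C - D) \<le> tiling_within n \<kappa> l H S" by (rule card_le_tiling_within[OF assms])
  moreover have "card (C - D) = card C - card D"
    using finC by (intro card_Diff_subset) (auto simp: D_def)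
  ultimately show ?thesis using C(2) by simp
qed

lemma tiling_within_add_copy:
  assumes "finite_graph H" "verts H \<noteq> {}" and K: "K \<in> mono_copies n \<kappa> l H"
  shows "tiling_within n \<kappa> l H (S - verts K) + 1 \<le> tiling_within n \<kappa> l H (S \<union> verts K)"
proof -
  obtain C where C: "C \<in> tilings n \<kappa> l H (S - verts K)" "card C = tiling_within n \<kappa> l H (S - verts K)"
    by (rule tiling_within_attained[OF assms(1)])
  have finC: "finite C" using finite_tiling assms(1) C(1) by blast
  have dis: "verts K' \<inter> verts K = {}" if "K' \<in> C" for K' using C(1) that by (auto simp: tilings_def)
  then have "K \<notin> C" using mono_copy_nonempty[OF K assms(2)] by blast
  moreover have "insert K C \<in> tilings n \<kappa> l H (S \<union> verts K)"
    unfolding tilings_def mem_Collect_eq pairwise_insert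
  proof (intro conjI allI impI ballI)
    show "disjnt (verts K) (verts K')" "disjnt (verts K') (verts K)" if "K' \<in> C \<and> K' \<noteq> K" for K'
      using dis[of K'] that by (auto simp: disjnt_def)
    show "verts K' \<subseteq> S \<union> verts K" if "K' \<in> insert K C" for K'
      using C(1) that by (auto simp: tilings_def)
  qed (use C(1) K in \<open>auto simp: tilings_def\<close>)
  then have "card (insert K C) \<le> tiling_within n \<kappa> l H (S \<union> verts K)"
    by (rule card_le_tiling_within[OF assms(1)])
  ultimately show ?thesis using C(2) finC by simp
qed

lemma tiling_game:
  assumes "finite_graph H" "verts H \<noteq> {}"
  shows "unit_game {..<n} (\<lambda>S. real (tiling_within n \<kappa> l H S))"
  unfolding unit_game_def
  using tiling_within_empty[OF assms] tiling_within_mono[OF assms(1)] tiling_within_insert[OF assms(1)]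
  by (auto simp: subset_insertI) (metis of_nat_Suc of_nat_le_iff Suc_eq_plus1 add.commute)

lemma mono_tiling_number_le: 
  assumes "finite_graph H" "verts H \<noteq> {}"
  shows "mono_tiling_number n \<kappa> l H \<le> n"
proof -
  have "tiling_within n \<kappa> l H S \<le> card S" if "finite S" for S :: "nat set"
    using that
  proof (induction S rule: finite_induct)
    case (insert v S)
    then show ?case using tiling_within_insert[OF assms(1), of n \<kappa> l v S] by simp
  qed (simp add: tiling_within_empty[OF assms])
  from this[of "{..<n}"] show ?thesis by (simp add: mono_tiling_number_eq)
qed

lemma mono_tiling_number_le_tiling_number:
  "l \<in> {1..r} \<Longrightarrow> mono_tiling_number n \<kappa> l H \<le> tiling_number r n H \<kappa>"
  unfolding tiling_number_def by (intro Max_ge) auto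

lemma verts_nonempty: "finite_graph H \<Longrightarrow> edges H \<noteq> {} \<Longrightarrow> verts H \<noteq> {}"
  by (fastforce simp: finite_graph_def)


section \<open>Covers of templates\<close>

text \<open>Dual solutions of the linear programs of all colours at once, over an arbitrary set of strips.\<close>

definition template_cover ::
  "nat \<Rightarrow> 'a graph \<Rightarrow> nat set \<Rightarrow> (nat \<Rightarrow> nat \<Rightarrow> nat) \<Rightarrow> (nat \<Rightarrow> nat \<Rightarrow> real) \<Rightarrow> bool" where
  "template_cover r H J lam y \<longleftrightarrow> (\<forall>l\<in>{1..r}. (\<forall>i\<in>J. 0 \<le> y l i) \<and>
     (\<forall>f\<in>verts H \<rightarrow> J. (\<forall>u v. {u, v} \<in> edges H \<longrightarrow> lam (f u) (f v) = l) \<longrightarrow>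
        1 \<le> (\<Sum>v\<in>verts H. y l (f v))))"

definition cover_bound :: "nat \<Rightarrow> 'a graph \<Rightarrow> real \<Rightarrow> bool" where
  "cover_bound r H b \<longleftrightarrow> (\<exists>q lam x y. 1 \<le> q \<and> q \<le> r \<and> strip_template r q lam \<and>
     x \<in> weight_simplex q \<and> template_cover r H {1..q} lam y \<and>
     (\<forall>l\<in>{1..r}. (\<Sum>i\<in>{1..q}. x i * y l i) \<le> b))"

text \<open>A template with many strips may be restricted to the support of sizes that do not raise the \<open>r\<close>
  averages of the cover; the reason for the bound \<open>r\<close> on the number of strips.\<close>

lemma cover_bound_many_strips:
  assumes r: "1 \<le> r" and J: "finite J" and x: "\<And>i. i \<in> J \<Longrightarrow> 0 \<le> x i" "(\<Sum>i\<in>J. x i) = 1"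
    and lam: "\<And>i j. i \<in> J \<Longrightarrow> j \<in> J \<Longrightarrow> lam i j \<in> {1..r} \<and> lam j i = lam i j"
    and y: "template_cover r H J lam y"
    and b: "\<And>l. l \<in> {1..r} \<Longrightarrow> (\<Sum>i\<in>J. x i * y l i) \<le> b"
  shows "cover_bound r H b"
proof -
  have y0: "\<And>l i. l \<in> {1..r} \<Longrightarrow> i \<in> J \<Longrightarrow> 0 \<le> y l i" using y by (auto simp: template_cover_def)
  have "\<exists>x'. (\<forall>i\<in>J. 0 \<le> x' i) \<and> (\<Sum>i\<in>J. x' i) = 1 \<and> card {i\<in>J. x' i \<noteq> 0} \<le> r \<and>
    (\<forall>l\<in>{1..r}. (\<Sum>i\<in>J. x' i * y l i) \<le> (\<Sum>i\<in>J. x i * y l i))"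
    by (rule averages_with_small_support) (use J r x y0 in auto)
  then obtain x' where x': "\<forall>i\<in>J. 0 \<le> x' i" "(\<Sum>i\<in>J. x' i) = 1" "card {i\<in>J. x' i \<noteq> 0} \<le> r"
    "\<forall>l\<in>{1..r}. (\<Sum>i\<in>J. x' i * y l i) \<le> (\<Sum>i\<in>J. x i * y l i)"
    by (elim exE conjE) (rule that)
  define J' where "J' = {i\<in>J. x' i \<noteq> 0}"
  define q where "q = card J'"
  have J': "finite J'" "J' \<subseteq> J" using J by (auto simp: J'_def)
  have sumJ': "(\<Sum>i\<in>J. x' i * g i) = (\<Sum>i\<in>J'. x' i * g i)" for g
    using J by (intro sum.mono_neutral_right) (auto simp: J'_def)
  have "J' \<noteq> {}" using sumJ'[of "\<lambda>_. 1"] x'(2) by auto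
  then have q: "1 \<le> q" "q \<le> r" using J' x'(3) by (auto simp: q_def J'_def Suc_le_eq card_gt_0_iff)
  obtain e where e: "bij_betw e {1..q} J'" using ex_bij_betw_nat_finite_1[OF J'(1)] by (auto simp: q_def)
  have eJ: "e i \<in> J" if "i \<in> {1..q}" for i using e J'(2) that by (auto simp: bij_betw_def)
  have reindex: "(\<Sum>i\<in>{1..q}. x' (e i) * g (e i)) = (\<Sum>i\<in>J. x' i * g i)" for g
    unfolding sumJ' by (rule sum.reindex_bij_betw[OF e])
  show ?thesis
    unfolding cover_bound_def
  proof (intro exI conjI)
    show "strip_template r q (\<lambda>i j. lam (e i) (e j))"
      unfolding strip_template_def using lam eJ by blast
    show "(\<lambda>i. x' (e i)) \<in> weight_simplex q"
      using reindex[of "\<lambda>_. 1"] x' eJ by (auto simp: weight_simplex_def)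
    show "template_cover r H {1..q} (\<lambda>i j. lam (e i) (e j)) (\<lambda>l i. y l (e i))"
      unfolding template_cover_def
    proof (intro ballI conjI impI)
      fix l assume l: "l \<in> {1..r}"
      show "0 \<le> y l (e i)" if "i \<in> {1..q}" for i using y0[OF l] eJ that by blast
      fix f assume f: "f \<in> verts H \<rightarrow> {1..q}" "\<forall>u v. {u, v} \<in> edges H \<longrightarrow> lam (e (f u)) (e (f v)) = l"
      have "(\<lambda>v. e (f v)) \<in> verts H \<rightarrow> J" using f(1) eJ by blast
      then show "1 \<le> (\<Sum>v\<in>verts H. y l (e (f v)))"
        using y[unfolded template_cover_def, rule_format, OF l, THEN conjunct2, rule_format] f(2) by simp
    qed
    show "\<forall>l\<in>{1..r}. (\<Sum>i\<in>{1..q}. x' (e i) * y l (e i)) \<le> b"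
    proof
      fix l assume l: "l \<in> {1..r}"
      show "(\<Sum>i\<in>{1..q}. x' (e i) * y l (e i)) \<le> b"
        unfolding reindex using x'(4)[rule_format, OF l] b[OF l] by linarith
    qed
  qed (use q in auto)
qed


section \<open>Every colouring yields a cover\<close>

lemma edge_verts:
  assumes "finite_graph H" "{u, v} \<in> edges H"
  shows "u \<in> verts H" "v \<in> verts H" "u \<noteq> v"
proof -
  have "{u, v} \<subseteq> verts H" "card {u, v} = 2" using assms by (auto simp: finite_graph_def)
  then show "u \<in> verts H" "v \<in> verts H" "u \<noteq> v" by auto
qed

lemma edge_pair:
  assumes "finite_graph H" "e \<in> edges H"
  obtains a b where "e = {a, b}" "a \<noteq> b" "a \<in> verts H" "b \<in> verts H"
proof -
  have "e \<subseteq> verts H" "card e = 2" using assms by (auto simp: finite_graph_def)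
  then show ?thesis using that by (auto simp: card_2_iff)
qed

text \<open>Ramsey's theorem is applied to the colouring combined with the relation \<open>u \<in> Z v \<or> v \<in> Z u\<close>. Two
  homogeneous sets of size \<open>M\<close> have about \<open>M * M\<close> pairs, of which only \<open>2 * B * M\<close> can be in this relation; so
  for large \<open>M\<close> none is.\<close>

lemma homogeneous_good_classes:
  "\<exists>N. \<forall>n \<kappa> (Z :: nat \<Rightarrow> nat set) (J :: nat set) V. \<kappa> \<in> colourings r n \<and> (\<forall>v<n. finite (Z v) \<and> card (Z v) \<le> B) \<and>
     J \<subseteq> {..<K} \<and> (\<forall>i\<in>J. V i \<subseteq> {..<n} \<and> N \<le> card (V i)) \<longrightarrow>
     (\<exists>U lam. (\<forall>i\<in>J. U i \<subseteq> V i \<and> finite (U i) \<and> h \<le> card (U i)) \<and>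
        (\<forall>i\<in>J. \<forall>j\<in>J. lam i j \<in> {1..r} \<and> lam j i = lam i j \<and>
           (\<forall>u\<in>U i. \<forall>v\<in>U j. u \<noteq> v \<longrightarrow> u \<notin> Z v \<and> \<kappa> {u, v} = lam i j)))"
proof -
  define M where "M = 2 * B + h + 2"
  have "0 < 2 * r + 2" by simp
  from ramsey_classes[OF this] obtain N where N:
    "\<forall>J (V :: nat \<Rightarrow> nat set) \<psi>. J \<subseteq> {..<K} \<and> (\<forall>i\<in>J. finite (V i) \<and> N \<le> card (V i)) \<and>
       (\<forall>e. \<psi> e < 2 * r + 2) \<longrightarrow>
     (\<exists>U L. (\<forall>i\<in>J. U i \<subseteq> V i \<and> card (U i) = M) \<and>
        (\<forall>i\<in>J. \<forall>j\<in>J. \<forall>u\<in>U i. \<forall>v\<in>U j. u \<noteq> v \<longrightarrow> \<psi> {u, v} = L i j))" ..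
  show ?thesis
  proof (intro exI[of _ N] allI impI, elim conjE)
    fix n \<kappa> and Z :: "nat \<Rightarrow> nat set" and J V
    assume \<kappa>: "\<kappa> \<in> colourings r n" and Z: "\<forall>v<n. finite (Z v) \<and> card (Z v) \<le> B"
      and J: "J \<subseteq> {..<K}" and V: "\<forall>i\<in>J. V i \<subseteq> {..<n} \<and> N \<le> card (V i)"
    define bad where "bad e \<longleftrightarrow> (\<exists>u v. e = {u, v} \<and> u \<in> Z v)" for e
    define \<psi> where "\<psi> e = 2 * min r (\<kappa> e) + (if bad e then 1 else 0)" for e
    have "\<forall>e. \<psi> e < 2 * r + 2" by (auto simp: \<psi>_def min_def)
    moreover have "\<forall>i\<in>J. finite (V i) \<and> N \<le> card (V i)" using V by (meson finite_lessThan finite_subset)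
    ultimately obtain U L where U: "\<forall>i\<in>J. U i \<subseteq> V i \<and> card (U i) = M"
      and L: "\<forall>i\<in>J. \<forall>j\<in>J. \<forall>u\<in>U i. \<forall>v\<in>U j. u \<noteq> v \<longrightarrow> \<psi> {u, v} = L i j"
      using N[rule_format, of J V \<psi>] J by auto
    have Un: "U i \<subseteq> {..<n}" "card (U i) = M" "finite (U i)" if "i \<in> J" for i
    proof -
      show "U i \<subseteq> {..<n}" "card (U i) = M" using U V that by blast+
      then show "finite (U i)" using finite_subset by blast
    qed
    have \<kappa>r: "\<kappa> {u, v} \<in> {1..r}" if "u < n" "v < n" "u \<noteq> v" for u v
      using \<kappa> that by (auto simp: colourings_def complete_edges_def PiE_iff)
    have notodd: "even (L i j)" if ij: "i \<in> J" "j \<in> J" for i j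
    proof (rule ccontr)
      assume odd: "odd (L i j)"
      have allbad: "u \<in> Z v \<or> v \<in> Z u" if "u \<in> U i" "v \<in> U j" "u \<noteq> v" for u v
      proof -
        have "odd (\<psi> {u, v})" using L that ij odd by simp
        then have "bad {u, v}" by (auto simp: \<psi>_def split: if_splits)
        then show ?thesis by (auto simp: bad_def doubleton_eq_iff)
      qed
      define A where "A = (SIGMA v:U j. Z v)"
      define A' where "A' = (SIGMA u:U i. Z u)"
      have "card A \<le> M * B" "card A' \<le> M * B" "finite A" "finite A'"
      proof -
        have c: "card (SIGMA v:U k. Z v) \<le> M * B" "finite (SIGMA v:U k. Z v)" if k: "k \<in> J" for k
        proof -
          have Zk: "finite (Z v) \<and> card (Z v) \<le> B" if "v \<in> U k" for v using Z Un[OF k] that by blast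
          then have "card (SIGMA v:U k. Z v) = (\<Sum>v\<in>U k. card (Z v))"
            using Un[OF k] by (intro card_SigmaI) auto
          also have "\<dots> \<le> card (U k) * B" using sum_bounded_above[of "U k" "\<lambda>v. card (Z v)" B] Zk by simp
          finally show "card (SIGMA v:U k. Z v) \<le> M * B" using Un[OF k] by simp
          show "finite (SIGMA v:U k. Z v)" using Un[OF k] Zk by auto
        qed
        show "card A \<le> M * B" "card A' \<le> M * B" "finite A" "finite A'"
          unfolding A_def A'_def using c ij by blast+
      qed
      moreover have "(U i \<times> U j) - (\<lambda>u. (u, u)) ` U i \<subseteq> prod.swap ` A \<union> A'"
      proof
        fix p assume "p \<in> (U i \<times> U j) - (\<lambda>u. (u, u)) ` U i"
        then obtain u v where p: "p = (u, v)" "u \<in> U i" "v \<in> U j" "u \<noteq> v" by auto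
        then have "(v, u) \<in> A \<or> (u, v) \<in> A'" using allbad by (auto simp: A_def A'_def)
        then show "p \<in> prod.swap ` A \<union> A'"
          using imageI[of "(v, u)" A prod.swap] p by auto
      qed
      ultimately have "card ((U i \<times> U j) - (\<lambda>u. (u, u)) ` U i) \<le> card (prod.swap ` A \<union> A')"
        by (intro card_mono) auto
      also have "\<dots> \<le> card (prod.swap ` A) + card A'" by (rule card_Un_le)
      also have "\<dots> \<le> M * B + M * B"
        using card_image_le[OF \<open>finite A\<close>, of prod.swap] \<open>card A \<le> M * B\<close> \<open>card A' \<le> M * B\<close> by linarith
      finally have "card ((U i \<times> U j) - (\<lambda>u. (u, u)) ` U i) \<le> M * B + M * B" .
      moreover have "card (U i \<times> U j) - card ((\<lambda>u. (u, u)) ` U i) \<le> card ((U i \<times> U j) - (\<lambda>u. (u, u)) ` U i)"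
        using Un ij by (intro diff_card_le_card_Diff) auto
      moreover have "card ((\<lambda>u. (u, u)) ` U i) \<le> M" using card_image_le[OF Un(3)[OF ij(1)]] Un(2)[OF ij(1)] by metis
      moreover have "card (U i \<times> U j) = M * M" using Un ij by simp
      ultimately have "M * M \<le> M * B + M * B + M" by linarith
      then have "M * M \<le> M * (2 * B + 1)" by (simp add: algebra_simps)
      moreover have "0 < M" by (simp add: M_def)
      ultimately have "M \<le> 2 * B + 1" by (simp only: mult_le_cancel1)
      then show False by (simp add: M_def)
    qed
    define lam where "lam i j = L i j div 2" for i j
    have good: "u \<notin> Z v \<and> \<kappa> {u, v} = lam i j"
      if ij: "i \<in> J" "j \<in> J" and uv: "u \<in> U i" "v \<in> U j" "u \<noteq> v" for i j u v
    proof -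
      have psi: "\<psi> {u, v} = L i j" using L ij uv by blast
      then have "even (\<psi> {u, v})" using notodd[OF ij] by simp
      then have nb: "\<not> bad {u, v}" by (simp add: \<psi>_def split: if_splits)
      have "\<kappa> {u, v} \<le> r" using \<kappa>r[of u v] Un[OF ij(1)] Un[OF ij(2)] uv by auto
      then have "2 * \<kappa> {u, v} = L i j" using psi nb by (simp add: \<psi>_def min_absorb2)
      then show ?thesis using nb by (auto simp: lam_def bad_def)
    qed
    have "lam i j \<in> {1..r} \<and> lam j i = lam i j" if ij: "i \<in> J" "j \<in> J" for i j
    proof -
      have "0 < card (U i)" using Un(2)[OF ij(1)] by (simp add: M_def)
      then obtain u where u: "u \<in> U i" by (metis card_gt_0_iff ex_in_conv)
      have "0 < card (U j - {u})" using Un[OF ij(2)] by (simp add: card_Diff_singleton_if M_def)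
      then obtain v where v: "v \<in> U j" "u \<noteq> v" by (metis card_gt_0_iff Diff_iff ex_in_conv singletonI)
      have "\<kappa> {u, v} = lam i j" "\<kappa> {v, u} = lam j i" using good ij u v by blast+
      moreover have "\<kappa> {u, v} \<in> {1..r}" using \<kappa>r[of u v] Un(1)[OF ij(1)] Un(1)[OF ij(2)] u v by auto
      ultimately show ?thesis by (simp add: insert_commute)
    qed
    then show "\<exists>U lam. (\<forall>i\<in>J. U i \<subseteq> V i \<and> finite (U i) \<and> h \<le> card (U i)) \<and>
        (\<forall>i\<in>J. \<forall>j\<in>J. lam i j \<in> {1..r} \<and> lam j i = lam i j \<and>
           (\<forall>u\<in>U i. \<forall>v\<in>U j. u \<noteq> v \<longrightarrow> u \<notin> Z v \<and> \<kappa> {u, v} = lam i j))"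
      using good U Un by (intro exI[of _ U] exI[of _ lam]) (auto simp: M_def)
  qed
qed

text \<open>Each class has room for all vertices of \<open>H\<close>, so those that are mapped to the same strip can be kept
  apart.\<close>

lemma embed_template_map:
  assumes H: "finite_graph H" and f: "f \<in> verts H \<rightarrow> J"
    and hom: "\<And>u v. {u, v} \<in> edges H \<Longrightarrow> lam (f u) (f v) = l"
    and U: "\<And>i. i \<in> J \<Longrightarrow> U i \<subseteq> {..<n} \<and> finite (U i) \<and> card (verts H) \<le> card (U i)"
    and disj: "\<And>i j. i \<in> J \<Longrightarrow> j \<in> J \<Longrightarrow> i \<noteq> j \<Longrightarrow> U i \<inter> U j = {}"
    and col: "\<And>i j u v. i \<in> J \<Longrightarrow> j \<in> J \<Longrightarrow> u \<in> U i \<Longrightarrow> v \<in> U j \<Longrightarrow> u \<noteq> v \<Longrightarrow> \<kappa> {u, v} = lam i j"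
  obtains g where "inj_on g (verts H)" "\<And>v. v \<in> verts H \<Longrightarrow> g v \<in> U (f v)"
    "image_graph g H \<in> mono_copies n \<kappa> l H"
proof -
  have finH: "finite (verts H)" using H by (simp add: finite_graph_def)
  have "\<exists>e. e ` verts H \<subseteq> U i \<and> inj_on e (verts H)" if "i \<in> J" for i
    using card_le_inj[OF finH, of "U i"] U[OF that] by blast
  then obtain e where e: "\<And>i. i \<in> J \<Longrightarrow> e i ` verts H \<subseteq> U i" "\<And>i. i \<in> J \<Longrightarrow> inj_on (e i) (verts H)"
    by metis
  define g where "g v = e (f v) v" for v
  have fJ: "f v \<in> J" if "v \<in> verts H" for v using f that by auto
  have gU: "g v \<in> U (f v)" if "v \<in> verts H" for v using e(1)[OF fJ[OF that]] that by (auto simp: g_def)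
  have inj: "inj_on g (verts H)"
  proof (rule inj_onI)
    fix u v assume uv: "u \<in> verts H" "v \<in> verts H" "g u = g v"
    then have "f u = f v" using disj[OF fJ fJ, of u v] gU by (metis IntI empty_iff)
    then show "u = v" using uv e(2)[OF fJ[OF uv(2)]] by (auto simp: g_def inj_on_def)
  qed
  have "\<kappa> (g ` ed) = l" if ed: "ed \<in> edges H" for ed
  proof -
    obtain a b where ab: "ed = {a, b}" "a \<noteq> b" "a \<in> verts H" "b \<in> verts H"
      using edge_pair[OF H ed] by blast
    have "g a \<noteq> g b" using inj ab by (auto dest: inj_onD)
    then have "\<kappa> {g a, g b} = lam (f a) (f b)" using col[OF fJ fJ gU gU] ab by blast
    then show ?thesis using hom ab ed by simp
  qed
  moreover have "g ` verts H \<subseteq> {..<n}" using gU U fJ by blast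
  ultimately have "image_graph g H \<in> mono_copies n \<kappa> l H" using inj by (auto simp: mono_copies_def)
  then show ?thesis using that inj gU by blast
qed


text \<open>The Shapley values of all colours, rounded to a grid, split the vertices into boundedly many
  classes. A homogeneous choice inside the large classes is a template, and the rounded values are
  almost a cover of it, because each template map is realized by a copy without bad patterns.\<close>

lemma colouring_gives_cover:
  assumes r: "1 \<le> r" and H: "finite_graph H" and E: "edges H \<noteq> {}" and eps: "0 < \<epsilon>"
  shows "\<exists>n0. \<forall>n\<ge>n0. \<forall>\<kappa>\<in>colourings r n.
     cover_bound r H (real (tiling_number r n H \<kappa>) / real n + \<epsilon>)"
proof -
  define h where "h = card (verts H)"
  have vH: "verts H \<noteq> {}" by (rule verts_nonempty[OF H E])
  have finH: "finite (verts H)" using H by (simp add: finite_graph_def)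
  have h: "1 \<le> h" using vH finH by (simp add: h_def Suc_le_eq card_gt_0_iff)
  define \<eta> where "\<eta> = min (1/4) (\<epsilon> / 6)"
  have \<eta>: "0 < \<eta>" "\<eta> \<le> 1/4" "6 * \<eta> \<le> \<epsilon>" using eps by (auto simp: \<eta>_def min_def)
  \<comment> \<open>The losses \<open>2 * d\<close> from cutting off the ends and \<open>h * e\<close> from bad patterns add up to \<open>\<eta>\<close>.\<close>
  define d where "d = \<eta> / 4"
  define e where "e = \<eta> / (2 * real h)"
  have d: "0 < d" "d < 1/2" using \<eta> by (auto simp: d_def)
  have e: "0 < e" "2 * d + real h * e = \<eta>" using \<eta> h by (auto simp: d_def e_def)
  define G where "G = nat \<lceil>1 / \<eta>\<rceil>"
  have G: "0 < G" "1 / real G \<le> \<eta>"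
  proof -
    have "1 / \<eta> \<le> real G" unfolding G_def by linarith
    moreover have "0 < 1 / \<eta>" using \<eta> by simp
    ultimately have "0 < real G" by linarith
    then show "0 < G" "1 / real G \<le> \<eta>"
      using \<open>1 / \<eta> \<le> real G\<close> \<eta> by (auto simp: field_simps)
  qed
  define B0 where "B0 = nat \<lceil>real h / (d ^ h * e\<^sup>2)\<rceil>"
  define T where "T = {1..r} \<rightarrow>\<^sub>E {..G}"
  define K where "K = card T"
  have finT: "finite T" by (auto simp: T_def intro: finite_PiE)
  obtain \<tau> where \<tau>: "bij_betw \<tau> {..<K} T"
    using ex_bij_betw_nat_finite[OF finT] by (auto simp: K_def atLeast0LessThan)
  from homogeneous_good_classes obtain N where N:
    "\<forall>n \<kappa> (Z :: nat \<Rightarrow> nat set) (J :: nat set) V. \<kappa> \<in> colourings r n \<and>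
       (\<forall>v<n. finite (Z v) \<and> card (Z v) \<le> r * B0) \<and>
       J \<subseteq> {..<K} \<and> (\<forall>i\<in>J. V i \<subseteq> {..<n} \<and> N \<le> card (V i)) \<longrightarrow>
     (\<exists>U lam. (\<forall>i\<in>J. U i \<subseteq> V i \<and> finite (U i) \<and> h \<le> card (U i)) \<and>
        (\<forall>i\<in>J. \<forall>j\<in>J. lam i j \<in> {1..r} \<and> lam j i = lam i j \<and>
           (\<forall>u\<in>U i. \<forall>v\<in>U j. u \<noteq> v \<longrightarrow> u \<notin> Z v \<and> \<kappa> {u, v} = lam i j)))" ..
  define n0 where "n0 = nat \<lceil>real (K * N) / \<eta>\<rceil> + 1"
  show ?thesis
  proof (intro exI[of _ n0] allI impI ballI)
    fix n \<kappa> assume n: "n0 \<le> n" and \<kappa>: "\<kappa> \<in> colourings r n"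
    have n1: "0 < n" using n by (simp add: n0_def)
    have KN: "real (K * N) \<le> \<eta> * real n"
    proof -
      have "real (K * N) / \<eta> \<le> real n" using n unfolding n0_def by linarith
      then show ?thesis using \<eta> by (simp add: field_simps)
    qed
    define m where "m l S = real (tiling_within n \<kappa> l H S)" for l S
    have game: "unit_game {..<n} (m l)" for l unfolding m_def by (rule tiling_game[OF H vH])
    define y where "y l v = shapley d {..<n} (m l) v" for l v
    have y01: "0 \<le> y l v" "y l v \<le> 1" if "v < n" for l v
      unfolding y_def using shapley_bounds[OF _ game _ d] that by auto
    \<comment> \<open>\<open>Z l v\<close> meets all patterns that raise the value of \<open>v\<close> in colour \<open>l\<close>.\<close>
    define avoids where "avoids l v Z \<longleftrightarrow> finite Z \<and> real (card Z) \<le> real h / (d ^ h * e\<^sup>2) \<and>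
      (\<forall>I O'. I \<subseteq> {..<n} \<and> O' \<subseteq> {..<n} \<and> I \<inter> O' = {} \<and> card (I \<union> O') \<le> h \<and> (I \<union> O') \<inter> Z = {} \<longrightarrow>
         pattern_shapley d {..<n} (m l) v I O' \<le> shapley d {..<n} (m l) v + e)" for l v Z
    define Z where "Z l v = (SOME Z. avoids l v Z)" for l v
    have ex: "\<exists>Z. avoids l v Z" if "v < n" for l v
      unfolding avoids_def using that by (intro bad_patterns_transversal game d e) auto
    have avoids: "avoids l v (Z l v)" if "v < n" for l v
      unfolding Z_def by (rule someI_ex[OF ex[OF that]])
    have Z: "finite (Z l v) \<and> real (card (Z l v)) \<le> real h / (d ^ h * e\<^sup>2)" if "v < n" for l v
      using avoids[OF that] by (simp add: avoids_def)
    have Zpat: "pattern_shapley d {..<n} (m l) v I O' \<le> shapley d {..<n} (m l) v + e"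
      if "v < n" "I \<subseteq> {..<n}" "O' \<subseteq> {..<n}" "I \<inter> O' = {}" "card (I \<union> O') \<le> h" "(I \<union> O') \<inter> Z l v = {}"
      for l v I O'
      using avoids[OF that(1), of l] that(2-) by (simp add: avoids_def)
    define Z' where "Z' v = (\<Union>l\<in>{1..r}. Z l v)" for v
    have Z': "finite (Z' v) \<and> card (Z' v) \<le> r * B0" if v: "v < n" for v
    proof
      show "finite (Z' v)" using Z[OF v] by (simp add: Z'_def)
      have "card (Z l v) \<le> B0" for l using Z[OF v, of l] unfolding B0_def by linarith
      then have "(\<Sum>l\<in>{1..r}. card (Z l v)) \<le> r * B0"
        using sum_bounded_above[of "{1..r}" "\<lambda>l. card (Z l v)" B0] by simp
      then show "card (Z' v) \<le> r * B0"
        unfolding Z'_def using card_UN_le[of "{1..r}" "\<lambda>l. Z l v"] by simp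
    qed
    define g where "g l v = nat \<lceil>y l v * real G\<rceil>" for l v
    have g: "y l v \<le> real (g l v) / real G" "real (g l v) / real G \<le> y l v + 1 / real G" "g l v \<le> G"
      if "v < n" for l v
    proof -
      have "y l v * real G \<le> real (g l v)" unfolding g_def by linarith
      then show "y l v \<le> real (g l v) / real G" using G by (simp add: field_simps)
      have yG: "0 \<le> y l v * real G" using y01 that by simp
      then have "real (g l v) \<le> y l v * real G + 1" unfolding g_def by linarith
      then show "real (g l v) / real G \<le> y l v + 1 / real G" using G by (simp add: field_simps)
      have "y l v * real G \<le> 1 * real G" using y01 that by (intro mult_right_mono) auto
      then show "g l v \<le> G" unfolding g_def by linarith
    qed
    define cls where "cls v = (\<lambda>l\<in>{1..r}. g l v)" for v
    have clsT: "cls v \<in> T" if "v < n" for v using g(3)[OF that] by (auto simp: cls_def T_def)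
    define V where "V i = {v\<in>{..<n}. cls v = \<tau> i}" for i
    have Vg: "g l v = \<tau> i l" if "v \<in> V i" "l \<in> {1..r}" for v i l
      using that by (auto simp: V_def cls_def fun_eq_iff split: if_splits)
    have Vn: "V i \<subseteq> {..<n}" "finite (V i)" for i by (auto simp: V_def)
    have Vdisj: "V i \<inter> V j = {}" if "i < K" "j < K" "i \<noteq> j" for i j
      using \<tau> that by (auto simp: V_def bij_betw_def inj_on_def)
    have Vall: "(\<Union>i<K. V i) = {..<n}"
      using clsT \<tau> by (auto simp: V_def bij_betw_def image_iff)
    \<comment> \<open>The small classes together have at most \<open>K * N\<close> vertices and are neglected.\<close>
    define J where "J = {i\<in>{..<K}. N \<le> card (V i)}"
    have J: "J \<subseteq> {..<K}" "finite J" by (auto simp: J_def)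
    obtain U lam where U: "\<forall>i\<in>J. U i \<subseteq> V i \<and> finite (U i) \<and> h \<le> card (U i)"
      and lam: "\<forall>i\<in>J. \<forall>j\<in>J. lam i j \<in> {1..r} \<and> lam j i = lam i j \<and>
           (\<forall>u\<in>U i. \<forall>v\<in>U j. u \<noteq> v \<longrightarrow> u \<notin> Z' v \<and> \<kappa> {u, v} = lam i j)"
    proof -
      have "\<forall>v<n. finite (Z' v) \<and> card (Z' v) \<le> r * B0" using Z' by blast
      moreover have "\<forall>i\<in>J. V i \<subseteq> {..<n} \<and> N \<le> card (V i)" using Vn by (simp add: J_def)
      ultimately show ?thesis using N[rule_format, of \<kappa> n Z' J V] \<kappa> J(1) that by auto
    qed
    have lam1: "lam i j \<in> {1..r} \<and> lam j i = lam i j" if "i \<in> J" "j \<in> J" for i j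
      using lam that by simp
    have lam2: "u \<notin> Z' v \<and> \<kappa> {u, v} = lam i j"
      if "i \<in> J" "j \<in> J" "u \<in> U i" "v \<in> U j" "u \<noteq> v" for i j u v
      using lam that by simp
    \<comment> \<open>The common rounded value in class \<open>i\<close>, scaled to make up for the loss \<open>\<eta>\<close>.\<close>
    define w where "w l i = real (\<tau> i l) / real G / (1 - \<eta>)" for l i
    have w: "template_cover r H J lam w"
      unfolding template_cover_def
    proof (intro ballI conjI impI)
      show "0 \<le> w l i" for l i using \<eta> by (simp add: w_def)
      fix l f assume l: "l \<in> {1..r}" and f: "f \<in> verts H \<rightarrow> J"
        and hom: "\<forall>u v. {u, v} \<in> edges H \<longrightarrow> lam (f u) (f v) = l"
      have fJ: "f v \<in> J" if "v \<in> verts H" for v using f that by auto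
      obtain \<phi> where \<phi>: "inj_on \<phi> (verts H)" "\<And>v. v \<in> verts H \<Longrightarrow> \<phi> v \<in> U (f v)"
        "image_graph \<phi> H \<in> mono_copies n \<kappa> l H"
      proof (rule embed_template_map[OF H f, of lam l U n \<kappa>])
        show "U i \<subseteq> {..<n} \<and> finite (U i) \<and> card (verts H) \<le> card (U i)" if "i \<in> J" for i
          using U Vn that unfolding h_def by (meson order_trans)
        show "U i \<inter> U j = {}" if "i \<in> J" "j \<in> J" "i \<noteq> j" for i j
          using U Vdisj[of i j] J that by (meson disjoint_iff lessThan_iff subsetD)
      qed (use hom lam2 in auto)
      define X where "X = \<phi> ` verts H"
      have \<phi>V: "\<phi> v \<in> V (f v)" "\<phi> v < n" if "v \<in> verts H" for v
        using \<phi>(2)[OF that] U fJ[OF that] Vn(1)[of "f v"] by auto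
      have X: "X \<subseteq> {..<n}" using \<phi>V by (auto simp: X_def)
      have cardX: "card X = h" using \<phi>(1) by (simp add: X_def h_def card_image)
      have "1 - 2 * d \<le> (\<Sum>v\<in>X. shapley d {..<n} (m l) v + e)"
      proof (rule shapley_cover[OF _ game d X])
        fix S
        show "m l (S - X) + 1 \<le> m l (S \<union> X)"
          using tiling_within_add_copy[OF H vH \<phi>(3), of S]
          by (simp add: m_def X_def image_graph_def)
      next
        fix v I O' assume v: "v \<in> X" and IO: "I \<union> O' = X - {v}" "I \<inter> O' = {}"
        have "card (I \<union> O') \<le> h"
          unfolding IO(1) using cardX X by (metis card_Diff1_le)
        moreover have "u \<notin> Z l v" if u: "u \<in> X" "u \<noteq> v" for u
        proof -
          obtain a b where ab: "a \<in> verts H" "b \<in> verts H" "u = \<phi> a" "v = \<phi> b"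
            using u v by (auto simp: X_def)
          then have "u \<notin> Z' v" using lam2[OF fJ fJ \<phi>(2) \<phi>(2)] u by blast
          then show ?thesis using l by (auto simp: Z'_def)
        qed
        then have "(I \<union> O') \<inter> Z l v = {}" unfolding IO(1) by blast
        ultimately show "pattern_shapley d {..<n} (m l) v I O' \<le> shapley d {..<n} (m l) v + e"
          using IO X v by (intro Zpat) auto
      qed simp
      also have "\<dots> = (\<Sum>v\<in>verts H. y l (\<phi> v)) + real h * e"
        using \<phi>(1) cardX by (simp add: sum.distrib y_def) (simp add: X_def sum.reindex)
      also have "(\<Sum>v\<in>verts H. y l (\<phi> v)) \<le> (\<Sum>v\<in>verts H. real (\<tau> (f v) l) / real G)"
        using g(1) \<phi>V Vg[OF _ l] by (intro sum_mono) metis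
      finally have "1 - \<eta> \<le> (\<Sum>v\<in>verts H. real (\<tau> (f v) l) / real G)" using e(2) by linarith
      moreover have "0 < 1 - \<eta>" using \<eta> by simp
      ultimately have "1 \<le> (\<Sum>v\<in>verts H. real (\<tau> (f v) l) / real G) / (1 - \<eta>)"
        by (simp only: pos_le_divide_eq mult_1)
      then show "1 \<le> (\<Sum>v\<in>verts H. w l (f v))"
        unfolding w_def by (simp only: sum_divide_distrib)
    qed
    define nJ where "nJ = (\<Sum>i\<in>J. real (card (V i)))"
    have nJ: "(1 - \<eta>) * real n \<le> nJ"
    proof -
      have "real n = real (card (\<Union>i<K. V i))" by (simp add: Vall)
      also have "\<dots> = (\<Sum>i<K. real (card (V i)))"
        using Vn Vdisj by (subst card_UN_disjoint) auto
      also have "\<dots> = nJ + (\<Sum>i\<in>{..<K} - J. real (card (V i)))"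
        unfolding nJ_def using J by (subst sum.subset_diff[of J]) auto
      also have "(\<Sum>i\<in>{..<K} - J. real (card (V i))) \<le> (\<Sum>i\<in>{..<K} - J. real N)"
        by (intro sum_mono) (auto simp: J_def)
      also have "\<dots> \<le> (\<Sum>i<K. real N)" by (intro sum_mono2) auto
      also have "\<dots> \<le> \<eta> * real n" using KN by simp
      finally show ?thesis by (simp add: algebra_simps)
    qed
    have "0 < (1 - \<eta>) * real n" using n1 \<eta> by simp
    then have nJ0: "0 < nJ" using nJ by linarith
    define x where "x i = real (card (V i)) / nJ" for i
    define t where "t = real (tiling_number r n H \<kappa>) / real n"
    have tn: "t * real n = real (tiling_number r n H \<kappa>)" using n1 by (simp add: t_def)
    have "cover_bound r H (t + \<epsilon>)"
    proof (rule cover_bound_many_strips[OF r J(2) _ _ lam1 w])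
      show "0 \<le> x i" for i using nJ0 by (simp add: x_def)
      show "(\<Sum>i\<in>J. x i) = 1" using nJ0 by (simp add: x_def nJ_def sum_divide_distrib[symmetric])
      fix l assume l: "l \<in> {1..r}"
      have "(\<Sum>i\<in>J. real (card (V i)) * (real (\<tau> i l) / real G)) = (\<Sum>i\<in>J. \<Sum>v\<in>V i. real (g l v) / real G)"
        using Vg[OF _ l] by (intro sum.cong) auto
      also have "\<dots> \<le> (\<Sum>i<K. \<Sum>v\<in>V i. real (g l v) / real G)"
        using J by (intro sum_mono2 sum_nonneg) auto
      also have "\<dots> = (\<Sum>v<n. real (g l v) / real G)"
        unfolding Vall[symmetric] using Vn Vdisj by (subst sum.UNION_disjoint) auto
      also have "\<dots> \<le> (\<Sum>v<n. y l v + 1 / real G)" using g(2) by (intro sum_mono) auto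
      also have "\<dots> = (\<Sum>v<n. y l v) + real n * (1 / real G)" by (simp add: sum.distrib)
      also have "\<dots> \<le> real (tiling_number r n H \<kappa>) + real n * \<eta>"
      proof (intro add_mono mult_left_mono)
        have "(\<Sum>v<n. y l v) \<le> real (mono_tiling_number n \<kappa> l H)"
          using shapley_sum_le[OF _ game[of l] d] by (simp add: y_def m_def mono_tiling_number_eq)
        then show "(\<Sum>v<n. y l v) \<le> real (tiling_number r n H \<kappa>)"
          using mono_tiling_number_le_tiling_number[OF l, of n \<kappa> H] by linarith
      qed (use G in auto)
      finally have up: "(\<Sum>i\<in>J. real (card (V i)) * (real (\<tau> i l) / real G)) \<le> (t + \<eta>) * real n"
        unfolding distrib_right tn by (simp add: mult.commute)
      have t01: "0 \<le> t" "t \<le> 1"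
      proof -
        have "tiling_number r n H \<kappa> \<le> n"
          unfolding tiling_number_def using r mono_tiling_number_le[OF H vH] by (subst Max_le_iff) auto
        then show "0 \<le> t" "t \<le> 1" using n1 by (auto simp: t_def)
      qed
      have "(\<Sum>i\<in>J. x i * w l i) = (\<Sum>i\<in>J. real (card (V i)) * (real (\<tau> i l) / real G)) / (nJ * (1 - \<eta>))"
        unfolding sum_divide_distrib by (intro sum.cong) (auto simp: x_def w_def)
      also have "\<dots> \<le> (t + \<eta>) * real n / (nJ * (1 - \<eta>))"
        using up nJ0 \<eta> by (intro divide_right_mono) auto
      also have "\<dots> \<le> t + \<epsilon>"
      proof -
        have "t * \<eta> \<le> 1 * \<eta>" using t01(2) \<eta>(1) by (intro mult_right_mono) linarith+
        moreover have "\<eta> * \<eta> \<le> 1/4 * \<eta>" using \<eta>(1,2) by (intro mult_right_mono) linarith+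
        moreover have "(t + 6 * \<eta>) * (1 - 2 * \<eta>) = t + 6 * \<eta> - 2 * (t * \<eta>) - 12 * (\<eta> * \<eta>)"
          by (simp add: algebra_simps)
        ultimately have "t + \<eta> \<le> (t + 6 * \<eta>) * (1 - 2 * \<eta>)" by linarith
        also have "\<dots> \<le> (t + \<epsilon>) * (1 - 2 * \<eta>)" using \<eta> by (intro mult_right_mono) auto
        also have "\<dots> \<le> (t + \<epsilon>) * ((1 - \<eta>) * (1 - \<eta>))"
          using t01 eps by (intro mult_left_mono) (auto simp: algebra_simps)
        finally have "(t + \<eta>) * real n \<le> (t + \<epsilon>) * ((1 - \<eta>) * (1 - \<eta>)) * real n"
          by (rule mult_right_mono) simp
        also have "\<dots> = (t + \<epsilon>) * (((1 - \<eta>) * real n) * (1 - \<eta>))" by (simp only: mult_ac)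
        also have "\<dots> \<le> (t + \<epsilon>) * (nJ * (1 - \<eta>))"
          using nJ t01 eps \<eta> by (intro mult_left_mono mult_right_mono) auto
        finally show ?thesis using nJ0 \<eta> by (simp add: pos_divide_le_eq)
      qed
      finally show "(\<Sum>i\<in>J. x i * w l i) \<le> t + \<epsilon>" .
    qed
    then show "cover_bound r H (real (tiling_number r n H \<kappa>) / real n + \<epsilon>)" by (simp add: t_def)
  qed
qed


section \<open>Weak duality\<close>

lemma fibre_sum:
  fixes y :: "nat \<Rightarrow> real"
  assumes "finite_graph H" "f \<in> template_maps H q lam l"
  shows "(\<Sum>i\<in>{1..q}. real (fibre_size H f i) * y i) = (\<Sum>v\<in>verts H. y (f v))"
proof -
  have fin: "finite (verts H)" using assms(1) by (simp add: finite_graph_def)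
  have f: "f ` verts H \<subseteq> {1..q}" using assms(2) by (auto simp: template_maps_def)
  have "(\<Sum>v\<in>verts H. y (f v)) = (\<Sum>i\<in>{1..q}. \<Sum>v\<in>{v\<in>verts H. f v = i}. y (f v))"
    using f fin by (subst sum.group) auto
  also have "\<dots> = (\<Sum>i\<in>{1..q}. real (fibre_size H f i) * y i)"
    by (intro sum.cong) (auto simp: fibre_size_def)
  finally show ?thesis by simp
qed

lemma finite_template_maps:
  assumes "finite_graph H"
  shows "finite (template_maps H q lam l)"
  by (rule finite_subset[of _ "verts H \<rightarrow>\<^sub>E {1..q}"])
     (use assms in \<open>auto simp: template_maps_def finite_graph_def intro: finite_PiE\<close>)

definition packings :: "'a graph \<Rightarrow> nat \<Rightarrow> (nat \<Rightarrow> nat \<Rightarrow> nat) \<Rightarrow> nat \<Rightarrow> (nat \<Rightarrow> real) \<Rightarrow> (('a \<Rightarrow> nat) \<Rightarrow> real) set" where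
  "packings H q lam l x = {w. (\<forall>f\<in>template_maps H q lam l. 0 \<le> w f) \<and>
     (\<forall>i\<in>{1..q}. (\<Sum>f\<in>template_maps H q lam l. real (fibre_size H f i) * w f) \<le> x i)}"

lemma tau_eq: "tau H q lam l x = (SUP w\<in>packings H q lam l x. \<Sum>f\<in>template_maps H q lam l. w f)"
  unfolding tau_def packings_def by (simp add: setcompr_eq_image)

lemma zero_packing: "(\<And>i. i \<in> {1..q} \<Longrightarrow> 0 \<le> x i) \<Longrightarrow> (\<lambda>_. 0) \<in> packings H q lam l x"
  by (simp add: packings_def)

lemma packing_le_cover:
  assumes H: "finite_graph H" and w: "w \<in> packings H q lam l x"
    and y: "\<And>i. i \<in> {1..q} \<Longrightarrow> 0 \<le> y i" "\<And>f. f \<in> template_maps H q lam l \<Longrightarrow> 1 \<le> (\<Sum>v\<in>verts H. y (f v))"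
  shows "(\<Sum>f\<in>template_maps H q lam l. w f) \<le> (\<Sum>i\<in>{1..q}. x i * y i)"
proof -
  let ?F = "template_maps H q lam l"
  have "(\<Sum>f\<in>?F. w f) \<le> (\<Sum>f\<in>?F. w f * (\<Sum>v\<in>verts H. y (f v)))"
  proof (rule sum_mono)
    fix f assume f: "f \<in> ?F"
    then have "w f * 1 \<le> w f * (\<Sum>v\<in>verts H. y (f v))"
      using w y(2) by (intro mult_left_mono) (auto simp: packings_def)
    then show "w f \<le> w f * (\<Sum>v\<in>verts H. y (f v))" by simp
  qed
  also have "\<dots> = (\<Sum>f\<in>?F. \<Sum>i\<in>{1..q}. y i * (real (fibre_size H f i) * w f))"
    by (intro sum.cong refl) (simp add: fibre_sum[OF H, symmetric] sum_distrib_left mult_ac)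
  also have "\<dots> = (\<Sum>i\<in>{1..q}. y i * (\<Sum>f\<in>?F. real (fibre_size H f i) * w f))"
    by (subst sum.swap) (simp add: sum_distrib_left)
  also have "\<dots> \<le> (\<Sum>i\<in>{1..q}. y i * x i)"
    using w y(1) by (intro sum_mono mult_left_mono) (auto simp: packings_def)
  finally show ?thesis by (simp add: mult.commute)
qed

lemma packing_le_tau:
  assumes H: "finite_graph H" "verts H \<noteq> {}" and w: "w \<in> packings H q lam l x"
  shows "(\<Sum>f\<in>template_maps H q lam l. w f) \<le> tau H q lam l x"
proof -
  have "card (verts H) \<ge> 1" using H by (simp add: finite_graph_def Suc_le_eq card_gt_0_iff)
  then have "(\<Sum>f\<in>template_maps H q lam l. w' f) \<le> (\<Sum>i\<in>{1..q}. x i * 1)"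
    if "w' \<in> packings H q lam l x" for w'
    using that by (intro packing_le_cover[OF H(1)]) auto
  then have "bdd_above ((\<lambda>w. \<Sum>f\<in>template_maps H q lam l. w f) ` packings H q lam l x)"
    by (intro bdd_aboveI2)
  then show ?thesis unfolding tau_eq using w by (rule cSUP_upper2) simp
qed

lemma tau_le_cover:
  assumes H: "finite_graph H" and x: "\<And>i. i \<in> {1..q} \<Longrightarrow> 0 \<le> x i"
    and y: "template_cover r H {1..q} lam y" and l: "l \<in> {1..r}"
  shows "tau H q lam l x \<le> (\<Sum>i\<in>{1..q}. x i * y l i)"
  unfolding tau_eq
proof (rule cSUP_least)
  show "packings H q lam l x \<noteq> {}" using zero_packing[where x = x, OF x] by blast
  fix w assume w: "w \<in> packings H q lam l x"
  show "(\<Sum>f\<in>template_maps H q lam l. w f) \<le> (\<Sum>i\<in>{1..q}. x i * y l i)"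
    by (rule packing_le_cover[OF H w]) (use y l in \<open>auto simp: template_cover_def template_maps_def PiE_def\<close>)
qed

definition template_values :: "nat \<Rightarrow> 'a graph \<Rightarrow> real set" where
  "template_values r H = {Max ((\<lambda>l. tau H q lam l x) ` {1..r}) | q lam x.
            1 \<le> q \<and> q \<le> r \<and> strip_template r q lam \<and> x \<in> weight_simplex q}"

lemma beta_eq: "beta r H = Inf (template_values r H)"
  by (simp add: beta_def template_values_def)

text \<open>In every template some strip has weight at least \<open>1 / r\<close>, and the constant maps into it
  already pack a \<open>1 / card (verts H)\<close> fraction of it.\<close>

lemma template_value_lower:
  assumes r: "1 \<le> r" and H: "finite_graph H" "verts H \<noteq> {}" and b: "b \<in> template_values r H"
  shows "1 / (real r * real (card (verts H))) \<le> b"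
proof -
  let ?h = "card (verts H)"
  obtain q lam x where q: "1 \<le> q" "q \<le> r" "strip_template r q lam" "x \<in> weight_simplex q"
    and b_eq: "b = Max ((\<lambda>l. tau H q lam l x) ` {1..r})"
    using b by (auto simp: template_values_def)
  have h: "0 < ?h" using H by (simp add: finite_graph_def card_gt_0_iff)
  have x: "\<And>i. i \<in> {1..q} \<Longrightarrow> 0 \<le> x i" "(\<Sum>i\<in>{1..q}. x i) = 1" using q(4) by (auto simp: weight_simplex_def)
  have "\<exists>i\<in>{1..q}. 1 / real q \<le> x i"
  proof (rule ccontr)
    assume "\<not> ?thesis"
    then have "(\<Sum>i\<in>{1..q}. x i) < (\<Sum>i\<in>{1..q}. 1 / real q)" using q(1) by (intro sum_strict_mono) (auto simp: not_le)
    then show False using x(2) q(1) by simp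
  qed
  then obtain i where i: "i \<in> {1..q}" "1 / real q \<le> x i" by blast
  define l where "l = lam i i"
  define f where "f = (\<lambda>v\<in>verts H. i)"
  have l: "l \<in> {1..r}" using q(3) i(1) by (auto simp: strip_template_def l_def)
  have f: "f \<in> template_maps H q lam l"
  proof -
    show ?thesis using edge_verts[OF H(1)] i(1) by (auto simp: template_maps_def f_def l_def)
  qed
  have fib: "fibre_size H f j = (if j = i then ?h else 0)" for j
  proof -
    have "{v \<in> verts H. f v = j} = (if j = i then verts H else {})" by (auto simp: f_def)
    then show ?thesis by (simp add: fibre_size_def)
  qed
  define w where "w f' = (if f' = f then x i / real ?h else 0)" for f'
  have sum_w: "(\<Sum>f'\<in>template_maps H q lam l. c f' * w f') = c f * (x i / real ?h)" for c :: "('a \<Rightarrow> nat) \<Rightarrow> real"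
    using f finite_template_maps[OF H(1)] by (simp add: w_def if_distrib[of "\<lambda>x. _ * x"] cong: if_cong)
  have "w \<in> packings H q lam l x"
    unfolding packings_def using sum_w fib x i h by (auto simp: w_def[of f'] w_def)
  then have "x i / real ?h \<le> tau H q lam l x"
    using packing_le_tau[OF H, of w q lam l x] sum_w[of "\<lambda>_. 1"] by simp
  also have "\<dots> \<le> b" unfolding b_eq using l by (intro Max_ge) auto
  finally have "x i / real ?h \<le> b" .
  moreover have "1 / real r \<le> x i" using i(2) q(1,2) by (intro order_trans[OF _ i(2)]) (simp add: frac_le)
  then have "1 / real r / real ?h \<le> x i / real ?h" by (intro divide_right_mono) auto
  ultimately show ?thesis by simp
qed

lemma template_values_nonempty:
  assumes "1 \<le> r"
  shows "template_values r H \<noteq> {}"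
proof -
  have "strip_template r 1 (\<lambda>_ _. 1)" "(\<lambda>_. 1) \<in> weight_simplex 1"
    using assms by (auto simp: strip_template_def weight_simplex_def)
  then show ?thesis using assms unfolding template_values_def by blast
qed

lemma beta_pos:
  assumes r: "1 \<le> r" and H: "finite_graph H" "verts H \<noteq> {}"
  shows "0 < beta r H"
proof -
  have "1 / (real r * real (card (verts H))) \<le> beta r H"
    unfolding beta_eq by (intro cInf_greatest template_values_nonempty template_value_lower assms)
  moreover have "0 < real r * real (card (verts H))"
    using assms by (simp add: finite_graph_def card_gt_0_iff)
  ultimately show ?thesis by (meson less_le_trans zero_less_divide_1_iff)
qed

lemma template_values_bdd:
  "1 \<le> r \<Longrightarrow> finite_graph H \<Longrightarrow> verts H \<noteq> {} \<Longrightarrow> bdd_below (template_values r H)"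
  using template_value_lower by (intro bdd_belowI)

lemma beta_le_cover_bound:
  assumes r: "1 \<le> r" and H: "finite_graph H" "verts H \<noteq> {}" and b: "cover_bound r H b"
  shows "beta r H \<le> b"
proof -
  obtain q lam x y where q: "1 \<le> q" "q \<le> r" "strip_template r q lam" "x \<in> weight_simplex q"
    "template_cover r H {1..q} lam y" and le: "\<And>l. l \<in> {1..r} \<Longrightarrow> (\<Sum>i\<in>{1..q}. x i * y l i) \<le> b"
    using b unfolding cover_bound_def by blast
  have "Max ((\<lambda>l. tau H q lam l x) ` {1..r}) \<in> template_values r H"
    unfolding template_values_def using q by blast
  then have "beta r H \<le> Max ((\<lambda>l. tau H q lam l x) ` {1..r})"
    unfolding beta_eq by (rule cInf_lower[OF _ template_values_bdd[OF r H]])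
  also have "\<dots> \<le> b"
  proof (subst Max_le_iff)
    show "\<forall>a\<in>(\<lambda>l. tau H q lam l x) ` {1..r}. a \<le> b"
    proof (clarify)
      fix l assume l: "l \<in> {1..r}"
      have "tau H q lam l x \<le> (\<Sum>i\<in>{1..q}. x i * y l i)"
        using q(4) by (intro tau_le_cover[OF H(1) _ q(5) l]) (auto simp: weight_simplex_def)
      then show "tau H q lam l x \<le> b" using le[OF l] by linarith
    qed
  qed (use r in auto)
  finally show ?thesis .
qed


section \<open>Strip colourings\<close>

lemma split_into_strips:
  fixes a :: "nat \<Rightarrow> nat"
  shows "(\<Sum>i\<in>{1..q}. a i) \<le> n \<Longrightarrow>
    \<exists>s. (\<forall>v<n. s v \<le> q) \<and> (\<forall>i\<in>{1..q}. card {v\<in>{..<n}. s v = i} = a i) \<and>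
      card {v\<in>{..<n}. s v = (0::nat)} = n - (\<Sum>i\<in>{1..q}. a i)"
proof (induction q)
  case 0
  show ?case by (intro exI[of _ "\<lambda>_. 0"]) simp
next
  case (Suc q)
  then obtain s where s: "\<forall>v<n. s v \<le> q" "\<forall>i\<in>{1..q}. card {v\<in>{..<n}. s v = i} = a i"
    "card {v\<in>{..<n}. s v = 0} = n - (\<Sum>i\<in>{1..q}. a i)" by auto
  have "a (Suc q) \<le> card {v\<in>{..<n}. s v = 0}" using s(3) Suc.prems by simp
  then obtain A where A: "A \<subseteq> {v\<in>{..<n}. s v = 0}" "card A = a (Suc q)" "finite A"
    by (rule obtain_subset_with_card_n) auto
  define s' where "s' v = (if v \<in> A then Suc q else s v)" for v
  have "{v\<in>{..<n}. s' v = Suc q} = A" using A(1) s(1) by (auto simp: s'_def)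
  moreover have "{v\<in>{..<n}. s' v = 0} = {v\<in>{..<n}. s v = 0} - A" using A(1) by (auto simp: s'_def)
  then have "card {v\<in>{..<n}. s' v = 0} = n - (\<Sum>i\<in>{1..Suc q}. a i)"
    using A s(3) by (simp add: card_Diff_subset)
  moreover have "\<forall>v<n. s' v \<le> Suc q" using s(1) by (auto simp: s'_def le_Suc_eq)
  ultimately show ?case
  proof (intro exI[of _ s'] conjI ballI)
    fix i assume "i \<in> {1..Suc q}"
    then consider "i \<in> {1..q}" | "i = Suc q" by fastforce
    then show "card {v\<in>{..<n}. s' v = i} = a i"
    proof cases
      case 1
      then have "{v\<in>{..<n}. s' v = i} = {v\<in>{..<n}. s v = i}" using A(1) by (auto simp: s'_def)
      then show ?thesis using s(2) 1 by simp
    next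
      case 2
      then show ?thesis using A \<open>{v\<in>{..<n}. s' v = Suc q} = A\<close> by simp
    qed
  qed
qed

lemma finite_colourings: "finite (colourings r n)"
proof -
  have "finite (complete_edges n)"
    by (rule finite_subset[of _ "Pow {..<n}"]) (auto simp: complete_edges_def)
  then show ?thesis unfolding colourings_def by (intro finite_PiE) auto
qed

lemma Rt_le: "\<kappa> \<in> colourings r n \<Longrightarrow> Rt r H n \<le> tiling_number r n H \<kappa>"
  unfolding Rt_def by (intro Min_le) (auto simp: finite_colourings)

lemma Rt_attained:
  assumes "1 \<le> r"
  obtains \<kappa> where "\<kappa> \<in> colourings r n" "tiling_number r n H \<kappa> = Rt r H n"
proof -
  have "(\<lambda>e\<in>complete_edges n. 1) \<in> colourings r n" using assms by (auto simp: colourings_def)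
  then have "Rt r H n \<in> tiling_number r n H ` colourings r n"
    unfolding Rt_def using finite_colourings by (intro Min_in) auto
  then show ?thesis using that by auto
qed

text \<open>Counting the copies of a tiling by the strips of their vertices gives a packing. The at most
  \<open>q\<close> vertices that are lost by rounding meet at most \<open>q\<close> copies.\<close>

lemma Rt_le_template_value:
  assumes r: "1 \<le> r" and H: "finite_graph H" "verts H \<noteq> {}" and q: "1 \<le> q" "q \<le> r"
    and lam: "strip_template r q lam" and x: "x \<in> weight_simplex q" and n: "0 < n"
    and t: "\<And>l. l \<in> {1..r} \<Longrightarrow> tau H q lam l x \<le> t"
  shows "real (Rt r H n) \<le> t * real n + real r"
proof -
  have x0: "\<And>i. i \<in> {1..q} \<Longrightarrow> 0 \<le> x i" and x1: "(\<Sum>i\<in>{1..q}. x i) = 1"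
    using x by (auto simp: weight_simplex_def)
  define a where "a i = nat \<lfloor>x i * real n\<rfloor>" for i
  have a: "real (a i) \<le> x i * real n" "x i * real n \<le> real (a i) + 1" if "i \<in> {1..q}" for i
  proof -
    have "0 \<le> x i * real n" using x0[OF that] by simp
    then show "real (a i) \<le> x i * real n" "x i * real n \<le> real (a i) + 1"
      unfolding a_def by linarith+
  qed
  have xn: "(\<Sum>i\<in>{1..q}. x i * real n) = real n" using x1 by (simp add: sum_distrib_right[symmetric])
  have "(\<Sum>i\<in>{1..q}. real (a i)) \<le> (\<Sum>i\<in>{1..q}. x i * real n)"
    using a(1) by (intro sum_mono) auto
  then have "real (\<Sum>i\<in>{1..q}. a i) \<le> real n" unfolding xn by simp
  then have a_le: "(\<Sum>i\<in>{1..q}. a i) \<le> n" by linarith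
  have "(\<Sum>i\<in>{1..q}. x i * real n) \<le> (\<Sum>i\<in>{1..q}. real (a i) + 1)"
    using a(2) by (intro sum_mono) auto
  then have "real n \<le> real (\<Sum>i\<in>{1..q}. a i) + real q" unfolding xn by (simp add: sum.distrib)
  then have a_ge': "n \<le> (\<Sum>i\<in>{1..q}. a i) + q" by linarith
  obtain s where s: "\<forall>v<n. s v \<le> q" "\<forall>i\<in>{1..q}. card {v\<in>{..<n}. s v = i} = a i"
    "card {v\<in>{..<n}. s v = 0} = n - (\<Sum>i\<in>{1..q}. a i)"
    using split_into_strips[OF a_le] by blast
  define W where "W = {v\<in>{..<n}. s v = 0}"
  have W: "finite W" "card W \<le> r" using s(3) a_ge' q(2) by (auto simp: W_def)
  \<comment> \<open>The vertices lost by rounding, for which \<open>s\<close> is 0, are added to the first strip.\<close>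
  define s' where "s' v = (if s v = 0 then 1 else s v)" for v
  have s'q: "s' v \<in> {1..q}" if "v < n" for v using s(1) that q(1) by (auto simp: s'_def)
  define \<kappa> where "\<kappa> = (\<lambda>e\<in>complete_edges n. lam (s' (Min e)) (s' (Max e)))"
  have pair: "\<kappa> {u, v} = lam (s' u) (s' v)" if "u < n" "v < n" "u \<noteq> v" for u v
  proof -
    have "{u, v} \<in> complete_edges n" using that by (auto simp: complete_edges_def)
    then have "\<kappa> {u, v} = lam (s' (min u v)) (s' (max u v))" by (simp add: \<kappa>_def)
    also have "\<dots> = lam (s' u) (s' v)"
      using lam s'q[OF that(1)] s'q[OF that(2)] unfolding strip_template_def min_def max_def by auto
    finally show ?thesis .
  qed
  have "\<kappa> \<in> colourings r n"
    unfolding colourings_def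
  proof (rule PiE_I)
    fix e assume e: "e \<in> complete_edges n"
    then obtain u v where uv: "e = {u, v}" "u \<noteq> v" "u < n" "v < n"
      by (auto simp: complete_edges_def card_2_iff)
    then show "\<kappa> e \<in> {1..r}" using pair[of u v] lam s'q by (auto simp: strip_template_def)
  qed (simp add: \<kappa>_def)
  then have "Rt r H n \<le> tiling_number r n H \<kappa>" by (rule Rt_le)
  moreover have "real (mono_tiling_number n \<kappa> l H) \<le> t * real n + real r" if l: "l \<in> {1..r}" for l
  proof -
    let ?F = "template_maps H q lam l"
    obtain C where C: "C \<in> tilings n \<kappa> l H {..<n}" "card C = mono_tiling_number n \<kappa> l H"
      using tiling_within_attained[OF H(1)] mono_tiling_number_eq by metis
    have finC: "finite C" by (rule finite_tiling[OF H(1) C(1)])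
    have Ccopies: "C \<subseteq> mono_copies n \<kappa> l H" using C(1) by (simp add: tilings_def)
    have Cdis: "verts K \<inter> verts K' = {}" if "K \<in> C" "K' \<in> C" "K \<noteq> K'" for K K'
      using C(1) that by (simp add: tilings_def pairwise_def disjnt_def)
    define C1 where "C1 = {K\<in>C. verts K \<inter> W \<noteq> {}}"
    define C0 where "C0 = C - C1"
    have "card C1 \<le> card W"
    proof -
      have "\<forall>K\<in>C1. \<exists>v. v \<in> verts K \<inter> W" by (auto simp: C1_def)
      then obtain p where p: "\<And>K. K \<in> C1 \<Longrightarrow> p K \<in> verts K \<inter> W" by metis
      have "inj_on p C1"
      proof (rule inj_onI)
        fix K K' assume KK: "K \<in> C1" "K' \<in> C1" "p K = p K'"
        then have "p K \<in> verts K \<inter> verts K'" using p[of K] p[of K'] by auto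
        then show "K = K'" using Cdis[of K K'] KK by (auto simp: C1_def)
      qed
      moreover have "p ` C1 \<subseteq> W" using p by auto
      ultimately show ?thesis using W(1) card_inj_on_le by blast
    qed
    then have cardC: "card C \<le> card C0 + r"
      using W(2) finC by (simp add: C0_def C1_def card_Diff_subset)
    \<comment> \<open>The strip type of a copy is that of some fixed isomorphism from \<open>H\<close>.\<close>
    have "\<forall>K\<in>C. \<exists>g. K = image_graph g H \<and> inj_on g (verts H) \<and> g ` verts H \<subseteq> {..<n} \<and>
        (\<forall>e\<in>edges H. \<kappa> (g ` e) = l)"
      using Ccopies unfolding mono_copies_def by blast
    then obtain g where g: "\<And>K. K \<in> C \<Longrightarrow> K = image_graph (g K) H \<and> inj_on (g K) (verts H) \<and>
        g K ` verts H \<subseteq> {..<n} \<and> (\<forall>e\<in>edges H. \<kappa> (g K ` e) = l)" by metis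
    define ty where "ty K = (\<lambda>v\<in>verts H. s (g K v))" for K
    have vK: "verts K = g K ` verts H" if "K \<in> C" for K
      using g[OF that] by (metis fst_conv image_graph_def)
    have ty: "ty K \<in> ?F" if K: "K \<in> C0" for K
    proof -
      have KC: "K \<in> C" "verts K \<inter> W = {}" using K by (auto simp: C0_def C1_def)
      have gn: "g K v < n" if "v \<in> verts H" for v using g[OF KC(1)] that by auto
      have sg: "s (g K v) \<noteq> 0" if "v \<in> verts H" for v
        using KC vK[OF KC(1)] gn[OF that] that by (auto simp: W_def)
      have s'g: "s' (g K v) = s (g K v)" if "v \<in> verts H" for v using sg[OF that] by (simp add: s'_def)
      have "lam (ty K u) (ty K v) = l" if uv: "{u, v} \<in> edges H" for u v
      proof -
        note uvH = edge_verts[OF H(1) uv]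
        then have "g K u \<noteq> g K v" using g[OF KC(1)] by (auto dest: inj_onD)
        then have "\<kappa> {g K u, g K v} = lam (s' (g K u)) (s' (g K v))" using gn uvH by (intro pair)
        moreover have "\<kappa> (g K ` {u, v}) = l" using g[OF KC(1)] uv by blast
        ultimately show ?thesis using uvH s'g by (simp add: ty_def)
      qed
      moreover have "ty K \<in> verts H \<rightarrow>\<^sub>E {1..q}"
        using gn sg s(1) by (auto simp: ty_def Suc_le_eq)
      ultimately show ?thesis by (simp add: template_maps_def)
    qed
    have fin0: "finite C0" using finC by (simp add: C0_def)
    define w where "w f = real (card {K\<in>C0. ty K = f}) / real n" for f
    have count: "(\<Sum>f\<in>?F. c f * real (card {K\<in>C0. ty K = f})) = (\<Sum>K\<in>C0. c (ty K))" for c :: "('a \<Rightarrow> nat) \<Rightarrow> real"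
    proof -
      have "(\<Sum>K\<in>C0. c (ty K)) = (\<Sum>f\<in>?F. \<Sum>K\<in>{K\<in>C0. ty K = f}. c (ty K))"
        using ty fin0 finite_template_maps[OF H(1)] by (subst sum.group) auto
      also have "\<dots> = (\<Sum>f\<in>?F. c f * real (card {K\<in>C0. ty K = f}))"
        by (intro sum.cong) auto
      finally show ?thesis by simp
    qed
    have "w \<in> packings H q lam l x"
      unfolding packings_def
    proof (intro CollectI conjI ballI)
      fix i assume i: "i \<in> {1..q}"
      have fs: "fibre_size H (ty K) i = card {v\<in>verts K. s v = i}" if K: "K \<in> C0" for K
      proof -
        have KC: "K \<in> C" using K by (simp add: C0_def)
        have "{v\<in>verts K. s v = i} = g K ` {v\<in>verts H. ty K v = i}"
          by (auto simp: vK[OF KC] ty_def)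
        moreover have "inj_on (g K) {v\<in>verts H. ty K v = i}"
          using g[OF KC] by (auto intro: inj_on_subset)
        ultimately show ?thesis by (simp add: fibre_size_def card_image)
      qed
      have fv: "finite (verts K)" if "K \<in> C0" for K
        using that mono_copy_verts Ccopies finite_subset by (metis C0_def DiffD1 finite_lessThan subsetD)
      have "(\<Sum>K\<in>C0. fibre_size H (ty K) i) = (\<Sum>K\<in>C0. card {v\<in>verts K. s v = i})" using fs by simp
      also have "\<dots> = card (\<Union>K\<in>C0. {v\<in>verts K. s v = i})"
      proof (rule card_UN_disjoint[symmetric])
        show "\<forall>K\<in>C0. \<forall>K'\<in>C0. K \<noteq> K' \<longrightarrow> {v\<in>verts K. s v = i} \<inter> {v\<in>verts K'. s v = i} = {}"
        proof (intro ballI impI)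
          fix K K' assume "K \<in> C0" "K' \<in> C0" "K \<noteq> K'"
          then have "verts K \<inter> verts K' = {}" by (intro Cdis) (simp_all add: C0_def)
          then show "{v\<in>verts K. s v = i} \<inter> {v\<in>verts K'. s v = i} = {}" by blast
        qed
      qed (use fin0 fv in auto)
      also have "\<dots> \<le> card {v\<in>{..<n}. s v = i}"
        using Ccopies mono_copy_verts by (intro card_mono) (fastforce simp: C0_def)+
      also have "\<dots> = a i" using s(2) i by blast
      finally have "real (\<Sum>K\<in>C0. fibre_size H (ty K) i) \<le> x i * real n" using a(1)[OF i] by linarith
      moreover have "(\<Sum>f\<in>?F. real (fibre_size H f i) * w f) = real (\<Sum>K\<in>C0. fibre_size H (ty K) i) / real n"
        using count[of "\<lambda>f. real (fibre_size H f i)"] by (simp add: w_def sum_divide_distrib[symmetric])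
      ultimately show "(\<Sum>f\<in>?F. real (fibre_size H f i) * w f) \<le> x i"
        using n by (simp add: pos_divide_le_eq)
    qed (simp add: w_def)
    then have "(\<Sum>f\<in>?F. w f) \<le> t" using packing_le_tau[OF H] t[OF l] by (meson order_trans)
    moreover have "(\<Sum>f\<in>?F. w f) = real (card C0) / real n"
      using count[of "\<lambda>_. 1"] by (simp add: w_def sum_divide_distrib[symmetric])
    ultimately have "real (card C0) \<le> t * real n" using n by (simp add: pos_divide_le_eq)
    then show ?thesis using cardC C(2) by linarith
  qed
  then have "real (tiling_number r n H \<kappa>) \<le> t * real n + real r"
  proof -
    have "tiling_number r n H \<kappa> \<in> (\<lambda>l. mono_tiling_number n \<kappa> l H) ` {1..r}"
      unfolding tiling_number_def using r by (intro Max_in) auto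
    then show ?thesis using \<open>\<And>l. l \<in> {1..r} \<Longrightarrow> real (mono_tiling_number n \<kappa> l H) \<le> t * real n + real r\<close> by auto
  qed
  ultimately show ?thesis by linarith
qed


section \<open>Asymptotics of the tiling number\<close>

lemma cover_bound_mono: "cover_bound r H b \<Longrightarrow> b \<le> b' \<Longrightarrow> cover_bound r H b'"
  unfolding cover_bound_def by (meson order_trans)

lemma Rt_upper:
  assumes r: "1 \<le> r" and H: "finite_graph H" "verts H \<noteq> {}" and eps: "0 < \<epsilon>"
  shows "\<forall>\<^sub>F n in sequentially. real (Rt r H n) \<le> (beta r H + \<epsilon>) * real n"
proof -
  obtain b where b: "b \<in> template_values r H" "b < beta r H + \<epsilon> / 2"
    using cInf_lessD[OF template_values_nonempty[OF r], of H "beta r H + \<epsilon> / 2"] eps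
    by (auto simp: beta_eq)
  then obtain q lam x where q: "1 \<le> q" "q \<le> r" "strip_template r q lam" "x \<in> weight_simplex q"
    and b_eq: "b = Max ((\<lambda>l. tau H q lam l x) ` {1..r})"
    by (auto simp: template_values_def)
  have Rt: "real (Rt r H n) \<le> b * real n + real r" if "0 < n" for n
    by (rule Rt_le_template_value[OF r H q that]) (simp add: b_eq)
  have "\<forall>\<^sub>F n in sequentially. nat \<lceil>2 * real r / \<epsilon>\<rceil> + 1 \<le> n" by (rule eventually_ge_at_top)
  then show ?thesis
  proof (rule eventually_mono)
    fix n assume n: "nat \<lceil>2 * real r / \<epsilon>\<rceil> + 1 \<le> n"
    then have "2 * real r / \<epsilon> \<le> real n" by linarith
    then have "real r \<le> \<epsilon> / 2 * real n" using eps by (simp add: field_simps)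
    moreover have "b * real n \<le> (beta r H + \<epsilon> / 2) * real n" using b by (intro mult_right_mono) auto
    ultimately show "real (Rt r H n) \<le> (beta r H + \<epsilon>) * real n"
      using Rt[of n] n by (simp add: algebra_simps)
  qed
qed

lemma Rt_gives_cover:
  assumes r: "1 \<le> r" and H: "finite_graph H" "edges H \<noteq> {}" and eps: "0 < \<epsilon>"
  shows "\<forall>\<^sub>F n in sequentially. cover_bound r H (real (Rt r H n) / real n + \<epsilon>)"
proof -
  obtain n0 where n0: "\<forall>n\<ge>n0. \<forall>\<kappa>\<in>colourings r n.
     cover_bound r H (real (tiling_number r n H \<kappa>) / real n + \<epsilon>)"
    using colouring_gives_cover[OF r H eps] by blast
  show ?thesis
    unfolding eventually_sequentially
  proof (intro exI[of _ n0] allI impI)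
    fix n assume n: "n0 \<le> n"
    obtain \<kappa> where "\<kappa> \<in> colourings r n" "tiling_number r n H \<kappa> = Rt r H n"
      by (rule Rt_attained[OF r])
    then show "cover_bound r H (real (Rt r H n) / real n + \<epsilon>)" using n0 n by metis
  qed
qed

lemma Rt_lower:
  assumes r: "1 \<le> r" and H: "finite_graph H" "edges H \<noteq> {}" and eps: "0 < \<epsilon>"
  shows "\<forall>\<^sub>F n in sequentially. (beta r H - \<epsilon>) * real n \<le> real (Rt r H n)"
  using Rt_gives_cover[OF assms] eventually_gt_at_top[of 0]
proof eventually_elim
  case (elim n)
  have "beta r H \<le> real (Rt r H n) / real n + \<epsilon>"
    by (rule beta_le_cover_bound[OF r H(1) verts_nonempty[OF H] elim(1)])
  then have "(beta r H - \<epsilon>) \<le> real (Rt r H n) / real n" by simp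
  then show ?case using elim(2) by (simp add: pos_le_divide_eq)
qed

text \<open>Strong duality for \<open>beta\<close>, through colourings: an optimal colouring of a large complete graph has a
  tiling number of at most \<open>(beta + o(1)) n\<close> and yields a cover that is almost as good.\<close>

lemma cover_bound_near_beta:
  assumes r: "1 \<le> r" and H: "finite_graph H" "edges H \<noteq> {}" and eps: "0 < \<epsilon>"
  shows "cover_bound r H (beta r H + \<epsilon>)"
proof -
  have "0 < \<epsilon> / 2" using eps by simp
  from Rt_gives_cover[OF r H this] Rt_upper[OF r H(1) verts_nonempty[OF H] this] eventually_gt_at_top[of 0]
  have "\<forall>\<^sub>F n in sequentially. cover_bound r H (beta r H + \<epsilon>)"
  proof eventually_elim
    case (elim n)
    have "real (Rt r H n) / real n \<le> beta r H + \<epsilon> / 2"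
      using elim(2,3) by (simp add: pos_divide_le_eq)
    then show ?case by (intro cover_bound_mono[OF elim(1)]) linarith
  qed
  then show ?thesis by simp
qed

lemma Rt_asymptotics:
  assumes r: "1 \<le> r" and H: "finite_graph H" "edges H \<noteq> {}"
  shows "(\<lambda>n. real (Rt r H n) - beta r H * real n) \<in> o(\<lambda>n. real n)"
proof (rule landau_o.smallI)
  fix c :: real assume c: "0 < c"
  show "\<forall>\<^sub>F n in sequentially. norm (real (Rt r H n) - beta r H * real n) \<le> c * norm (real n)"
    using Rt_upper[OF r H(1) verts_nonempty[OF H] c] Rt_lower[OF r H c]
    by eventually_elim (auto simp: algebra_simps abs_le_iff)
qed


section \<open>Ramsey numbers of disjoint copies\<close>

lemma mono_copy_disjoint_copies_iff:
  assumes H: "finite_graph H" "verts H \<noteq> {}"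
  shows "mono_copies n \<kappa> l (disjoint_copies k H) \<noteq> {} \<longleftrightarrow> k \<le> mono_tiling_number n \<kappa> l H"
proof
  assume "mono_copies n \<kappa> l (disjoint_copies k H) \<noteq> {}"
  then obtain F where F': "inj_on F (verts (disjoint_copies k H))" "F ` verts (disjoint_copies k H) \<subseteq> {..<n}"
    and col: "\<forall>e\<in>edges (disjoint_copies k H). \<kappa> (F ` e) = l"
    unfolding mono_copies_def by blast
  have F: "inj_on F (verts H \<times> {..<k})" "F ` (verts H \<times> {..<k}) \<subseteq> {..<n}"
    using F' by (simp_all add: disjoint_copies_def)
  define K where "K j = image_graph (\<lambda>v. F (v, j)) H" for j
  have vK: "verts (K j) = (\<lambda>v. F (v, j)) ` verts H" for j by (simp add: K_def image_graph_def)
  have K: "K j \<in> mono_copies n \<kappa> l H" if j: "j < k" for j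
  proof -
    have "inj_on (\<lambda>v. F (v, j)) (verts H)"
      using F(1) j by (auto simp: inj_on_def)
    moreover have "(\<lambda>v. F (v, j)) ` verts H \<subseteq> {..<n}"
      using F(2) j by (auto simp: image_subset_iff)
    moreover have "\<kappa> ((\<lambda>v. F (v, j)) ` e) = l" if e: "e \<in> edges H" for e
    proof -
      have "(\<lambda>v. (v, j)) ` e \<in> edges (disjoint_copies k H)"
        using e j by (auto simp: disjoint_copies_def)
      then have "\<kappa> (F ` (\<lambda>v. (v, j)) ` e) = l" using col by blast
      then show ?thesis by (simp add: image_image)
    qed
    ultimately show ?thesis unfolding mono_copies_def K_def by blast
  qed
  have dis: "verts (K i) \<inter> verts (K j) = {}" if "i < k" "j < k" "i \<noteq> j" for i j
    using F(1) that unfolding vK by (auto simp: inj_on_def)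
  have "inj_on K {..<k}"
  proof (rule inj_onI)
    fix i j assume ij: "i \<in> {..<k}" "j \<in> {..<k}" "K i = K j"
    then show "i = j" using dis[of i j] mono_copy_nonempty[OF K H(2), of i] by fastforce
  qed
  then have "card (K ` {..<k}) = k" by (simp add: card_image)
  moreover have "K ` {..<k} \<in> tilings n \<kappa> l H {..<n}"
    unfolding tilings_def
  proof (intro CollectI conjI ballI)
    show "pairwise (\<lambda>K K'. disjnt (verts K) (verts K')) (K ` {..<k})"
    proof (rule pairwiseI)
      fix A B assume "A \<in> K ` {..<k}" "B \<in> K ` {..<k}" "A \<noteq> B"
      then obtain i j where "A = K i" "B = K j" "i < k" "j < k" "i \<noteq> j" by auto
      then show "disjnt (verts A) (verts B)" using dis by (simp add: disjnt_def)
    qed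
    show "verts A \<subseteq> {..<n}" if "A \<in> K ` {..<k}" for A
      using that K mono_copy_verts by blast
  qed (use K in auto)
  ultimately show "k \<le> mono_tiling_number n \<kappa> l H"
    unfolding mono_tiling_number_eq using card_le_tiling_within[OF H(1)] by metis
next
  assume k: "k \<le> mono_tiling_number n \<kappa> l H"
  obtain C where C: "C \<in> tilings n \<kappa> l H {..<n}" "card C = mono_tiling_number n \<kappa> l H"
    using tiling_within_attained[OF H(1)] mono_tiling_number_eq by metis
  have "\<exists>K. inj_on K {..<k} \<and> K ` {..<k} \<subseteq> C"
    using card_le_inj[of "{..<k}" C] finite_tiling[OF H(1) C(1)] C(2) k by auto
  then obtain K where K: "inj_on K {..<k}" "\<And>j. j < k \<Longrightarrow> K j \<in> C" by blast
  have "\<exists>g. j < k \<longrightarrow> K j = image_graph g H \<and> inj_on g (verts H) \<and> g ` verts H \<subseteq> {..<n} \<and>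
        (\<forall>e\<in>edges H. \<kappa> (g ` e) = l)" for j
  proof (cases "j < k")
    case True
    then have "K j \<in> mono_copies n \<kappa> l H" using C(1) K(2) by (auto simp: tilings_def)
    then show ?thesis unfolding mono_copies_def by blast
  qed simp
  then have "\<forall>j. \<exists>g. j < k \<longrightarrow> K j = image_graph g H \<and> inj_on g (verts H) \<and> g ` verts H \<subseteq> {..<n} \<and>
        (\<forall>e\<in>edges H. \<kappa> (g ` e) = l)" ..
  from choice[OF this] obtain g where g: "\<And>j. j < k \<Longrightarrow> K j = image_graph (g j) H \<and>
      inj_on (g j) (verts H) \<and> g j ` verts H \<subseteq> {..<n} \<and> (\<forall>e\<in>edges H. \<kappa> (g j ` e) = l)"
    by auto
  define F where "F p = g (snd p) (fst p)" for p
  have "inj_on F (verts H \<times> {..<k})"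
  proof (rule inj_onI, clarify)
    fix u i v j assume uv: "u \<in> verts H" "v \<in> verts H" "i < k" "j < k" "F (u, i) = F (v, j)"
    have "i = j"
    proof (rule ccontr)
      assume "i \<noteq> j"
      then have "K i \<noteq> K j" using K(1) uv by (auto dest: inj_onD)
      then have "verts (K i) \<inter> verts (K j) = {}"
        using C(1) K(2) uv by (simp add: tilings_def pairwise_def disjnt_def)
      moreover have "verts (K i) = g i ` verts H" "verts (K j) = g j ` verts H"
        using g[OF uv(3)] g[OF uv(4)] by (metis fst_conv image_graph_def)+
      then have "F (u, i) \<in> verts (K i)" "F (v, j) \<in> verts (K j)"
        using uv(1,2) by (simp_all add: F_def)
      ultimately show False using uv(5) by auto
    qed
    then show "u = v \<and> i = j" using g uv by (auto simp: F_def dest: inj_onD)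
  qed
  moreover have "F ` (verts H \<times> {..<k}) \<subseteq> {..<n}"
  proof clarify
    fix v j assume vj: "v \<in> verts H" "j < k"
    then have "g j v \<in> {..<n}" using g[OF vj(2)] by blast
    then show "F (v, j) < n" by (simp add: F_def)
  qed
  moreover have "\<kappa> (F ` e) = l" if e: "e \<in> edges (disjoint_copies k H)" for e
  proof -
    obtain e' j where e': "e = (\<lambda>v. (v, j)) ` e'" "e' \<in> edges H" "j < k"
      using e by (auto simp: disjoint_copies_def)
    then have "F ` e = g j ` e'" by (auto simp: F_def image_image)
    then show ?thesis using g[OF e'(3)] e'(2) by simp
  qed
  ultimately have "image_graph F (disjoint_copies k H) \<in> mono_copies n \<kappa> l (disjoint_copies k H)"
    unfolding mono_copies_def by (auto simp: disjoint_copies_def)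
  then show "mono_copies n \<kappa> l (disjoint_copies k H) \<noteq> {}" by blast
qed

lemma ramsey_number_eq:
  assumes r: "1 \<le> r" and H: "finite_graph H" "verts H \<noteq> {}"
  shows "ramsey_number r (disjoint_copies k H) = (LEAST n. k \<le> Rt r H n)"
proof -
  have "(\<forall>\<kappa>\<in>colourings r n. \<exists>l\<in>{1..r}. mono_copies n \<kappa> l (disjoint_copies k H) \<noteq> {}) \<longleftrightarrow> k \<le> Rt r H n" for n
  proof -
    have "(\<exists>l\<in>{1..r}. k \<le> mono_tiling_number n \<kappa> l H) \<longleftrightarrow> k \<le> tiling_number r n H \<kappa>" for \<kappa>
      unfolding tiling_number_def using r by (subst Max_ge_iff) auto
    moreover have "(\<forall>\<kappa>\<in>colourings r n. k \<le> tiling_number r n H \<kappa>) \<longleftrightarrow> k \<le> Rt r H n"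
      by (metis Rt_attained[OF r] Rt_le order_trans)
    ultimately show ?thesis by (simp add: mono_copy_disjoint_copies_iff[OF H])
  qed
  then show ?thesis by (simp add: ramsey_number_def)
qed

text \<open>The generalized inverse of a sequence that grows like \<open>b * n\<close> grows like \<open>k / b\<close>.\<close>

lemma least_inverse_asymptotics:
  fixes g :: "nat \<Rightarrow> nat"
  assumes b: "0 < b" and g: "(\<lambda>n. real (g n) - b * real n) \<in> o(\<lambda>n. real n)" and gle: "\<And>n. g n \<le> n"
  shows "(\<lambda>k. real (LEAST n. k \<le> g n) - (1 / b) * real k) \<in> o(\<lambda>k. real k)"
proof (rule landau_o.smallI)
  fix c :: real assume c: "0 < c"
  define \<epsilon> where "\<epsilon> = min (b / 2) (c * b\<^sup>2 / 4)"
  have e: "0 < \<epsilon>" "\<epsilon> \<le> b / 2" "\<epsilon> \<le> c * b\<^sup>2 / 4" using b c by (auto simp: \<epsilon>_def)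
  obtain n0 where n0: "\<And>n. n0 \<le> n \<Longrightarrow> \<bar>real (g n) - b * real n\<bar> \<le> \<epsilon> * real n"
    using landau_o.smallD[OF g e(1)] by (auto simp: eventually_sequentially)
  define k0 where "k0 = n0 + nat \<lceil>2 / c\<rceil> + 2"
  have "norm (real (LEAST n. k \<le> g n) - (1 / b) * real k) \<le> c * norm (real k)" if k: "k0 \<le> k" for k
  proof -
    define R where "R = (LEAST n. k \<le> g n)"
    have "\<exists>n. k \<le> g n"
    proof -
      define n where "n = n0 + nat \<lceil>2 * real k / b\<rceil>"
      have "2 * real k / b \<le> real n" unfolding n_def by linarith
      then have "real k \<le> b / 2 * real n" using b by (simp add: field_simps)
      also have "\<dots> \<le> (b - \<epsilon>) * real n" using e by (intro mult_right_mono) auto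
      also have "\<dots> \<le> real (g n)" using n0[of n] by (simp add: n_def algebra_simps abs_le_iff)
      finally show ?thesis by auto
    qed
    then have Rk: "k \<le> g R" unfolding R_def by (rule LeastI_ex)
    then have kR: "k \<le> R" using gle[of R] by linarith
    have "\<not> k \<le> g (R - 1)" using kR k unfolding R_def k0_def by (intro not_less_Least) auto
    then have R1: "g (R - 1) < k" by simp
    have k2: "2 / c \<le> real k" using k unfolding k0_def by linarith
    have ge: "real k \<le> (b + \<epsilon>) * real R"
      using n0[of R] kR k Rk by (simp add: k0_def algebra_simps abs_le_iff)
    have "(b - \<epsilon>) * real (R - 1) \<le> real (g (R - 1))"
      using n0[of "R - 1"] kR k by (simp add: k0_def algebra_simps abs_le_iff)
    then have lt: "(b - \<epsilon>) * (real R - 1) < real k"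
      using R1 kR k by (simp add: k0_def of_nat_diff)
    have eb: "\<epsilon> / b \<le> c * b / 4" using e(3) b by (simp add: field_simps power2_eq_square)
    have "b * real R - real k \<le> c * b * real k"
    proof -
      have half: "b / 2 * (real R - 1) \<le> (b - \<epsilon>) * (real R - 1)"
        using e kR k by (intro mult_right_mono) (auto simp: k0_def)
      then have "real R - 1 \<le> 2 * real k / b" using lt b by (simp add: field_simps)
      then have "\<epsilon> * (real R - 1) \<le> \<epsilon> * (2 * real k / b)" using e by (intro mult_left_mono) auto
      also have "\<dots> = (\<epsilon> / b) * (2 * real k)" by simp
      also have "\<dots> \<le> (c * b / 4) * (2 * real k)" using eb by (intro mult_right_mono) auto
      also have "\<dots> = c * b * real k / 2" by simp
      finally have "\<epsilon> * (real R - 1) \<le> c * b * real k / 2" .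
      moreover have "b \<le> c * b * real k / 2"
        using k2 b c by (simp add: field_simps)
      ultimately show ?thesis using lt by (simp add: algebra_simps)
    qed
    moreover have "real k - b * real R \<le> c * b * real k"
    proof (cases "b * real R \<le> real k")
      case True
      then have "real R \<le> real k / b" using b by (simp add: field_simps)
      then have "\<epsilon> * real R \<le> \<epsilon> * (real k / b)" using e by (intro mult_left_mono) auto
      also have "\<dots> = (\<epsilon> / b) * real k" by simp
      also have "\<dots> \<le> (c * b / 4) * real k" using eb by (intro mult_right_mono) auto
      also have "\<dots> \<le> c * b * real k" using b c by (simp add: field_simps)
      finally show ?thesis using ge by (simp add: algebra_simps)
    next
      case False
      moreover have "0 \<le> c * b * real k" using b c by simp
      ultimately show ?thesis by linarith
    qed
    ultimately have "\<bar>b * real R - real k\<bar> \<le> c * b * real k" by linarith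
    then have "\<bar>b * (real R - (1 / b) * real k)\<bar> \<le> b * (c * real k)" using b by (simp add: algebra_simps)
    then have "b * \<bar>real R - (1 / b) * real k\<bar> \<le> b * (c * real k)" using b by (simp only: abs_mult abs_of_pos)
    then have "\<bar>real R - (1 / b) * real k\<bar> \<le> c * real k" using b by (simp only: mult_le_cancel_left_pos)
    then show ?thesis by (simp add: R_def)
  qed
  then show "\<forall>\<^sub>F k in sequentially. norm (real (LEAST n. k \<le> g n) - (1 / b) * real k) \<le> c * norm (real k)"
    unfolding eventually_sequentially by blast
qed

lemma ramsey_asymptotics:
  assumes r: "1 \<le> r" and H: "finite_graph H" "edges H \<noteq> {}"
  shows "(\<lambda>k. real (ramsey_number r (disjoint_copies k H)) - (1 / beta r H) * real k) \<in> o(\<lambda>k. real k)"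
proof -
  have vH: "verts H \<noteq> {}" by (rule verts_nonempty[OF H])
  have "Rt r H n \<le> n" for n
  proof -
    obtain \<kappa> where "\<kappa> \<in> colourings r n" "tiling_number r n H \<kappa> = Rt r H n"
      by (rule Rt_attained[OF r])
    moreover have "tiling_number r n H \<kappa> \<le> n"
      unfolding tiling_number_def using r mono_tiling_number_le[OF H(1) vH] by (subst Max_le_iff) auto
    ultimately show ?thesis by simp
  qed
  from least_inverse_asymptotics[OF beta_pos[OF r H(1) vH] Rt_asymptotics[OF r H] this]
  show ?thesis by (simp only: ramsey_number_eq[OF r H(1) vH])
qed


section \<open>Recursive functions\<close>

text \<open>A function of several variables, or one with bound variables in scope, is treated as a
  function of the code of the tuple of its variables. The rules below turn the recursiveness of an
  expression into that of its parts.\<close>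

lemma recursive_id: "recursive (\<lambda>a. a)"
  using recursive.pair[OF recursive.first recursive.second] by simp

lemma recursive_fst: "recursive f \<Longrightarrow> recursive (\<lambda>a. fst (prod_decode (f a)))"
  by (rule recursive.comp[OF recursive.first])

lemma recursive_snd: "recursive f \<Longrightarrow> recursive (\<lambda>a. snd (prod_decode (f a)))"
  by (rule recursive.comp[OF recursive.second])

lemma recursive_Suc: "recursive f \<Longrightarrow> recursive (\<lambda>a. Suc (f a))"
  by (rule recursive.comp[OF recursive.suc])

lemma recursive_const: "recursive (\<lambda>_. c)"
  by (induction c) (auto intro: recursive.zero recursive_Suc)

lemma recursive_rec_nat:
  assumes "recursive f" "recursive b"
    "recursive (\<lambda>c. g (fst (prod_decode c)) (fst (prod_decode (snd (prod_decode c))))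
       (snd (prod_decode (snd (prod_decode c)))))"
  shows "recursive (\<lambda>a. rec_nat (f a) (g a) (b a))"
  using recursive.comp[OF recursive.prim_rec[OF assms(1,3)] recursive.pair[OF recursive_id assms(2)]]
  by simp

lemmas recursive_base = recursive_id recursive_fst recursive_snd recursive_Suc recursive_const recursive.pair

lemma recursive_add:
  assumes "recursive f" "recursive g"
  shows "recursive (\<lambda>a. f a + g a)"
proof -
  have "rec_nat x (\<lambda>_ z. Suc z) y = x + y" for x y :: nat by (induction y) auto
  moreover have "recursive (\<lambda>a. rec_nat (f a) (\<lambda>_ z. Suc z) (g a))"
    by (rule recursive_rec_nat) (intro assms recursive_base)+
  ultimately show ?thesis by simp
qed

lemma recursive_mult:
  assumes "recursive f" "recursive g"
  shows "recursive (\<lambda>a. f a * g a)"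
proof -
  have "rec_nat 0 (\<lambda>_ z. z + x) y = x * y" for x y :: nat by (induction y) auto
  moreover have "recursive (\<lambda>a. rec_nat 0 (\<lambda>_ z. z + f a) (g a))"
    by (rule recursive_rec_nat)
      (intro assms recursive_base recursive_add recursive.comp[OF assms(1)])+
  ultimately show ?thesis by simp
qed

lemma recursive_diff:
  assumes "recursive f" "recursive g"
  shows "recursive (\<lambda>a. f a - g a)"
proof -
  have "rec_nat 0 (\<lambda>m _. m) x = x - 1" for x :: nat by (cases x) auto
  moreover have "recursive (\<lambda>a. rec_nat 0 (\<lambda>m _. m) (h a))" if "recursive h" for h
    by (rule recursive_rec_nat) (intro that recursive_base)+
  ultimately have pred: "recursive (\<lambda>a. h a - 1)" if "recursive h" for h using that by simp
  have "rec_nat x (\<lambda>_ z. z - 1) y = x - y" for x y :: nat by (induction y) auto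
  moreover have "recursive (\<lambda>a. rec_nat (f a) (\<lambda>_ z. z - 1) (g a))"
    by (rule recursive_rec_nat) (intro assms pred recursive_base)+
  ultimately show ?thesis by simp
qed

lemma recursive_power:
  assumes "recursive f" "recursive g"
  shows "recursive (\<lambda>a. f a ^ g a)"
proof -
  have "rec_nat 1 (\<lambda>_ z. z * x) y = x ^ y" for x y :: nat by (induction y) auto
  moreover have "recursive (\<lambda>a. rec_nat 1 (\<lambda>_ z. z * f a) (g a))"
    by (rule recursive_rec_nat)
      (intro assms recursive_base recursive_mult recursive.comp[OF assms(1)])+
  ultimately show ?thesis by simp
qed

lemma recursive_fact:
  assumes "recursive f"
  shows "recursive (\<lambda>a. fact (f a))"
proof -
  have "rec_nat 1 (\<lambda>m z. z * Suc m) x = fact x" for x :: nat by (induction x) (auto simp: algebra_simps)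
  moreover have "recursive (\<lambda>a. rec_nat 1 (\<lambda>m z. z * Suc m) (f a))"
    by (rule recursive_rec_nat) (intro assms recursive_base recursive_mult)+
  ultimately show ?thesis by simp
qed

lemma recursive_sum:
  assumes "recursive b" "recursive (\<lambda>c. g (fst (prod_decode c)) (snd (prod_decode c)))"
  shows "recursive (\<lambda>a. \<Sum>i<b a. g a i)"
proof -
  have "rec_nat 0 (\<lambda>m z. z + g a m) y = (\<Sum>i<y. g a i)" for a y by (induction y) auto
  moreover have "recursive (\<lambda>c. g (fst (prod_decode c)) (fst (prod_decode (snd (prod_decode c)))))"
  proof -
    have "recursive (\<lambda>c. prod_encode (fst (prod_decode c), fst (prod_decode (snd (prod_decode c)))))"
      by (intro recursive_base)
    from recursive.comp[OF assms(2) this] show ?thesis by simp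
  qed
  then have "recursive (\<lambda>a. rec_nat 0 (\<lambda>m z. z + g a m) (b a))"
    by (intro recursive_rec_nat recursive_add assms recursive_base)
  ultimately show ?thesis by simp
qed

definition decidable :: "(nat \<Rightarrow> bool) \<Rightarrow> bool" where
  "decidable P \<longleftrightarrow> recursive (\<lambda>a. if P a then 1 else 0)"

lemma decidable_le:
  assumes "recursive f" "recursive g"
  shows "decidable (\<lambda>a. f a \<le> g a)"
proof -
  have "recursive (\<lambda>a. 1 - (f a - g a))" by (intro recursive_diff assms recursive_const)
  moreover have "(\<lambda>a. 1 - (f a - g a)) = (\<lambda>a. if f a \<le> g a then 1 else 0)" by auto
  ultimately show ?thesis by (simp add: decidable_def)
qed

lemma decidable_not:
  assumes "decidable P"
  shows "decidable (\<lambda>a. \<not> P a)"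
proof -
  have "recursive (\<lambda>a. 1 - (if P a then 1 else 0))"
    using assms unfolding decidable_def by (intro recursive_diff recursive_const)
  moreover have "(\<lambda>a. 1 - (if P a then 1 else 0)) = (\<lambda>a. if \<not> P a then 1 else (0::nat))" by auto
  ultimately show ?thesis by (simp add: decidable_def)
qed

lemma decidable_conj:
  assumes "decidable P" "decidable Q"
  shows "decidable (\<lambda>a. P a \<and> Q a)"
proof -
  have "recursive (\<lambda>a. (if P a then 1 else 0) * (if Q a then 1 else 0))"
    using assms unfolding decidable_def by (intro recursive_mult)
  moreover have "(\<lambda>a. (if P a then 1 else 0) * (if Q a then 1 else 0)) = (\<lambda>a. if P a \<and> Q a then 1 else (0::nat))"
    by auto
  ultimately show ?thesis by (simp add: decidable_def)
qed

lemma decidable_disj: "decidable P \<Longrightarrow> decidable Q \<Longrightarrow> decidable (\<lambda>a. P a \<or> Q a)"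
  using decidable_not[OF decidable_conj[OF decidable_not decidable_not]] by simp

lemma decidable_imp: "decidable P \<Longrightarrow> decidable Q \<Longrightarrow> decidable (\<lambda>a. P a \<longrightarrow> Q a)"
  unfolding imp_conv_disj by (intro decidable_disj decidable_not)

lemma decidable_eq:
  assumes "recursive f" "recursive g"
  shows "decidable (\<lambda>a. f a = g a)"
  using decidable_conj[OF decidable_le[OF assms] decidable_le[OF assms(2,1)]] by (simp add: order_eq_iff)

lemma decidable_all_less:
  assumes "recursive b" "decidable (\<lambda>c. P (fst (prod_decode c)) (snd (prod_decode c)))"
  shows "decidable (\<lambda>a. \<forall>i<b a. P a i)"
proof -
  have "recursive (\<lambda>a. \<Sum>i<b a. if \<not> P a i then 1 else 0)"
    using decidable_not[OF assms(2)] unfolding decidable_def by (intro recursive_sum assms(1))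
  then have "decidable (\<lambda>a. (\<Sum>i<b a. if \<not> P a i then 1 else 0) = (0::nat))"
    by (intro decidable_eq recursive_const)
  moreover have "((\<Sum>i<b a. if \<not> P a i then 1 else 0) = (0::nat)) \<longleftrightarrow> (\<forall>i<b a. P a i)" for a
    by (auto simp: sum_eq_0_iff split: if_splits)
  ultimately show ?thesis by simp
qed

lemma decidable_ex_less:
  assumes "recursive b" "decidable (\<lambda>c. P (fst (prod_decode c)) (snd (prod_decode c)))"
  shows "decidable (\<lambda>a. \<exists>i<b a. P a i)"
  using decidable_not[OF decidable_all_less[OF assms(1) decidable_not[OF assms(2)]]] by simp

text \<open>The search is bounded by \<open>b a\<close>, so that it ends also on inputs without a solution.\<close>

lemma recursive_bounded_search:
  assumes "recursive b" "decidable (\<lambda>c. P (fst (prod_decode c)) (snd (prod_decode c)))"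
  shows "recursive (\<lambda>a. LEAST m. m = b a \<or> P a m)"
proof -
  define f where "f c = (if \<not> (snd (prod_decode c) = b (fst (prod_decode c)) \<or>
     P (fst (prod_decode c)) (snd (prod_decode c))) then 1 else 0 :: nat)" for c
  have "recursive f"
    unfolding f_def decidable_def[symmetric]
    by (intro decidable_not decidable_disj decidable_eq assms recursive_base recursive.comp[OF assms(1)])
  moreover have "\<exists>m. f (prod_encode (a, m)) = 0" for a by (intro exI[of _ "b a"]) (simp add: f_def)
  ultimately have "recursive (\<lambda>a. LEAST m. f (prod_encode (a, m)) = 0)" by (rule recursive.minimize)
  moreover have "f (prod_encode (a, m)) = 0 \<longleftrightarrow> m = b a \<or> P a m" for a m by (auto simp: f_def)
  ultimately show ?thesis by simp
qed


section \<open>Codes of lists\<close>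

definition code_drop :: "nat \<Rightarrow> nat \<Rightarrow> nat" where
  "code_drop c k = rec_nat c (\<lambda>_ y. snd (prod_decode (y - 1))) k"

definition code_nth :: "nat \<Rightarrow> nat \<Rightarrow> nat" where
  "code_nth c k = fst (prod_decode (code_drop c k - 1))"

lemma prod_decode_0: "prod_decode 0 = (0, 0)"
  using prod_encode_inverse[of "(0, 0)"] by (simp add: prod_encode_def)

lemma code_drop: "code_drop (list_encode xs) k = list_encode (drop k xs)"
proof (induction k)
  case 0
  show ?case by (simp add: code_drop_def)
next
  case (Suc k)
  have "code_drop (list_encode xs) (Suc k) = snd (prod_decode (list_encode (drop k xs) - 1))"
    using Suc by (simp add: code_drop_def)
  also have "\<dots> = list_encode (drop (Suc k) xs)"
    by (cases "drop k xs") (auto simp: prod_decode_0 drop_Suc tl_drop[symmetric] drop_tl)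
  finally show ?case .
qed

lemma code_nth: "k < length xs \<Longrightarrow> code_nth (list_encode xs) k = xs ! k"
  by (simp add: code_nth_def code_drop Cons_nth_drop_Suc[symmetric])

lemma code_drop_eq_0_iff: "code_drop (list_encode xs) k = 0 \<longleftrightarrow> length xs \<le> k"
  unfolding code_drop by (cases "drop k xs") auto

lemma length_le_list_encode: "length xs \<le> list_encode xs"
proof (induction xs)
  case (Cons x xs)
  then show ?case using le_prod_encode_2[of "list_encode xs" x] by simp
qed simp

lemma all_in_list_iff_code:
  "(\<forall>x\<in>set xs. P x) \<longleftrightarrow>
     (\<forall>k<list_encode xs. \<not> code_drop (list_encode xs) k = 0 \<longrightarrow> P (code_nth (list_encode xs) k))"
proof -
  have "(\<forall>x\<in>set xs. P x) \<longleftrightarrow> (\<forall>k<length xs. P (xs ! k))" by (auto simp: all_set_conv_all_nth)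
  then show ?thesis
    using length_le_list_encode[of xs] by (auto simp: code_drop_eq_0_iff not_le code_nth)
qed

definition code_bound :: "nat \<Rightarrow> nat \<Rightarrow> nat" where
  "code_bound L E = rec_nat 0 (\<lambda>_ y. Suc (prod_encode (E, y))) L"

lemma prod_encode_mono: "a \<le> a' \<Longrightarrow> b \<le> b' \<Longrightarrow> prod_encode (a, b) \<le> prod_encode (a', b')"
  unfolding prod_encode_def triangle_def
  by (auto intro!: add_mono div_le_mono mult_le_mono)

lemma list_encode_le_code_bound:
  "(\<And>x. x \<in> set xs \<Longrightarrow> x \<le> E) \<Longrightarrow> list_encode xs \<le> code_bound (length xs) E"
proof (induction xs)
  case (Cons x xs)
  then have "prod_encode (x, list_encode xs) \<le> prod_encode (E, code_bound (length xs) E)"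
    by (intro prod_encode_mono) auto
  then show ?case by (simp add: code_bound_def)
qed (simp add: code_bound_def)

definition table_code :: "(nat \<Rightarrow> nat) \<Rightarrow> nat \<Rightarrow> nat" where
  "table_code F L = list_encode (map F [0..<L])"

lemma code_nth_table: "k < L \<Longrightarrow> code_nth (table_code F L) k = F k"
  by (simp add: table_code_def code_nth)

lemma table_code_bound:
  assumes "\<And>k. k < L \<Longrightarrow> F k \<le> E"
  shows "table_code F L < Suc (code_bound L E)"
proof -
  have "list_encode (map F [0..<L]) \<le> code_bound (length (map F [0..<L])) E"
    by (rule list_encode_le_code_bound) (use assms in auto)
  then show ?thesis by (simp add: table_code_def)
qed

lemma recursive_code_drop:
  assumes "recursive f" "recursive g"
  shows "recursive (\<lambda>a. code_drop (f a) (g a))"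
  unfolding code_drop_def by (rule recursive_rec_nat) (intro assms recursive_diff recursive_base)+

lemma recursive_code_nth: "recursive f \<Longrightarrow> recursive g \<Longrightarrow> recursive (\<lambda>a. code_nth (f a) (g a))"
  unfolding code_nth_def by (intro recursive_diff recursive_base recursive_code_drop)

lemma recursive_code_bound:
  assumes "recursive f" "recursive g"
  shows "recursive (\<lambda>a. code_bound (f a) (g a))"
  unfolding code_bound_def
  by (rule recursive_rec_nat) (intro assms recursive_base recursive.comp[OF assms(2)])+


section \<open>Certificates for the constant\<close>

text \<open>The constraints on a cover have entries at most the number \<open>n\<close> of vertices of the graph. Those on
  the sizes of the strips, with the vertices of the first polyhedra as covers, have the numerators and
  the common denominator of these covers as entries. In both cases there are at most \<open>Suc r\<close> variables.\<close>

definition cover_height :: "nat \<Rightarrow> nat \<Rightarrow> nat" where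
  "cover_height r n = height_bound (Suc r) n"

definition weight_height :: "nat \<Rightarrow> nat \<Rightarrow> nat" where
  "weight_height r n = height_bound (Suc r) (fact (cover_height r n) * Suc (cover_height r n))"

text \<open>The fractions \<open>X i / fact (weight_height r n)\<close> are the sizes of the strips, the fractions
  \<open>Y l i / fact (cover_height r n)\<close> form a cover, and \<open>p / fact (weight_height r n)\<close> is a bound for its
  averages. The edges of the graph are those of the list \<open>es\<close> on the vertex set \<open>{..<n}\<close>.\<close>

definition certificate ::
  "nat \<Rightarrow> nat \<Rightarrow> (nat \<times> nat) list \<Rightarrow> nat \<Rightarrow> nat \<Rightarrow> (nat \<Rightarrow> nat \<Rightarrow> nat) \<Rightarrow> (nat \<Rightarrow> nat) \<Rightarrow> (nat \<Rightarrow> nat \<Rightarrow> nat) \<Rightarrow> bool" where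
  "certificate r n es p q lam X Y \<longleftrightarrow> 1 \<le> q \<and> q \<le> r \<and> strip_template r q lam \<and>
     (\<Sum>i\<in>{1..q}. X i) = fact (weight_height r n) \<and>
     (\<forall>l\<in>{1..r}. (\<Sum>i\<in>{1..q}. X i * Y l i) \<le> fact (cover_height r n) * p) \<and>
     (\<forall>l\<in>{1..r}. \<forall>f. (\<forall>v<n. f v \<in> {1..q}) \<and> (\<forall>(u, v)\<in>set es. lam (f u) (f v) = l) \<longrightarrow>
        fact (cover_height r n) \<le> (\<Sum>v<n. Y l (f v)))"

text \<open>Edges are unordered and the entries of \<open>es\<close> are ordered pairs, which makes no difference for
  symmetric templates.\<close>

lemma presents_edge_iff:
  assumes "presents n es H" and g: "bij_betw g {..<n} (verts H)"
    "edges H = {{g u, g v} | u v. (u, v) \<in> set es}"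
    and sym: "\<And>i j. i \<in> {1..q} \<Longrightarrow> j \<in> {1..q} \<Longrightarrow> lam j i = lam i j"
    and f: "\<And>v. v \<in> verts H \<Longrightarrow> f v \<in> {1..q}"
  shows "(\<forall>u v. {u, v} \<in> edges H \<longrightarrow> lam (f u) (f v) = l) \<longleftrightarrow>
    (\<forall>(u, v)\<in>set es. lam (f (g u)) (f (g v)) = l)"
proof
  assume L: "\<forall>u v. {u, v} \<in> edges H \<longrightarrow> lam (f u) (f v) = l"
  show "\<forall>(u, v)\<in>set es. lam (f (g u)) (f (g v)) = l"
  proof clarify
    fix u v assume "(u, v) \<in> set es"
    then have "{g u, g v} \<in> edges H" unfolding g(2) by auto
    then show "lam (f (g u)) (f (g v)) = l" by (rule L[rule_format])
  qed
next
  assume R: "\<forall>(u, v)\<in>set es. lam (f (g u)) (f (g v)) = l"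
  show "\<forall>u v. {u, v} \<in> edges H \<longrightarrow> lam (f u) (f v) = l"
  proof (intro allI impI)
    fix a b assume "{a, b} \<in> edges H"
    then obtain u v where uv: "{a, b} = {g u, g v}" "(u, v) \<in> set es" unfolding g(2) by auto
    then have l: "lam (f (g u)) (f (g v)) = l" using R by auto
    have "u < n" "v < n" using assms(1) uv(2) by (auto simp: presents_def)
    then have "g u \<in> verts H" "g v \<in> verts H" using g(1) by (auto simp: bij_betw_def)
    then have "lam (f (g v)) (f (g u)) = lam (f (g u)) (f (g v))" using f by (intro sym) auto
    moreover have "(a = g u \<and> b = g v) \<or> (a = g v \<and> b = g u)" using uv(1) by (auto simp: doubleton_eq_iff)
    ultimately show "lam (f a) (f b) = l" using l by auto
  qed
qed

lemma certificate_sound: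
  assumes "presents n es H" "certificate r n es p q lam X Y"
  shows "cover_bound r H (real p / fact (weight_height r n))"
proof -
  obtain g where g: "bij_betw g {..<n} (verts H)" "edges H = {{g u, g v} | u v. (u, v) \<in> set es}"
    using assms(1) by (auto simp: presents_def)
  define N1 where "N1 = (fact (cover_height r n) :: nat)"
  define N2 where "N2 = (fact (weight_height r n) :: nat)"
  have N: "0 < N1" "0 < N2" by (auto simp: N1_def N2_def)
  have c: "1 \<le> q" "q \<le> r" "strip_template r q lam" "(\<Sum>i\<in>{1..q}. X i) = N2"
    "\<And>l. l \<in> {1..r} \<Longrightarrow> (\<Sum>i\<in>{1..q}. X i * Y l i) \<le> N1 * p"
    "\<And>l f. l \<in> {1..r} \<Longrightarrow> \<forall>v<n. f v \<in> {1..q} \<Longrightarrow> \<forall>(u, v)\<in>set es. lam (f u) (f v) = l \<Longrightarrow>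
        N1 \<le> (\<Sum>v<n. Y l (f v))"
    using assms(2) unfolding certificate_def N1_def N2_def by auto
  have "cover_bound r H (real p / real N2)"
    unfolding cover_bound_def
  proof (intro exI conjI)
    show "(\<lambda>i. real (X i) / real N2) \<in> weight_simplex q"
      unfolding weight_simplex_def mem_Collect_eq sum_divide_distrib[symmetric] of_nat_sum[symmetric]
      using c(4) N by simp
    show "template_cover r H {1..q} lam (\<lambda>l i. real (Y l i) / real N1)"
      unfolding template_cover_def
    proof (intro ballI conjI impI)
      fix l f assume l: "l \<in> {1..r}" and f: "f \<in> verts H \<rightarrow> {1..q}"
        and hom: "\<forall>u v. {u, v} \<in> edges H \<longrightarrow> lam (f u) (f v) = l"
      have gH: "g v \<in> verts H" if "v < n" for v using g(1) that by (auto simp: bij_betw_def)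
      have "(\<forall>u v. {u, v} \<in> edges H \<longrightarrow> lam (f u) (f v) = l) \<longleftrightarrow>
          (\<forall>(u, v)\<in>set es. lam (f (g u)) (f (g v)) = l)"
        by (rule presents_edge_iff[where q = q, OF assms(1) g]) (use c(3) f in \<open>auto simp: strip_template_def\<close>)
      then have "\<forall>(u, v)\<in>set es. lam (f (g u)) (f (g v)) = l" using hom by (rule iffD1)
      then have "N1 \<le> (\<Sum>v<n. Y l (f (g v)))" using funcset_mem[OF f gH] by (intro c(6)[OF l]) auto
      also have "\<dots> = (\<Sum>v\<in>verts H. Y l (f v))"
        by (rule sum.reindex_bij_betw[OF g(1)])
      finally show "1 \<le> (\<Sum>v\<in>verts H. real (Y l (f v)) / real N1)"
        unfolding sum_divide_distrib[symmetric] of_nat_sum[symmetric]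
        using N by (simp del: of_nat_sum)
    qed simp
    show "\<forall>l\<in>{1..r}. (\<Sum>i\<in>{1..q}. real (X i) / real N2 * (real (Y l i) / real N1)) \<le> real p / real N2"
    proof
      fix l assume l: "l \<in> {1..r}"
      have "(\<Sum>i\<in>{1..q}. real (X i) / real N2 * (real (Y l i) / real N1)) =
          real (\<Sum>i\<in>{1..q}. X i * Y l i) / (real N2 * real N1)"
        by (simp add: sum_divide_distrib)
      also have "\<dots> \<le> real (N1 * p) / (real N2 * real N1)"
        using c(5)[OF l] by (intro divide_right_mono of_nat_mono) auto
      also have "\<dots> = real p / real N2" using N by simp
      finally show "(\<Sum>i\<in>{1..q}. real (X i) / real N2 * (real (Y l i) / real N1)) \<le> real p / real N2" .
    qed
  qed (use c in auto)
  then show ?thesis by (simp add: N2_def)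
qed

text \<open>A certificate arises from any cover by replacing first the cover of each colour and then the
  sizes of the strips by vertices that do not raise the averages. The strips are the variables from 1 to
  \<open>q\<close> among \<open>0, \<dots>, r\<close>; in this way the bound does not depend on \<open>q\<close>.\<close>

lemma cover_vertex:
  assumes H: "finite_graph H" "verts H \<noteq> {}" and q: "q \<le> r"
    and x: "\<And>i. i \<in> {1..q} \<Longrightarrow> 0 \<le> x i" and y: "template_cover r H {1..q} lam y" and l: "l \<in> {1..r}"
  shows "\<exists>z Y. (\<forall>i\<in>{1..q}. fact (cover_height r (card (verts H))) * z i = real (Y i)) \<and>
     (\<forall>i<Suc r. Y i \<le> fact (cover_height r (card (verts H))) * cover_height r (card (verts H))) \<and>
     (\<Sum>i\<in>{1..q}. x i * z i) \<le> (\<Sum>i\<in>{1..q}. x i * y l i) \<and>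
     (\<forall>f\<in>verts H \<rightarrow> {1..q}. (\<forall>u v. {u, v} \<in> edges H \<longrightarrow> lam (f u) (f v) = l) \<longrightarrow>
        1 \<le> (\<Sum>v\<in>verts H. z (f v)))"
proof -
  let ?n = "card (verts H)" and ?k = "Suc r"
  have n: "1 \<le> ?n" using H by (simp add: finite_graph_def Suc_le_eq card_gt_0_iff)
  define row where "row f = (\<lambda>i. int (fibre_size H f i), 1 :: int)" for f
  define C where "C = unit_row ` {..<?k} \<union> row ` template_maps H q lam l"
  define c where "c i = (if i \<in> {1..q} then x i else 0)" for i
  define z0 where "z0 i = (if i \<in> {1..q} then y l i else 0)" for i
  have sub: "{1..q} \<subseteq> {..<?k}" using q by auto
  have ext: "(\<Sum>i<?k. (if i \<in> {1..q} then g i else 0)) = (\<Sum>i\<in>{1..q}. g i)" for g :: "nat \<Rightarrow> real"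
    by (rule sum.mono_neutral_cong_right) (use sub in auto)
  have row_value: "row_value ?k (fst (row f)) z = (\<Sum>v\<in>verts H. z (f v))"
    if f: "f \<in> template_maps H q lam l" for f z
  proof -
    have "f v \<in> {1..q}" if "v \<in> verts H" for v using f that by (auto simp: template_maps_def)
    then have "{v \<in> verts H. f v = i} = {}" if "i \<notin> {1..q}" for i using that by blast
    then have "fibre_size H f i = 0" if "i \<notin> {1..q}" for i
      unfolding fibre_size_def using that by (metis card.empty)
    then have "row_value ?k (fst (row f)) z = (\<Sum>i<?k. if i \<in> {1..q} then real (fibre_size H f i) * z i else 0)"
      unfolding row_value_def row_def by (intro sum.cong) auto
    then show ?thesis unfolding ext using fibre_sum[OF H(1) f] by simp
  qed
  have unit: "row_value ?k (fst (unit_row i)) z = z i" if "i < ?k" for i z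
    using row_value_unit[OF that] .
  have maps: "restrict f (verts H) \<in> template_maps H q lam l"
    if f: "f \<in> verts H \<rightarrow> {1..q}" "\<forall>u v. {u, v} \<in> edges H \<longrightarrow> lam (f u) (f v) = l" for f
  proof -
    show ?thesis using f edge_verts[OF H(1)] by (auto simp: template_maps_def)
  qed
  have "\<exists>z' m. satisfies ?k C z' \<and> (\<Sum>i<?k. c i * z' i) \<le> (\<Sum>i<?k. c i * z0 i) \<and>
     (\<forall>i<?k. real (fact (height_bound ?k ?n)) * z' i = real (m i) \<and>
        m i \<le> fact (height_bound ?k ?n) * height_bound ?k ?n)"
  proof (rule bounded_vertex)
    show "finite C" using finite_template_maps[OF H(1)] by (simp add: C_def)
    show "unit_row i \<in> C" if "i < ?k" for i using that by (simp add: C_def)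
    show "0 \<le> c i" for i using x by (simp add: c_def)
    show "1 \<le> ?n" by (rule n)
    show "satisfies ?k C z0"
      unfolding satisfies_def
    proof clarify
      fix a b assume "(a, b) \<in> C"
      then consider i where "i < ?k" "(a, b) = unit_row i"
        | f where "f \<in> template_maps H q lam l" "(a, b) = row f" by (auto simp: C_def)
      then show "of_int b \<le> row_value ?k a z0"
      proof cases
        case 1
        then have "b = 0" "a = fst (unit_row i)" by (auto simp: unit_row_def)
        then show ?thesis using unit[OF 1(1)] y l by (auto simp: z0_def template_cover_def)
      next
        case 2
        then have ab: "b = 1" "a = fst (row f)" by (auto simp: row_def)
        have f: "f \<in> verts H \<rightarrow> {1..q}" "\<forall>u v. {u, v} \<in> edges H \<longrightarrow> lam (f u) (f v) = l"
          using 2(1) by (auto simp: template_maps_def PiE_def)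
        then have "1 \<le> (\<Sum>v\<in>verts H. y l (f v))" using y l by (simp add: template_cover_def)
        also have "\<dots> = (\<Sum>v\<in>verts H. z0 (f v))" using f(1) by (intro sum.cong) (auto simp: z0_def Pi_iff)
        finally show ?thesis using row_value[OF 2(1)] ab by simp
      qed
    qed
    fix a b assume "(a, b) \<in> C"
    then consider i where "(a, b) = unit_row i" | f where "(a, b) = row f" by (auto simp: C_def)
    note cases = this
    show "\<bar>b\<bar> \<le> int ?n" using cases n by cases (auto simp: unit_row_def row_def)
    fix j
    have fib: "fibre_size H f j \<le> ?n" for f
      unfolding fibre_size_def using H(1) by (intro card_mono) (auto simp: finite_graph_def)
    show "\<bar>a j\<bar> \<le> int ?n" using cases
    proof cases
      case 1
      then have "\<bar>a j\<bar> \<le> 1" by (auto simp: unit_row_def)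
      then show ?thesis using n by linarith
    next
      case (2 f)
      then have "a j = int (fibre_size H f j)" by (simp add: row_def)
      then show ?thesis using fib[of f] by simp
    qed
  qed
  then obtain z m where z: "satisfies ?k C z" "(\<Sum>i<?k. c i * z i) \<le> (\<Sum>i<?k. c i * z0 i)"
    and zm: "\<forall>i<?k. real (fact (cover_height r ?n)) * z i = real (m i) \<and>
        m i \<le> fact (cover_height r ?n) * cover_height r ?n"
    unfolding cover_height_def[symmetric] by (elim exE conjE) (rule that)
  have m: "real (fact (cover_height r ?n)) * z i = real (m i)"
    "m i \<le> fact (cover_height r ?n) * cover_height r ?n" if "i < ?k" for i
    using zm that by simp_all
  show ?thesis
  proof (intro exI[of _ z] exI[of _ m] conjI ballI allI impI)
    show "fact (cover_height r ?n) * z i = real (m i)" if "i \<in> {1..q}" for i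
      using m(1)[of i] that q by simp
    have "(\<Sum>i<?k. c i * z i) = (\<Sum>i\<in>{1..q}. x i * z i)"
      "(\<Sum>i<?k. c i * z0 i) = (\<Sum>i\<in>{1..q}. x i * y l i)"
      unfolding ext[symmetric] by (auto intro!: sum.cong simp: c_def z0_def)
    then show "(\<Sum>i\<in>{1..q}. x i * z i) \<le> (\<Sum>i\<in>{1..q}. x i * y l i)" using z(2) by simp
    fix f assume f: "f \<in> verts H \<rightarrow> {1..q}" "\<forall>u v. {u, v} \<in> edges H \<longrightarrow> lam (f u) (f v) = l"
    have "row (restrict f (verts H)) \<in> C" using maps[OF f] by (simp add: C_def)
    then have "1 \<le> row_value ?k (fst (row (restrict f (verts H)))) z"
      using z(1) by (force simp: satisfies_def row_def)
    then show "1 \<le> (\<Sum>v\<in>verts H. z (f v))" using row_value[OF maps[OF f]] by simp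
  qed (use m in auto)
qed

text \<open>Here the variable with index 0 stands for the largest average, which is the cost.\<close>

lemma weight_vertex:
  fixes Y :: "nat \<Rightarrow> nat \<Rightarrow> nat"
  assumes q: "1 \<le> q" "q \<le> r" and x: "\<And>i. i \<in> {1..q} \<Longrightarrow> 0 \<le> x i" "(\<Sum>i\<in>{1..q}. x i) = 1"
    and N1: "N1 = fact (cover_height r n)"
    and Y: "\<And>l i. l \<in> {1..r} \<Longrightarrow> i \<in> {1..q} \<Longrightarrow> Y l i \<le> N1 * cover_height r n"
    and b: "0 \<le> b" "\<And>l. l \<in> {1..r} \<Longrightarrow> (\<Sum>i\<in>{1..q}. x i * real (Y l i)) \<le> real N1 * b"
  shows "\<exists>X. (\<forall>i<Suc r. X i \<le> fact (weight_height r n) * weight_height r n) \<and>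
     (\<Sum>i\<in>{1..q}. X i) = fact (weight_height r n) \<and>
     (\<forall>l\<in>{1..r}. (\<Sum>i\<in>{1..q}. X i * Y l i) \<le> N1 * X 0) \<and>
     real (X 0) \<le> fact (weight_height r n) * b"
proof -
  let ?k = "Suc r" and ?M = "N1 * Suc (cover_height r n)"
  define N2 where "N2 = (fact (weight_height r n) :: nat)"
  have wh: "weight_height r n = height_bound ?k ?M" by (simp add: weight_height_def N1)
  have M: "1 \<le> ?M" "N1 \<le> ?M" using N1 by (simp_all add: Suc_le_eq)
  define s :: "nat \<Rightarrow> int" where "s i = (if i \<in> {1..q} then 1 else 0)" for i
  define avg :: "nat \<Rightarrow> nat \<Rightarrow> int" where
    "avg l i = (if i = 0 then int N1 else if i \<in> {1..q} then - int (Y l i) else 0)" for l i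
  define C where "C = unit_row ` {..<?k} \<union> {(s, 1), (\<lambda>i. - s i, -1)} \<union> (\<lambda>l. (avg l, 0)) ` {1..r}"
  define c :: "nat \<Rightarrow> real" where "c i = (if i = 0 then 1 else 0)" for i
  define z0 where "z0 i = (if i = 0 then b else if i \<in> {1..q} then x i else 0)" for i
  have sub: "{1..q} \<subseteq> {..<?k}" using q by auto
  have ext: "(\<Sum>i<?k. (if i \<in> {1..q} then g i else 0)) = (\<Sum>i\<in>{1..q}. g i)" for g :: "nat \<Rightarrow> real"
    by (rule sum.mono_neutral_cong_right) (use sub in auto)
  have s_value: "row_value ?k s z = (\<Sum>i\<in>{1..q}. z i)" for z
    unfolding row_value_def ext[symmetric] by (intro sum.cong) (auto simp: s_def)
  have ms_value: "row_value ?k (\<lambda>i. - s i) z = - (\<Sum>i\<in>{1..q}. z i)" for z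
    unfolding s_value[symmetric] by (simp add: row_value_def sum_negf)
  have avg_value: "row_value ?k (avg l) z = real N1 * z 0 - (\<Sum>i\<in>{1..q}. z i * real (Y l i))" for l z
  proof -
    have "row_value ?k (avg l) z =
      (\<Sum>i<?k. (if i = 0 then real N1 * z 0 else 0) - (if i \<in> {1..q} then z i * real (Y l i) else 0))"
      unfolding row_value_def by (intro sum.cong) (auto simp: avg_def)
    also have "\<dots> = (\<Sum>i<?k. (if i = 0 then real N1 * z 0 else 0)) - (\<Sum>i\<in>{1..q}. z i * real (Y l i))"
      unfolding sum_subtractf ext ..
    finally show ?thesis by simp
  qed
  have c_value: "(\<Sum>i<?k. c i * z i) = z 0" for z
    by (simp add: c_def if_distrib[of "\<lambda>x. x * _"] cong: if_cong)
  have "\<exists>z' m. satisfies ?k C z' \<and> (\<Sum>i<?k. c i * z' i) \<le> (\<Sum>i<?k. c i * z0 i) \<and>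
     (\<forall>i<?k. real (fact (height_bound ?k ?M)) * z' i = real (m i) \<and>
        m i \<le> fact (height_bound ?k ?M) * height_bound ?k ?M)"
  proof (rule bounded_vertex)
    show "finite C" by (simp add: C_def)
    show "unit_row i \<in> C" if "i < ?k" for i using that by (simp add: C_def)
    show "0 \<le> c i" for i by (simp add: c_def)
    show "1 \<le> ?M" by (rule M)
    have z0: "(\<Sum>i\<in>{1..q}. z0 i * g i) = (\<Sum>i\<in>{1..q}. x i * g i)" for g :: "nat \<Rightarrow> real"
      by (intro sum.cong) (auto simp: z0_def)
    show "satisfies ?k C z0"
      unfolding satisfies_def
    proof clarify
      fix a b' assume "(a, b') \<in> C"
      then consider i where "i < ?k" "(a, b') = unit_row i" | "a = s" "b' = 1" | "a = (\<lambda>i. - s i)" "b' = -1"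
        | l where "l \<in> {1..r}" "a = avg l" "b' = 0" by (auto simp: C_def)
      then show "of_int b' \<le> row_value ?k a z0"
      proof cases
        case 1
        then have "b' = 0" "a = fst (unit_row i)" by (auto simp: unit_row_def)
        then show ?thesis using row_value_unit[OF 1(1), of z0] x b by (auto simp: z0_def)
      next
        case 2
        then show ?thesis using s_value z0[of "\<lambda>_. 1"] x by simp
      next
        case 3
        then show ?thesis using ms_value z0[of "\<lambda>_. 1"] x by simp
      next
        case 4
        then show ?thesis using avg_value[of l z0] z0[of "\<lambda>i. real (Y l i)"] b(2)[OF 4(1)] by (simp add: z0_def[of 0])
      qed
    qed
    fix a b' assume "(a, b') \<in> C"
    then consider i where "(a, b') = unit_row i" | "a = s" "b' = 1" | "a = (\<lambda>i. - s i)" "b' = -1"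
        | l where "l \<in> {1..r}" "a = avg l" "b' = 0" by (auto simp: C_def)
    note cases = this
    have iM: "int 1 \<le> int ?M" using M(1) by (simp only: of_nat_le_iff)
    show "\<bar>b'\<bar> \<le> int ?M" using cases iM
      by cases (auto simp: unit_row_def simp del: of_nat_mult of_nat_Suc mult_Suc_right)
    fix j
    show "\<bar>a j\<bar> \<le> int ?M" using cases
    proof cases
      case 4
      have "Y l j \<le> ?M" if "j \<in> {1..q}" using Y[OF 4(1) that] by simp
      then show ?thesis using 4 M by (auto simp: avg_def simp del: of_nat_mult of_nat_Suc mult_Suc_right)
    qed (use iM in \<open>auto simp: unit_row_def s_def simp del: of_nat_mult of_nat_Suc mult_Suc_right\<close>)
  qed
  then obtain z m where z: "satisfies ?k C z" "z 0 \<le> z0 0"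
    and zm: "\<forall>i<?k. real N2 * z i = real (m i) \<and> m i \<le> N2 * weight_height r n"
    unfolding c_value wh[symmetric] N2_def[symmetric] by (elim exE conjE) (rule that)
  have m: "real N2 * z i = real (m i)" "m i \<le> N2 * weight_height r n" if "i < ?k" for i
    using zm that by simp_all
  have mz: "(\<Sum>i\<in>{1..q}. real (m i) * g i) = real N2 * (\<Sum>i\<in>{1..q}. z i * g i)" for g
    unfolding sum_distrib_left using m(1) q by (intro sum.cong) (auto simp: mult.assoc[symmetric])
  have "1 \<le> row_value ?k s z" "- 1 \<le> row_value ?k (\<lambda>i. - s i) z"
    using z(1) unfolding satisfies_def C_def by force+
  then have "(\<Sum>i\<in>{1..q}. z i) = 1" unfolding s_value ms_value by linarith
  then have "real (\<Sum>i\<in>{1..q}. m i) = real N2" using mz[of "\<lambda>_. 1"] by simp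
  then have sum_m: "(\<Sum>i\<in>{1..q}. m i) = N2" by (simp only: of_nat_eq_iff)
  have avg_m: "(\<Sum>i\<in>{1..q}. m i * Y l i) \<le> N1 * m 0" if l: "l \<in> {1..r}" for l
  proof -
    have "(avg l, 0) \<in> C" using l by (simp add: C_def)
    then have "0 \<le> row_value ?k (avg l) z" using z(1) by (force simp: satisfies_def)
    then have "real N2 * (\<Sum>i\<in>{1..q}. z i * real (Y l i)) \<le> real N2 * (real N1 * z 0)"
      unfolding avg_value by (intro mult_left_mono) auto
    also have "\<dots> = real N1 * real (m 0)" using m(1)[of 0] by (simp add: mult_ac)
    finally have "real (\<Sum>i\<in>{1..q}. m i * Y l i) \<le> real (N1 * m 0)"
      unfolding mz[symmetric] by simp
    then show ?thesis by (simp only: of_nat_le_iff)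
  qed
  have "real (m 0) \<le> real N2 * b"
    using m(1)[of 0] z(2) by (metis z0_def mult_left_mono of_nat_0_le_iff zero_less_Suc)
  then show ?thesis
    using m(2) sum_m avg_m by (intro exI[of _ m]) (auto simp: N2_def)
qed

lemma certificate_complete:
  assumes P: "presents n es H" and H: "finite_graph H" "verts H \<noteq> {}" and b: "cover_bound r H b"
  shows "\<exists>p q lam X Y. certificate r n es p q lam X Y \<and> real p \<le> fact (weight_height r n) * b \<and>
     p \<le> fact (weight_height r n) * weight_height r n \<and>
     (\<forall>i<Suc r. X i \<le> fact (weight_height r n) * weight_height r n) \<and>
     (\<forall>l\<in>{1..r}. \<forall>i<Suc r. Y l i \<le> fact (cover_height r n) * cover_height r n)"
proof -
  obtain g where g: "bij_betw g {..<n} (verts H)" "edges H = {{g u, g v} | u v. (u, v) \<in> set es}"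
    using P by (auto simp: presents_def)
  have n: "card (verts H) = n" using bij_betw_same_card[OF g(1)] by simp
  define N1 where "N1 = (fact (cover_height r n) :: nat)"
  have N1: "0 < N1" by (simp add: N1_def)
  obtain q lam x y where q: "1 \<le> q" "q \<le> r" "strip_template r q lam"
    and x: "\<And>i. i \<in> {1..q} \<Longrightarrow> 0 \<le> x i" "(\<Sum>i\<in>{1..q}. x i) = 1"
    and y: "template_cover r H {1..q} lam y"
    and le: "\<And>l. l \<in> {1..r} \<Longrightarrow> (\<Sum>i\<in>{1..q}. x i * y l i) \<le> b"
    using b unfolding cover_bound_def weight_simplex_def by blast
  have "0 \<le> (\<Sum>i\<in>{1..q}. x i * y 1 i)"
    using x y q by (intro sum_nonneg mult_nonneg_nonneg) (auto simp: template_cover_def)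
  also have "\<dots> \<le> b" using q by (intro le) auto
  finally have b0: "0 \<le> b" .
  define good where "good l z Y' \<longleftrightarrow> (\<forall>i\<in>{1..q}. real N1 * z i = real (Y' i)) \<and>
     (\<forall>i<Suc r. Y' i \<le> N1 * cover_height r n) \<and>
     (\<Sum>i\<in>{1..q}. x i * z i) \<le> (\<Sum>i\<in>{1..q}. x i * y l i) \<and>
     (\<forall>f\<in>verts H \<rightarrow> {1..q}. (\<forall>u v. {u, v} \<in> edges H \<longrightarrow> lam (f u) (f v) = l) \<longrightarrow>
        1 \<le> (\<Sum>v\<in>verts H. z (f v)))" for l and z :: "nat \<Rightarrow> real" and Y' :: "nat \<Rightarrow> nat"
  have "\<exists>p. good l (fst p) (snd p)" if "l \<in> {1..r}" for l
    using cover_vertex[where x = x, OF H q(2) x(1) y that] unfolding good_def n N1_def by auto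
  then obtain w where w: "\<And>l. l \<in> {1..r} \<Longrightarrow> good l (fst (w l)) (snd (w l))" by metis
  define z where "z l = fst (w l)" for l
  define Y where "Y l = snd (w l)" for l
  have zY: "good l (z l) (Y l)" if "l \<in> {1..r}" for l using w[OF that] by (simp add: z_def Y_def)
  have "\<exists>X. (\<forall>i<Suc r. X i \<le> fact (weight_height r n) * weight_height r n) \<and>
     (\<Sum>i\<in>{1..q}. X i) = fact (weight_height r n) \<and>
     (\<forall>l\<in>{1..r}. (\<Sum>i\<in>{1..q}. X i * Y l i) \<le> N1 * X 0) \<and>
     real (X 0) \<le> fact (weight_height r n) * b"
  proof (rule weight_vertex[where x = x, OF q(1,2) x N1_def _ b0])
    fix l assume l: "l \<in> {1..r}"
    show "Y l i \<le> N1 * cover_height r n" if "i \<in> {1..q}" for i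
      using zY[OF l] that q(2) by (simp add: good_def)
    have "(\<Sum>i\<in>{1..q}. x i * real (Y l i)) = real N1 * (\<Sum>i\<in>{1..q}. x i * z l i)"
      unfolding sum_distrib_left
    proof (rule sum.cong)
      fix i assume "i \<in> {1..q}"
      then have "real N1 * z l i = real (Y l i)" using zY[OF l] by (simp add: good_def)
      then show "x i * real (Y l i) = real N1 * (x i * z l i)" by (metis mult.left_commute)
    qed simp
    also have "\<dots> \<le> real N1 * b" using zY[OF l] le[OF l] by (intro mult_left_mono) (auto simp: good_def)
    finally show "(\<Sum>i\<in>{1..q}. x i * real (Y l i)) \<le> real N1 * b" .
  qed
  then obtain X where X: "\<forall>i<Suc r. X i \<le> fact (weight_height r n) * weight_height r n"
    "(\<Sum>i\<in>{1..q}. X i) = fact (weight_height r n)"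
    "\<forall>l\<in>{1..r}. (\<Sum>i\<in>{1..q}. X i * Y l i) \<le> N1 * X 0"
    "real (X 0) \<le> fact (weight_height r n) * b" by blast
  have "fact (cover_height r n) \<le> (\<Sum>v<n. Y l (f v))"
    if l: "l \<in> {1..r}" and f: "\<forall>v<n. f v \<in> {1..q}" "\<forall>(u, v)\<in>set es. lam (f u) (f v) = l" for l f
  proof -
    define f' where "f' v = f (inv_into {..<n} g v)" for v
    have f'g: "f' (g v) = f v" if "v < n" for v
      using g(1) that by (simp add: f'_def bij_betw_def inv_into_f_f)
    have f'q: "f' v \<in> {1..q}" if "v \<in> verts H" for v
      using f(1) inv_into_into[of v g "{..<n}"] g(1) that by (auto simp: f'_def bij_betw_def)
    have "\<forall>(u, v)\<in>set es. lam (f' (g u)) (f' (g v)) = l"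
      using f(2) f'g P by (fastforce simp: presents_def)
    moreover have "(\<forall>u v. {u, v} \<in> edges H \<longrightarrow> lam (f' u) (f' v) = l) \<longleftrightarrow>
        (\<forall>(u, v)\<in>set es. lam (f' (g u)) (f' (g v)) = l)"
      by (rule presents_edge_iff[where q = q, OF P g]) (use q(3) f'q in \<open>auto simp: strip_template_def\<close>)
    ultimately have hom: "\<forall>u v. {u, v} \<in> edges H \<longrightarrow> lam (f' u) (f' v) = l" by (simp only:)
    have "real N1 * 1 \<le> real N1 * (\<Sum>v\<in>verts H. z l (f' v))"
      using zY[OF l] hom f'q by (intro mult_left_mono) (auto simp: good_def)
    also have "\<dots> = (\<Sum>v\<in>verts H. real (Y l (f' v)))"
      unfolding sum_distrib_left using zY[OF l] f'q by (intro sum.cong) (auto simp: good_def)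
    also have "\<dots> = (\<Sum>v<n. real (Y l (f' (g v))))"
      by (rule sum.reindex_bij_betw[OF g(1), symmetric])
    also have "\<dots> = (\<Sum>v<n. real (Y l (f v)))" using f'g by (intro sum.cong) auto
    finally have "real N1 \<le> real (\<Sum>v<n. Y l (f v))" by simp
    then show ?thesis by (simp only: of_nat_le_iff N1_def)
  qed
  then have "certificate r n es (X 0) q lam X Y"
    unfolding certificate_def using q X(2,3) by (simp add: N1_def)
  then show ?thesis
    using X(1,4) zY by (intro exI[of _ "X 0"] exI[of _ q] exI[of _ lam] exI[of _ X] exI[of _ Y])
      (auto simp: good_def N1_def)
qed


section \<open>The algorithm\<close>

definition in_r :: "nat \<Rightarrow> nat" where "in_r a = fst (prod_decode a)"
definition in_n :: "nat \<Rightarrow> nat" where "in_n a = fst (prod_decode (snd (prod_decode a)))"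
definition in_es :: "nat \<Rightarrow> nat" where "in_es a = snd (prod_decode (snd (prod_decode a)))"

text \<open>A table with index pairs \<open>(i, j)\<close>, where \<open>j \<le> r\<close>, is stored row by row.\<close>

definition code_nth2 :: "nat \<Rightarrow> nat \<Rightarrow> nat \<Rightarrow> nat \<Rightarrow> nat" where
  "code_nth2 r c i j = code_nth c (i * Suc r + j)"

definition code_hom :: "nat \<Rightarrow> nat \<Rightarrow> nat \<Rightarrow> nat \<Rightarrow> nat \<Rightarrow> nat \<Rightarrow> nat \<Rightarrow> bool" where
  "code_hom r n E q lamc l fc \<longleftrightarrow>
     (\<forall>v<n. 1 \<le> code_nth fc v \<and> code_nth fc v \<le> q) \<and>
     (\<forall>k<E. \<not> code_drop E k = 0 \<longrightarrow>
        code_nth2 r lamc (code_nth fc (fst (prod_decode (code_nth E k))))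
          (code_nth fc (snd (prod_decode (code_nth E k)))) = l)"

definition code_certificate :: "nat \<Rightarrow> nat \<Rightarrow> nat \<Rightarrow> nat \<Rightarrow> nat \<Rightarrow> nat \<Rightarrow> nat \<Rightarrow> nat \<Rightarrow> bool" where
  "code_certificate r n E p q lamc Xc Yc \<longleftrightarrow> 1 \<le> q \<and>
     (\<forall>i<q. \<forall>j<q. 1 \<le> code_nth2 r lamc (Suc i) (Suc j) \<and> code_nth2 r lamc (Suc i) (Suc j) \<le> r \<and>
        code_nth2 r lamc (Suc j) (Suc i) = code_nth2 r lamc (Suc i) (Suc j)) \<and>
     (\<Sum>i<q. code_nth Xc (Suc i)) = fact (weight_height r n) \<and>
     (\<forall>l<r. (\<Sum>i<q. code_nth Xc (Suc i) * code_nth2 r Yc (Suc l) (Suc i)) \<le> fact (cover_height r n) * p) \<and>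
     (\<forall>l<r. \<forall>fc<Suc (code_bound n r). code_hom r n E q lamc (Suc l) fc \<longrightarrow>
        fact (cover_height r n) \<le> (\<Sum>v<n. code_nth2 r Yc (Suc l) (code_nth fc v)))"

definition has_certificate :: "nat \<Rightarrow> nat \<Rightarrow> nat \<Rightarrow> nat \<Rightarrow> bool" where
  "has_certificate r n E p \<longleftrightarrow>
     (\<exists>q<Suc r. \<exists>lamc<Suc (code_bound (Suc r * Suc r) r).
      \<exists>Xc<Suc (code_bound (Suc r) (fact (weight_height r n) * weight_height r n)).
      \<exists>Yc<Suc (code_bound (Suc r * Suc r) (fact (cover_height r n) * cover_height r n)).
        code_certificate r n E p q lamc Xc Yc)"

definition numerator :: "nat \<Rightarrow> nat \<Rightarrow> nat \<Rightarrow> nat" where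
  "numerator r n E = (LEAST p. p = fact (weight_height r n) * weight_height r n \<or> has_certificate r n E p)"

text \<open>Since \<open>int_encode (-1) = 1\<close> and \<open>int_encode (int p) = 2 * p\<close>, this is the code of the program of
  minimizing \<open>(p / d) * x\<close> subject to \<open>- x \<le> - 1\<close>.\<close>

definition lp_code :: "nat \<Rightarrow> nat \<Rightarrow> nat" where
  "lp_code p d = prod_encode (Suc (prod_encode (prod_encode (2 * p, d), 0)),
     Suc (prod_encode (prod_encode (Suc (prod_encode (prod_encode (1, 1), 0)), prod_encode (1, 1)), 0)))"

definition beta_algorithm :: "nat \<Rightarrow> nat" where
  "beta_algorithm a = Suc (prod_encode (lp_code (numerator (in_r a) (in_n a) (in_es a))
     (fact (weight_height (in_r a) (in_n a))), 0))"

lemma sum_Suc_index: "(\<Sum>i<q. g (Suc i)) = (\<Sum>i\<in>{1..q}. g i)"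
  by (rule sum.reindex_bij_witness[of _ "\<lambda>i. i - 1" Suc]) auto

lemma all_Suc_index: "(\<forall>i<q. P (Suc i)) \<longleftrightarrow> (\<forall>i\<in>{1..q}. P i)"
  by (metis Suc_le_eq Suc_le_mono atLeastAtMost_iff le_add1 not0_implies_Suc not_one_le_zero plus_1_eq_Suc)

lemma code_hom_iff:
  assumes es: "\<forall>(u, v)\<in>set es. u < n \<and> v < n"
  shows "code_hom r n (list_encode (map prod_encode es)) q lamc l fc \<longleftrightarrow>
    (\<forall>v<n. code_nth fc v \<in> {1..q}) \<and>
    (\<forall>(u, v)\<in>set es. code_nth2 r lamc (code_nth fc u) (code_nth fc v) = l)"
  unfolding code_hom_def
    all_in_list_iff_code[of "map prod_encode es" "\<lambda>x. code_nth2 r lamc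
      (code_nth fc (fst (prod_decode x))) (code_nth fc (snd (prod_decode x))) = l", symmetric]
  by auto

lemma code_certificate_iff:
  assumes es: "\<forall>(u, v)\<in>set es. u < n \<and> v < n" and q: "q \<le> r"
  shows "code_certificate r n (list_encode (map prod_encode es)) p q lamc Xc Yc \<longleftrightarrow>
    certificate r n es p q (code_nth2 r lamc) (code_nth Xc) (code_nth2 r Yc)"
proof -
  let ?E = "list_encode (map prod_encode es)" and ?N1 = "fact (cover_height r n) :: nat"
  have homs: "(\<forall>fc<Suc (code_bound n r). code_hom r n ?E q lamc l fc \<longrightarrow>
        ?N1 \<le> (\<Sum>v<n. code_nth2 r Yc l (code_nth fc v))) \<longleftrightarrow>
      (\<forall>f. (\<forall>v<n. f v \<in> {1..q}) \<and> (\<forall>(u, v)\<in>set es. code_nth2 r lamc (f u) (f v) = l) \<longrightarrow>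
        ?N1 \<le> (\<Sum>v<n. code_nth2 r Yc l (f v)))" (is "?L \<longleftrightarrow> ?R") for l
  proof
    assume L: ?L
    show ?R
    proof (intro allI impI, elim conjE)
      fix f assume f: "\<forall>v<n. f v \<in> {1..q}" "\<forall>(u, v)\<in>set es. code_nth2 r lamc (f u) (f v) = l"
      have nth: "code_nth (table_code f n) v = f v" if "v < n" for v by (rule code_nth_table[OF that])
      have "table_code f n < Suc (code_bound n r)" using f(1) q by (intro table_code_bound) fastforce
      moreover have "code_hom r n ?E q lamc l (table_code f n)"
        unfolding code_hom_iff[OF es] using f es nth by fastforce
      ultimately have "?N1 \<le> (\<Sum>v<n. code_nth2 r Yc l (code_nth (table_code f n) v))" using L by blast
      also have "\<dots> = (\<Sum>v<n. code_nth2 r Yc l (f v))" using nth by (intro sum.cong) auto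
      finally show "?N1 \<le> (\<Sum>v<n. code_nth2 r Yc l (f v))" .
    qed
  next
    assume R: ?R
    show ?L
    proof (intro allI impI)
      fix fc assume "code_hom r n ?E q lamc l fc"
      then show "?N1 \<le> (\<Sum>v<n. code_nth2 r Yc l (code_nth fc v))"
        unfolding code_hom_iff[OF es] by (rule R[rule_format])
    qed
  qed
  have lam: "(\<forall>i<q. \<forall>j<q. 1 \<le> code_nth2 r lamc (Suc i) (Suc j) \<and> code_nth2 r lamc (Suc i) (Suc j) \<le> r \<and>
        code_nth2 r lamc (Suc j) (Suc i) = code_nth2 r lamc (Suc i) (Suc j)) \<longleftrightarrow>
      strip_template r q (code_nth2 r lamc)"
    unfolding strip_template_def
    all_Suc_index[of q "\<lambda>j. 1 \<le> code_nth2 r lamc (Suc i) j \<and> code_nth2 r lamc (Suc i) j \<le> r \<and>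
        code_nth2 r lamc j (Suc i) = code_nth2 r lamc (Suc i) j" for i]
    all_Suc_index[of q "\<lambda>i. \<forall>j\<in>{1..q}. 1 \<le> code_nth2 r lamc i j \<and> code_nth2 r lamc i j \<le> r \<and>
        code_nth2 r lamc j i = code_nth2 r lamc i j"]
    by (simp add: conj_assoc)
  show ?thesis
    unfolding code_certificate_def certificate_def lam homs
      sum_Suc_index[of "\<lambda>i. code_nth Xc i"] sum_Suc_index[of "\<lambda>i. code_nth Xc i * code_nth2 r Yc l i" for l]
      all_Suc_index[of r "\<lambda>l. (\<Sum>i\<in>{1..q}. code_nth Xc i * code_nth2 r Yc l i) \<le> ?N1 * p"]
      all_Suc_index[of r "\<lambda>l. \<forall>f. (\<forall>v<n. f v \<in> {1..q}) \<and> (\<forall>(u, v)\<in>set es. code_nth2 r lamc (f u) (f v) = l) \<longrightarrow>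
        ?N1 \<le> (\<Sum>v<n. code_nth2 r Yc l (f v))"]
    using q by blast
qed

text \<open>The tables that are read from a code agree with given functions only in the range of the indices.\<close>

lemma certificate_cong:
  assumes C: "certificate r n es p q lam X Y" and es: "\<forall>(u, v)\<in>set es. u < n \<and> v < n"
    and lam: "\<And>i j. i \<in> {1..q} \<Longrightarrow> j \<in> {1..q} \<Longrightarrow> lam' i j = lam i j"
    and X: "\<And>i. i \<in> {1..r} \<Longrightarrow> X' i = X i"
    and Y: "\<And>l i. l \<in> {1..r} \<Longrightarrow> i \<in> {1..r} \<Longrightarrow> Y' l i = Y l i"
  shows "certificate r n es p q lam' X' Y'"
proof -
  have q: "1 \<le> q" "q \<le> r" using C by (auto simp: certificate_def)
  have sub: "i \<in> {1..r}" if "i \<in> {1..q}" for i using that q by auto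
  show ?thesis
    unfolding certificate_def
  proof (intro conjI ballI allI impI)
    show "strip_template r q lam'"
    proof -
      have "strip_template r q lam" using C by (simp add: certificate_def)
      moreover have "lam' i j = lam i j" if "i \<in> {1..q}" "j \<in> {1..q}" for i j
        using lam that by simp
      ultimately show ?thesis unfolding strip_template_def by simp
    qed
    show "(\<Sum>i\<in>{1..q}. X' i) = fact (weight_height r n)"
    proof -
      have "(\<Sum>i\<in>{1..q}. X' i) = (\<Sum>i\<in>{1..q}. X i)" using X sub by (intro sum.cong) auto
      then show ?thesis using C by (simp add: certificate_def)
    qed
    fix l assume l: "l \<in> {1..r}"
    have "(\<Sum>i\<in>{1..q}. X' i * Y' l i) = (\<Sum>i\<in>{1..q}. X i * Y l i)"
      using X Y[OF l] sub by (intro sum.cong) auto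
    then show "(\<Sum>i\<in>{1..q}. X' i * Y' l i) \<le> fact (cover_height r n) * p"
      using C l by (simp add: certificate_def)
    fix f assume f: "(\<forall>v<n. f v \<in> {1..q}) \<and> (\<forall>(u, v)\<in>set es. lam' (f u) (f v) = l)"
    have "lam (f u) (f v) = l" if "(u, v) \<in> set es" for u v
    proof -
      have "f u \<in> {1..q}" "f v \<in> {1..q}" using es f that by auto
      then have "lam' (f u) (f v) = lam (f u) (f v)" by (rule lam)
      then show ?thesis using f that by auto
    qed
    then have "(\<forall>v<n. f v \<in> {1..q}) \<and> (\<forall>(u, v)\<in>set es. lam (f u) (f v) = l)" using f by auto
    moreover from C have "\<forall>l\<in>{1..r}. \<forall>f. (\<forall>v<n. f v \<in> {1..q}) \<and> (\<forall>(u, v)\<in>set es. lam (f u) (f v) = l) \<longrightarrow>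
        fact (cover_height r n) \<le> (\<Sum>v<n. Y l (f v))"
      unfolding certificate_def by (elim conjE)
    ultimately have "fact (cover_height r n) \<le> (\<Sum>v<n. Y l (f v))" using l by simp
    also have "\<dots> = (\<Sum>v<n. Y' l (f v))" using Y[OF l] f sub by (intro sum.cong) auto
    finally show "fact (cover_height r n) \<le> (\<Sum>v<n. Y' l (f v))" .
  qed (use q in auto)
qed

lemma code_nth2_table:
  assumes "i \<le> r" "j \<le> r"
  shows "code_nth2 r (table_code (\<lambda>k. F (k div Suc r) (k mod Suc r)) (Suc r * Suc r)) i j = F i j"
proof -
  have "i * Suc r + j < Suc i * Suc r" using assms by simp
  also have "\<dots> \<le> Suc r * Suc r" using assms by (intro mult_right_mono) auto
  finally have lt: "i * Suc r + j < Suc r * Suc r" .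
  have "(i * Suc r + j) div Suc r = i" "(i * Suc r + j) mod Suc r = j"
    using assms by (simp_all only: div_mult_self3 mod_mult_self3 div_less mod_less le_imp_less_Suc)
  then show ?thesis unfolding code_nth2_def code_nth_table[OF lt] by simp
qed

lemma has_certificate_sound:
  assumes "presents n es H" "has_certificate r n (list_encode (map prod_encode es)) p"
  shows "cover_bound r H (real p / fact (weight_height r n))"
proof -
  have es: "\<forall>(u, v)\<in>set es. u < n \<and> v < n" using assms(1) by (simp add: presents_def)
  obtain q lamc Xc Yc where "q < Suc r" "code_certificate r n (list_encode (map prod_encode es)) p q lamc Xc Yc"
    using assms(2) unfolding has_certificate_def by auto
  then have "certificate r n es p q (code_nth2 r lamc) (code_nth Xc) (code_nth2 r Yc)"
    using code_certificate_iff[OF es] by simp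
  then show ?thesis by (rule certificate_sound[OF assms(1)])
qed

lemma has_certificate_complete:
  assumes P: "presents n es H" and H: "finite_graph H" "verts H \<noteq> {}" and b: "cover_bound r H b"
  shows "\<exists>p. has_certificate r n (list_encode (map prod_encode es)) p \<and>
     real p \<le> fact (weight_height r n) * b \<and> p \<le> fact (weight_height r n) * weight_height r n"
proof -
  let ?W = "fact (weight_height r n) * weight_height r n" and ?C = "fact (cover_height r n) * cover_height r n"
  have es: "\<forall>(u, v)\<in>set es. u < n \<and> v < n" using P by (simp add: presents_def)
  from certificate_complete[OF assms] obtain p q lam X Y where C: "certificate r n es p q lam X Y"
    and p: "real p \<le> fact (weight_height r n) * b" "p \<le> ?W"
    and X: "\<forall>i<Suc r. X i \<le> ?W" and Y: "\<forall>l\<in>{1..r}. \<forall>i<Suc r. Y l i \<le> ?C"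
    by (elim exE conjE) (rule that)
  have q: "q \<le> r" using C by (simp add: certificate_def)
  \<comment> \<open>Values outside the ranges of the indices may be large; clipping bounds the codes of the tables.\<close>
  define lam' where "lam' i j = min r (lam i j)" for i j
  define Y' where "Y' l i = min ?C (Y l i)" for l i
  define lamc where "lamc = table_code (\<lambda>k. lam' (k div Suc r) (k mod Suc r)) (Suc r * Suc r)"
  define Xc where "Xc = table_code X (Suc r)"
  define Yc where "Yc = table_code (\<lambda>k. Y' (k div Suc r) (k mod Suc r)) (Suc r * Suc r)"
  have C': "certificate r n es p q lam' X Y'"
  proof (rule certificate_cong[OF C es])
    show "lam' i j = lam i j" if "i \<in> {1..q}" "j \<in> {1..q}" for i j
      using C that by (simp add: certificate_def strip_template_def lam'_def)
    show "Y' l i = Y l i" if "l \<in> {1..r}" "i \<in> {1..r}" for l i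
      using Y that by (simp add: Y'_def min_absorb2)
  qed simp
  have "certificate r n es p q (code_nth2 r lamc) (code_nth Xc) (code_nth2 r Yc)"
  proof (rule certificate_cong[OF C' es])
    show "code_nth2 r lamc i j = lam' i j" if "i \<in> {1..q}" "j \<in> {1..q}" for i j
      unfolding lamc_def using that q by (intro code_nth2_table) auto
    show "code_nth Xc i = X i" if "i \<in> {1..r}" for i
      unfolding Xc_def using that by (intro code_nth_table) auto
    show "code_nth2 r Yc l i = Y' l i" if "l \<in> {1..r}" "i \<in> {1..r}" for l i
      unfolding Yc_def using that by (intro code_nth2_table) auto
  qed
  then have "code_certificate r n (list_encode (map prod_encode es)) p q lamc Xc Yc"
    using code_certificate_iff[OF es q] by simp
  moreover have "lamc < Suc (code_bound (Suc r * Suc r) r)"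
    unfolding lamc_def by (rule table_code_bound) (simp add: lam'_def)
  moreover have "Xc < Suc (code_bound (Suc r) ?W)"
    unfolding Xc_def by (rule table_code_bound) (use X in simp)
  moreover have "Yc < Suc (code_bound (Suc r * Suc r) ?C)"
    unfolding Yc_def by (rule table_code_bound) (simp add: Y'_def)
  moreover have "q < Suc r" using q by simp
  ultimately have "has_certificate r n (list_encode (map prod_encode es)) p"
    unfolding has_certificate_def by blast
  then show ?thesis using p by blast
qed

text \<open>Certificates are covers, so their bounds are at least \<open>beta\<close>; and covers whose averages are arbitrarily
  close to \<open>beta\<close> lead to certificates, whose bounds are not below that of the least numerator.\<close>

lemma beta_eq_numerator:
  assumes r: "1 \<le> r" and P: "presents n es H" and H: "finite_graph H" "edges H \<noteq> {}"
  shows "beta r H = real (numerator r n (list_encode (map prod_encode es))) / fact (weight_height r n)"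
proof -
  let ?E = "list_encode (map prod_encode es)" and ?W = "fact (weight_height r n) * weight_height r n"
  define N2 where "N2 = (fact (weight_height r n) :: real)"
  have N2: "0 < N2" by (simp add: N2_def)
  have vH: "verts H \<noteq> {}" by (rule verts_nonempty[OF H])
  define p0 where "p0 = numerator r n ?E"
  have least: "p0 \<le> p" if "has_certificate r n ?E p" for p
    unfolding p0_def numerator_def using that by (intro Least_le) simp
  have "p0 = ?W \<or> has_certificate r n ?E p0"
    unfolding p0_def numerator_def by (rule LeastI[of _ ?W]) simp
  moreover obtain p1 where "has_certificate r n ?E p1" "p1 \<le> ?W"
    using has_certificate_complete[OF P H(1) vH cover_bound_near_beta[OF r H zero_less_one]] by blast
  ultimately have cert: "has_certificate r n ?E p0" using least by (metis order_antisym)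
  have "beta r H \<le> real p0 / N2"
    unfolding N2_def by (rule beta_le_cover_bound[OF r H(1) vH has_certificate_sound[OF P cert]])
  moreover have "real p0 / N2 \<le> beta r H"
  proof (rule field_le_epsilon)
    fix \<epsilon> :: real assume "0 < \<epsilon>"
    then obtain p where p: "has_certificate r n ?E p" "real p \<le> N2 * (beta r H + \<epsilon>)"
      using has_certificate_complete[OF P H(1) vH cover_bound_near_beta[OF r H]] unfolding N2_def by blast
    have "real p0 \<le> real p" using least[OF p(1)] by simp
    then have "real p0 \<le> (beta r H + \<epsilon>) * N2" using p(2) by (simp add: mult.commute)
    then show "real p0 / N2 \<le> beta r H + \<epsilon>" using N2 by (simp add: pos_divide_le_eq)
  qed
  ultimately show ?thesis by (simp add: p0_def N2_def)
qed

lemma decode_lp_code: "decode_lp (lp_code p d) = ([of_nat p / of_nat d], [([-1], -1)])"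
proof -
  have singleton: "list_decode (Suc (prod_encode (x, 0))) = [x]" for x
    using list_encode_inverse[of "[x]"] by simp
  have "int_decode (2 * p) = int p" "int_decode 1 = -1"
    by (simp_all add: int_decode_def sum_decode_def)
  then show ?thesis
    by (simp add: decode_lp_def lp_code_def singleton decode_row_def decode_rat_def del: list_decode.simps)
qed

lemma computed_by_single_lp:
  assumes "0 < p" "0 < d"
  shows "computed_by_lps [([of_nat p / of_nat d], [([-1], -1)])] (real p / real d)"
proof -
  let ?P = "([of_nat p / of_nat d], [([-1], -1)]) :: rat_lp"
  have c: "(of_rat (of_nat p / of_nat d) :: real) = real p / real d" by (simp add: of_rat_divide)
  have "lp_optimum ?P (real p / real d)"
    unfolding lp_optimum_def
  proof (intro conjI allI impI)
    show "\<exists>x. lp_feasible ?P x \<and> lp_dot (fst ?P) x = real p / real d"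
      using c by (intro exI[of _ "[1]"]) (simp add: lp_feasible_def lp_dot_def of_rat_minus)
    fix x assume "lp_feasible ?P x"
    then have "1 \<le> x ! 0" by (simp add: lp_feasible_def lp_dot_def of_rat_minus)
    then have "real p / real d * 1 \<le> real p / real d * x ! 0" by (intro mult_left_mono) auto
    then show "real p / real d \<le> lp_dot (fst ?P) x" using c by (simp add: lp_dot_def)
  qed
  then show ?thesis
    unfolding computed_by_lps_def lp_wf_def by (auto intro!: exI[of _ "[real p / real d]"])
qed

lemma beta_algorithm_correct:
  assumes r: "1 \<le> r" and P: "presents n es H" and H: "finite_graph H" "edges H \<noteq> {}"
  shows "computed_by_lps (decode_lps (beta_algorithm (encode_input r n es))) (beta r H)"
proof -
  let ?p = "numerator r n (list_encode (map prod_encode es))" and ?d = "fact (weight_height r n) :: nat"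
  have "list_decode (Suc (prod_encode (x, 0))) = [x]" for x
    using list_encode_inverse[of "[x]"] by simp
  then have "decode_lps (beta_algorithm (encode_input r n es)) = [([of_nat ?p / of_nat ?d], [([-1], -1)])]"
    by (simp add: decode_lps_def beta_algorithm_def encode_input_def in_r_def in_n_def in_es_def
      decode_lp_code del: list_decode.simps of_nat_fact)
  moreover have beta: "beta r H = real ?p / real ?d" using beta_eq_numerator[OF assms] by simp
  moreover have "0 < ?p" using beta beta_pos[OF r H(1) verts_nonempty[OF H]] by (cases "?p = 0") auto
  ultimately show ?thesis using computed_by_single_lp[of ?p ?d] by simp
qed

lemmas recursive_rules =
  recursive_base recursive_add recursive_mult recursive_diff recursive_power recursive_fact
  recursive_sum recursive_code_nth recursive_code_drop recursive_code_bound
  decidable_le decidable_eq decidable_conj decidable_imp decidable_not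
  decidable_all_less decidable_ex_less

lemma recursive_weight_height:
  assumes "recursive r" "recursive n"
  shows "recursive (\<lambda>a. weight_height (r a) (n a))" "recursive (\<lambda>a. cover_height (r a) (n a))"
  unfolding weight_height_def cover_height_def height_bound_def by (intro recursive_rules assms)+

lemma recursive_beta_algorithm: "recursive beta_algorithm"
proof -
  have "decidable (\<lambda>c. has_certificate (in_r (fst (prod_decode c))) (in_n (fst (prod_decode c)))
      (in_es (fst (prod_decode c))) (snd (prod_decode c)))"
    unfolding has_certificate_def code_certificate_def code_hom_def code_nth2_def in_r_def in_n_def in_es_def
    by (intro recursive_rules recursive_weight_height)
  then have "recursive (\<lambda>a. numerator (in_r a) (in_n a) (in_es a))"
    unfolding numerator_def
    by (intro recursive_bounded_search)
       (unfold in_r_def in_n_def, intro recursive_rules recursive_weight_height)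
  moreover have "recursive (\<lambda>a. weight_height (in_r a) (in_n a))"
    unfolding in_r_def in_n_def by (intro recursive_rules recursive_weight_height)
  ultimately show ?thesis
    unfolding beta_algorithm_def[abs_def] lp_code_def by (intro recursive_rules)
qed

theorem theorem1p7:
  shows "\<exists>A. recursive A \<and>
    (\<forall>(r :: nat) (H :: 'a graph). r \<ge> 2 \<and> finite_graph H \<and> edges H \<noteq> {} \<longrightarrow>
       beta r H > 0 \<and>
       (\<forall>n es. presents n es H \<longrightarrow>
          computed_by_lps (decode_lps (A (encode_input r n es))) (beta r H)) \<and>
       (\<lambda>n. real (Rt r H n) - beta r H * real n) \<in> o(\<lambda>n. real n) \<and>
       (\<lambda>k. real (ramsey_number r (disjoint_copies k H)) - (1 / beta r H) * real k)
         \<in> o(\<lambda>k. real k))"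
proof (intro exI[of _ beta_algorithm] conjI allI impI; (elim conjE)?)
  show "recursive beta_algorithm" by (rule recursive_beta_algorithm)
next
  fix r :: nat and H :: "'a graph"
  assume "2 \<le> r" and H: "finite_graph H" "edges H \<noteq> {}"
  then have r: "1 \<le> r" by simp
  show "beta r H > 0" by (rule beta_pos[OF r H(1) verts_nonempty[OF H]])
  show "computed_by_lps (decode_lps (beta_algorithm (encode_input r n es))) (beta r H)"
    if "presents n es H" for n es by (rule beta_algorithm_correct[OF r that H])
  show "(\<lambda>n. real (Rt r H n) - beta r H * real n) \<in> o(\<lambda>n. real n)"
    by (rule Rt_asymptotics[OF r H])
  show "(\<lambda>k. real (ramsey_number r (disjoint_copies k H)) - (1 / beta r H) * real k) \<in> o(\<lambda>k. real k)"
    by (rule ramsey_asymptotics[OF r H])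
qed

end
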